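(* Let $H:\mathbb{R}\times\mathbb{R}^d\times\mathbb{R}^d\to\mathbb{R}$ be a $C^2$ Hamiltonian for which there is a constant $A$ with $|d^2H(t,x,p)|\leq A$, $|dH(t,x,p)|\leq A(1+|p|)$ and $|H(t,x,p)|\leq A(1+|p|)^2$ for all $(t,x,p)$. Let $F_0\subset C^2(\mathbb{R}^d,\mathbb{R})$ be an equi-Lipschitz family and $B$ a constant such that $|d^2f_0(x)|\leq B$ for all $f_0\in F_0$, $x\in\mathbb{R}^d$, and such that $u_0:=\inf_{f_0\in F_0}f_0$ is finite valued (so $u_0$ is semi-concave and Lipschitz). Let $F$ be the family of $C^2$ solutions $f:\,]-T(B),T(B)[\times\mathbb{R}^d\to\mathbb{R}$ of $\partial_tf+H(t,x,\partial_xf)=0$ with $f(0,\cdot)=f_0$, $f_0\in F_0$. Let $v(t,x)=V_0^tu_0(x)$ be the viscosity solution and $g(t,x)=G_0^tu_0(x)$ the variational solution (for a fixed variational resolution $G$) of the Cauchy problem with initial condition $u_0$ at time $0$. Then $v$ and $g$ are semi-concave on $[0,T[\times\mathbb{R}^d$ for each $T\in\,]0,T(B)[$, and $$v\leq g\leq\inf_{f\in F}f\qquad\text{on }[0,T(B)[\times\mathbb{R}^d.$$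
   Context: The Hamilton-Jacobi equation is $\partial_tu(t,x)+H(t,x,\partial_xu(t,x))=0$ (HJ). The Hamiltonian system is $\dot q=\partial_pH(t,q,p)$, $\dot p=-\partial_qH(t,q,p)$ (complete under the assumptions on $H$). No convexity of $H$ is assumed. A function $w$ on a convex set is semi-concave if $w(z)-K\|z\|^2/2$ is concave for some constant $K$ (then $w$ is called $K$-semi-concave). For functions of $(t,x)$, this is meant jointly in $z=(t,x)$. For a locally Lipschitz function $u:\mathbb{R}^d\to\mathbb{R}$, the Clarke differential $Du(x)$ is the convex hull of the set of limits $\lim du(x_n)$ with $x_n\to x$ points of differentiability of $u$. Classical solutions (recalled facts fixing $T(\cdot)$). A function $Q^t(r)$, $t\geq0$, $r\in[0,\infty]$, with values in $[0,\infty]$, non-decreasing in $t$ and in $r$, satisfying $Q^0(r)=r$ and the semi-group property $Q^{t+s}=Q^t\circ Q^s$, is fixed, such that $T(r):=\sup\{t\geq0: Q^t(r)<\infty\}$ is positive for each $r\in[0,\infty[$ and such that: for each $s$ and each $C^2$ function $f_s$ on $\mathbb{R}^d$ with $\|d^2f_s\|_\infty\leq r$ there is a unique $C^2$ solution $f:\,]s-T(r),s+T(r)[\times\mathbb{R}^d\to\mathbb{R}$ of (HJ) with $f(s,\cdot)=f_s$, and it satisfies $\|d^2f_t\|_\infty\leq Q^{|t-s|}(r)$ (here $f_t=f(t,\cdot)$). If $f_s$ is moreover Lipschitz, then $Lip(f_t)\leq(Lip(f_s)+1)e^{A|t-s|}-1$, $|\partial_tf(t,x)|\leq A\big((Lip(f_s)+1)e^{A|t-s|}\big)^2$,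 and for each $T<T(r)$ one has $|d^2f(t,x)|\leq D$ on $]s-T,s+T[\times\mathbb{R}^d$ with $D$ depending only on $A$, $Lip(f_s)$, $Q^T(r)$. Variational solutions. A function $g:[s,\infty)\times\mathbb{R}^d\to\mathbb{R}$ is a variational solution with Lipschitz initial data $u$ at time $s$ if it is locally Lipschitz, $g(s,\cdot)=u$, it solves (HJ) almost everywhere, and for each $(t,x)$ with $t>s$ there is a trajectory $(q,p)$ of the Hamiltonian system with $q(t)=x$, $p(s)\in Du(q(s))$ and $g(t,x)=u(q(s))+\int_s^tp(\tau)\cdot\dot q(\tau)-H(\tau,q(\tau),p(\tau))\,d\tau$. A variational resolution is a family of operators $G_s^t$, $s\leq t$, from the space of Lipschitz functions on $\mathbb{R}^d$ to itself such that $(t,x)\mapsto G_s^tu(x)$ is a variational solution with initial data $u$ at time $s$ and: (1) $Lip(G_s^tu)\leq(Lip(u)+1)e^{A(t-s)}-1$ and $\|G_s^tu-u\|_\infty\leq A(t-s)\big((Lip(u)+1)e^{A(t-s)}\big)^2$; (2) $u\leq w\Rightarrow G_s^tu\leq G_s^tw$; (3) if $f:\,]T^-,T^+[\times\mathbb{R}^d\to\mathbb{R}$ is a $C^2$ solution of (HJ) then $G_s^tf_s=f_t$ for $s\leq t$ in $]T^-,T^+[$. Variational resolutions exist (not unique); one, $G$, is fixed. Viscosity solutions. A continuous function $w$ on an open subset of $\mathbb{R}\times\mathbb{R}^d$ is a viscosity solution of (HJ) if each smooth $\phi$ having a contact from above (resp. from below) with $w$ at a point $(t_0,x_0)$ satisfies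 $\partial_t\phi(t_0,x_0)+H(t_0,x_0,\partial_x\phi(t_0,x_0))\leq0$ (resp. $\geq0$). For Lipschitz $u$, $(t,x)\mapsto V_s^tu(x)$ is the unique function $v$ on $[s,\infty[\times\mathbb{R}^d$ that is a viscosity solution on $]s,\infty[\times\mathbb{R}^d$, with $v(s,\cdot)=u$ and $v(t,x)-u(x)$ bounded and Lipschitz on $]s,T[\times\mathbb{R}^d$ for each $T>s$. The operators $V_s^t$ also satisfy properties (1)-(3) above with $V$ in place of $G$, and the Markov property $V_s^t\circ V_\tau^s=V_\tau^t$ for $\tau\leq s\leq t$. *)

theory Defs
  imports "HOL-Analysis.Analysis"
begin

section \<open>Differential calculus on Euclidean spaces\<close>

text \<open>For open \<open>S\<close>, \<open>higher_differentiable_on S f n\<close> says that \<open>f\<close> is of class \<open>C\<^sup>n\<close> on \<open>S\<close>.\<close>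

primrec higher_differentiable_on :: "'a::euclidean_space set \<Rightarrow> ('a \<Rightarrow> real) \<Rightarrow> nat \<Rightarrow> bool" where
  "higher_differentiable_on S f 0 \<longleftrightarrow> continuous_on S f"
| "higher_differentiable_on S f (Suc n) \<longleftrightarrow>
     (\<forall>x\<in>S. f differentiable (at x)) \<and>
     (\<forall>h. higher_differentiable_on S (\<lambda>x. frechet_derivative f (at x) h) n)"

abbreviation C2_on :: "'a::euclidean_space set \<Rightarrow> ('a \<Rightarrow> real) \<Rightarrow> bool" where
  "C2_on S f \<equiv> higher_differentiable_on S f 2"

definition smooth_on :: "'a::euclidean_space set \<Rightarrow> ('a \<Rightarrow> real) \<Rightarrow> bool" where
  "smooth_on S f \<longleftrightarrow> (\<forall>n. higher_differentiable_on S f n)"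

text \<open>Differentials are represented by gradients. For a function \<open>w\<close> of \<open>(t, x)\<close>, the components
  of \<open>grad w (t, x)\<close> are the partial derivative in \<open>t\<close> and the partial gradient in \<open>x\<close>; likewise
  \<open>grad H (t, q, p)\<close> consists of the three partial gradients of \<open>H\<close>.\<close>

definition grad :: "('a::euclidean_space \<Rightarrow> real) \<Rightarrow> 'a \<Rightarrow> 'a" where
  "grad f x = (THE v. GDERIV f x :> v)"

text \<open>The norm of the second differential as a bilinear form: the operator norm of the Hessian.\<close>

definition d2_norm :: "('a::euclidean_space \<Rightarrow> real) \<Rightarrow> 'a \<Rightarrow> real" where
  "d2_norm f x = onorm (frechet_derivative (grad f) (at x))"

definition is_lipschitz :: "('a::metric_space \<Rightarrow> real) \<Rightarrow> bool" where
  "is_lipschitz u \<longleftrightarrow> (\<exists>L. L-lipschitz_on UNIV u)"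

definition Lip :: "('a::metric_space \<Rightarrow> real) \<Rightarrow> real" where
  "Lip u = Inf {L. L-lipschitz_on UNIV u}"

definition locally_lipschitz_on :: "'a::metric_space set \<Rightarrow> ('a \<Rightarrow> real) \<Rightarrow> bool" where
  "locally_lipschitz_on S w \<longleftrightarrow> (\<forall>z\<in>S. \<exists>e>0. \<exists>L. L-lipschitz_on (S \<inter> ball z e) w)"

definition semi_concave_on :: "'a::euclidean_space set \<Rightarrow> ('a \<Rightarrow> real) \<Rightarrow> bool" where
  "semi_concave_on S w \<longleftrightarrow> (\<exists>K. concave_on S (\<lambda>z. w z - K * (norm z)\<^sup>2 / 2))"

definition clarke_differential :: "('a::euclidean_space \<Rightarrow> real) \<Rightarrow> 'a \<Rightarrow> 'a set" where
  "clarke_differential u x = convex hull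
     {l. \<exists>X. X \<longlonglongrightarrow> x \<and> (\<forall>n::nat. u differentiable (at (X n))) \<and> (\<lambda>n. grad u (X n)) \<longlonglongrightarrow> l}"


section \<open>Classical solutions of the Hamilton-Jacobi equation\<close>

type_synonym 'a hamiltonian = "real \<times> 'a \<times> 'a \<Rightarrow> real"

definition admissible_hamiltonian :: "('a::euclidean_space) hamiltonian \<Rightarrow> real \<Rightarrow> bool" where
  "admissible_hamiltonian H A \<longleftrightarrow> C2_on UNIV H \<and>
     (\<forall>t x p. d2_norm H (t, x, p) \<le> A \<and>
              norm (grad H (t, x, p)) \<le> A * (1 + norm p) \<and>
              \<bar>H (t, x, p)\<bar> \<le> A * (1 + norm p)\<^sup>2)"

text \<open>The left-hand side of the Hamilton-Jacobi equation at the point \<open>z = (t, x)\<close>.\<close>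

definition HJ :: "('a::euclidean_space) hamiltonian \<Rightarrow> (real \<times> 'a \<Rightarrow> real) \<Rightarrow> real \<times> 'a \<Rightarrow> real" where
  "HJ H w z = fst (grad w z) + H (fst z, snd z, snd (grad w z))"

definition classical_solution_on ::
    "('a::euclidean_space) hamiltonian \<Rightarrow> (real \<times> 'a) set \<Rightarrow> (real \<times> 'a \<Rightarrow> real) \<Rightarrow> bool" where
  "classical_solution_on H \<Omega> f \<longleftrightarrow> C2_on \<Omega> f \<and> (\<forall>z\<in>\<Omega>. HJ H f z = 0)"

definition lifespan :: "(real \<Rightarrow> ennreal \<Rightarrow> ennreal) \<Rightarrow> ennreal \<Rightarrow> ereal" where
  "lifespan Q r = Sup {ereal t | t. 0 \<le> t \<and> Q t r < \<infinity>}"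

text \<open>The strip \<open>]s - \<tau>, s + \<tau>[\<close> times the whole space, where \<open>\<tau>\<close> may be infinite.\<close>

definition strip :: "real \<Rightarrow> ereal \<Rightarrow> (real \<times> 'a) set" where
  "strip s \<tau> = {t. ereal \<bar>t - s\<bar> < \<tau>} \<times> UNIV"

definition hessian_growth :: "('a::euclidean_space) hamiltonian \<Rightarrow> real \<Rightarrow>
    (real \<Rightarrow> ennreal \<Rightarrow> ennreal) \<Rightarrow> bool" where
  "hessian_growth H A Q \<longleftrightarrow>
     (\<forall>s t r. 0 \<le> s \<and> s \<le> t \<longrightarrow> Q s r \<le> Q t r) \<and>
     (\<forall>t r r'. 0 \<le> t \<and> r \<le> r' \<longrightarrow> Q t r \<le> Q t r') \<and>
     (\<forall>r. Q 0 r = r) \<and>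
     (\<forall>s t r. 0 \<le> s \<and> 0 \<le> t \<longrightarrow> Q (t + s) r = Q t (Q s r)) \<and>
     (\<forall>r<\<infinity>. 0 < lifespan Q r) \<and>
     (\<forall>s (r::real) fs. 0 \<le> r \<and> C2_on UNIV fs \<and> (\<forall>x. d2_norm fs x \<le> r) \<longrightarrow>
        (\<exists>f. classical_solution_on H (strip s (lifespan Q r)) f \<and> (\<forall>x. f (s, x) = fs x)) \<and>
        (\<forall>f f'. classical_solution_on H (strip s (lifespan Q r)) f \<and> (\<forall>x. f (s, x) = fs x) \<and>
                classical_solution_on H (strip s (lifespan Q r)) f' \<and> (\<forall>x. f' (s, x) = fs x) \<longrightarrow>
                (\<forall>z\<in>strip s (lifespan Q r). f z = f' z)) \<and>
        (\<forall>f. classical_solution_on H (strip s (lifespan Q r)) f \<and> (\<forall>x. f (s, x) = fs x) \<longrightarrow>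
             (\<forall>t x. (t, x) \<in> strip s (lifespan Q r) \<longrightarrow>
                ennreal (d2_norm (\<lambda>y. f (t, y)) x) \<le> Q \<bar>t - s\<bar> r))) \<and>
     (\<exists>D :: real \<Rightarrow> ennreal \<Rightarrow> real. \<forall>s (r::real) fs f.
        0 \<le> r \<and> C2_on UNIV fs \<and> (\<forall>x. d2_norm fs x \<le> r) \<and> is_lipschitz fs \<and>
        classical_solution_on H (strip s (lifespan Q r)) f \<and> (\<forall>x. f (s, x) = fs x) \<longrightarrow>
        (\<forall>t x. (t, x) \<in> strip s (lifespan Q r) \<longrightarrow>
           is_lipschitz (\<lambda>y. f (t, y)) \<and>
           Lip (\<lambda>y. f (t, y)) \<le> (Lip fs + 1) * exp (A * \<bar>t - s\<bar>) - 1 \<and>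
           \<bar>fst (grad f (t, x))\<bar> \<le> A * ((Lip fs + 1) * exp (A * \<bar>t - s\<bar>))\<^sup>2) \<and>
        (\<forall>T z. 0 < T \<and> ereal T < lifespan Q r \<and> z \<in> strip s (ereal T) \<longrightarrow>
           d2_norm f z \<le> D (Lip fs) (Q T r)))"


section \<open>Variational and viscosity solutions\<close>

definition hamiltonian_trajectory ::
    "('a::euclidean_space) hamiltonian \<Rightarrow> (real \<Rightarrow> 'a) \<Rightarrow> (real \<Rightarrow> 'a) \<Rightarrow> bool" where
  "hamiltonian_trajectory H q p \<longleftrightarrow>
     (\<forall>t. (q has_vector_derivative snd (snd (grad H (t, q t, p t)))) (at t) \<and>
          (p has_vector_derivative - fst (snd (grad H (t, q t, p t)))) (at t))"

definition variational_solution :: "('a::euclidean_space) hamiltonian \<Rightarrow> real \<Rightarrow>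
    ('a \<Rightarrow> real) \<Rightarrow> (real \<times> 'a \<Rightarrow> real) \<Rightarrow> bool" where
  "variational_solution H s u g \<longleftrightarrow>
     locally_lipschitz_on ({s..} \<times> UNIV) g \<and>
     (\<forall>x. g (s, x) = u x) \<and>
     (AE z in lebesgue. z \<in> {s<..} \<times> UNIV \<longrightarrow> g differentiable (at z) \<and> HJ H g z = 0) \<and>
     (\<forall>t x. s < t \<longrightarrow>
        (\<exists>q p. hamiltonian_trajectory H q p \<and> q t = x \<and> p s \<in> clarke_differential u (q s) \<and>
           g (t, x) = u (q s) +
             integral {s..t} (\<lambda>\<tau>. p \<tau> \<bullet> vector_derivative q (at \<tau>) - H (\<tau>, q \<tau>, p \<tau>))))"

text \<open>An operator family \<open>R s t\<close> is only constrained for \<open>s \<le> t\<close> and on Lipschitz functions.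
  In particular, the compatibility with a classical solution \<open>f\<close> is required at those initial times
  at which \<open>f\<close> is Lipschitz in the space variable.\<close>

type_synonym 'a evolution = "real \<Rightarrow> real \<Rightarrow> ('a \<Rightarrow> real) \<Rightarrow> ('a \<Rightarrow> real)"

definition evolution_properties ::
    "('a::euclidean_space) hamiltonian \<Rightarrow> real \<Rightarrow> 'a evolution \<Rightarrow> bool" where
  "evolution_properties H A R \<longleftrightarrow>
     (\<forall>s t u. s \<le> t \<and> is_lipschitz u \<longrightarrow>
        is_lipschitz (R s t u) \<and>
        Lip (R s t u) \<le> (Lip u + 1) * exp (A * (t - s)) - 1 \<and>
        (\<forall>x. \<bar>R s t u x - u x\<bar> \<le> A * (t - s) * ((Lip u + 1) * exp (A * (t - s)))\<^sup>2)) \<and>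
     (\<forall>s t u w. s \<le> t \<and> is_lipschitz u \<and> is_lipschitz w \<and> (\<forall>x. u x \<le> w x) \<longrightarrow>
        (\<forall>x. R s t u x \<le> R s t w x)) \<and>
     (\<forall>(T1::ereal) (T2::ereal) f s t.
        classical_solution_on H ({\<tau>. T1 < ereal \<tau> \<and> ereal \<tau> < T2} \<times> UNIV) f \<and>
        T1 < ereal s \<and> s \<le> t \<and> ereal t < T2 \<and> is_lipschitz (\<lambda>x. f (s, x)) \<longrightarrow>
        (\<forall>x. R s t (\<lambda>y. f (s, y)) x = f (t, x)))"

definition variational_resolution ::
    "('a::euclidean_space) hamiltonian \<Rightarrow> real \<Rightarrow> 'a evolution \<Rightarrow> bool" where
  "variational_resolution H A G \<longleftrightarrow>
     (\<forall>s u. is_lipschitz u \<longrightarrow> variational_solution H s u (\<lambda>(t, x). G s t u x)) \<and>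
     evolution_properties H A G"

definition contact_above :: "('b::topological_space \<Rightarrow> real) \<Rightarrow> ('b \<Rightarrow> real) \<Rightarrow> 'b \<Rightarrow> bool" where
  "contact_above \<phi> w z \<longleftrightarrow> \<phi> z = w z \<and> (\<forall>\<^sub>F y in nhds z. w y \<le> \<phi> y)"

definition contact_below :: "('b::topological_space \<Rightarrow> real) \<Rightarrow> ('b \<Rightarrow> real) \<Rightarrow> 'b \<Rightarrow> bool" where
  "contact_below \<phi> w z \<longleftrightarrow> \<phi> z = w z \<and> (\<forall>\<^sub>F y in nhds z. \<phi> y \<le> w y)"

definition viscosity_solution_on ::
    "('a::euclidean_space) hamiltonian \<Rightarrow> (real \<times> 'a) set \<Rightarrow> (real \<times> 'a \<Rightarrow> real) \<Rightarrow> bool" where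
  "viscosity_solution_on H \<Omega> w \<longleftrightarrow> continuous_on \<Omega> w \<and>
     (\<forall>\<phi> z. smooth_on \<Omega> \<phi> \<and> z \<in> \<Omega> \<and> contact_above \<phi> w z \<longrightarrow> HJ H \<phi> z \<le> 0) \<and>
     (\<forall>\<phi> z. smooth_on \<Omega> \<phi> \<and> z \<in> \<Omega> \<and> contact_below \<phi> w z \<longrightarrow> 0 \<le> HJ H \<phi> z)"

text \<open>Continuity up to the initial time is required explicitly: without it the initial condition
  would not constrain the solution at later times, and uniqueness would fail.\<close>

definition viscosity_cauchy_solution :: "('a::euclidean_space) hamiltonian \<Rightarrow> real \<Rightarrow>
    ('a \<Rightarrow> real) \<Rightarrow> (real \<times> 'a \<Rightarrow> real) \<Rightarrow> bool" where
  "viscosity_cauchy_solution H s u v \<longleftrightarrow>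
     continuous_on ({s..} \<times> UNIV) v \<and>
     viscosity_solution_on H ({s<..} \<times> UNIV) v \<and>
     (\<forall>x. v (s, x) = u x) \<and>
     (\<forall>T>s. bounded ((\<lambda>(t, x). v (t, x) - u x) ` ({s<..<T} \<times> UNIV)) \<and>
            (\<exists>L. L-lipschitz_on ({s<..<T} \<times> UNIV) (\<lambda>(t, x). v (t, x) - u x)))"

definition viscosity_resolution ::
    "('a::euclidean_space) hamiltonian \<Rightarrow> real \<Rightarrow> 'a evolution \<Rightarrow> bool" where
  "viscosity_resolution H A V \<longleftrightarrow>
     (\<forall>s u. is_lipschitz u \<longrightarrow>
        viscosity_cauchy_solution H s u (\<lambda>(t, x). V s t u x) \<and>
        (\<forall>v. viscosity_cauchy_solution H s u v \<longrightarrow> (\<forall>t\<ge>s. \<forall>x. v (t, x) = V s t u x))) \<and>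
     evolution_properties H A V \<and>
     (\<forall>\<tau> s t u. \<tau> \<le> s \<and> s \<le> t \<and> is_lipschitz u \<longrightarrow> V s t (V \<tau> s u) = V \<tau> t u)"

end

theory Submission
  imports Defs
begin

text \<open>
  Let \<open>M\<^sub>t\<close> be the set of functions obtained from \<open>F\<^sub>0\<close> by alternating classical evolutions and convex
  combinations, up to time \<open>t\<close>. Its elements keep the bounds on the differentials of the classical
  solutions, so that \<open>W\<^sub>t = inf M\<^sub>t\<close> is semi-concave in \<open>x\<close>.

  If \<open>S\<close> is a convex family of such functions with infimum \<open>u\<close>, an element of the Clarke differential of
  \<open>u\<close> at \<open>q\<close> is almost the differential of some \<open>\<phi> \<in> S\<close> almost touching \<open>u\<close> at \<open>q\<close>. Comparing the
  action of the trajectory given by the variational solution with the classical solution issued from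
  \<open>\<phi>\<close>, and using monotonicity for the converse, \<open>G\<^sub>s\<^sup>t u\<close> is the infimum of the classical evolutions
  of \<open>S\<close>. For \<open>S\<close> the convex hull of \<open>F\<^sub>0\<close> this gives the semi-concavity of \<open>g\<close> and, by monotonicity
  of \<open>V\<close>, the inequality \<open>v \<le> g\<close>.

  For the semi-concavity of \<open>v\<close>, one has \<open>W\<^sub>t \<le> G\<^sub>s\<^sup>t W\<^sub>s \<le> W\<^sub>t + C (t - s)\<^sup>2\<close>. The first inequality makes \<open>W\<close>
  a viscosity subsolution, the second one a supersolution, hence \<open>W = v\<close> by uniqueness; the second one
  also yields the joint midpoint estimate in \<open>(t, x)\<close>, by means of a classical solution that almost
  touches \<open>v\<close> at the midpoint and starts at the earlier of the two times.
\<close>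

section \<open>Differential calculus\<close>

text \<open>For an \<open>H\<close> that is not convex in \<open>p\<close>, an infimum of classical
  solutions can fail to be a subsolution: at a kink, a test function touching from above may have
  any convex combination of the gradients there, while the equation is known at the gradients
  themselves only. Adding convex combinations to the family lowers the infimum where this happens. A
  classical evolution does not map convex combinations to convex combinations, so they have to be
  added anew at later times; iterating \<open>G\<close> is no substitute, since \<open>G\<close> is
  not assumed to be Markov. The price is paid on the supersolution side. A function in
  \<open>M\<^sub>t\<close> may have passed through arbitrarily many stages between \<open>s\<close>
  and \<open>t\<close>, so an error of fixed size per stage would be fatal. The remedy is not to
  follow the function itself, but to keep one \<open>\<phi>\<close> in \<open>M\<^sub>s\<close> with
  nearly the same gradient together with a mean speed, and to compare with the least first order
  extrapolation \<open>j\<close> over \<open>M\<^sub>s\<close>. Convexity of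
  \<open>M\<^sub>s\<close> makes \<open>j\<close> a bound for mixed gradients as well.\<close>

lemma gderiv_unique:
  assumes "GDERIV f x :> D" "GDERIV f x :> E"
  shows "D = E"
  using has_derivative_unique[OF assms[unfolded gderiv_def]]
  by (metis vector_eq_ldot)

lemma grad_eqI: "GDERIV f x :> D \<Longrightarrow> grad f x = D"
  unfolding grad_def by (blast intro: gderiv_unique)

lemma gderiv_grad:
  fixes f :: "'a::euclidean_space \<Rightarrow> real"
  assumes "f differentiable (at x)"
  shows "GDERIV f x :> grad f x"
proof -
  obtain D where D: "(f has_derivative D) (at x)"
    using assms differentiable_def by blast
  then interpret D: bounded_linear D
    by (rule has_derivative_bounded_linear)
  have D_eq: "D = (\<lambda>h. h \<bullet> (\<Sum>b\<in>Basis. D b *\<^sub>R b))"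
  proof
    fix h
    have "D h = D (\<Sum>b\<in>Basis. (h \<bullet> b) *\<^sub>R b)"
      by (simp add: euclidean_representation)
    also have "\<dots> = h \<bullet> (\<Sum>b\<in>Basis. D b *\<^sub>R b)"
      by (simp add: D.sum D.scaleR inner_sum_right mult.commute)
    finally show "D h = h \<bullet> (\<Sum>b\<in>Basis. D b *\<^sub>R b)" .
  qed
  then have "GDERIV f x :> (\<Sum>b\<in>Basis. D b *\<^sub>R b)"
    unfolding gderiv_def using D D_eq by metis
  then show ?thesis
    by (metis grad_eqI)
qed

lemma gderiv_imp_differentiable: "GDERIV f x :> D \<Longrightarrow> f differentiable (at x)"
  unfolding gderiv_def by (rule differentiableI)

lemma frechet_derivative_eq_grad:
  fixes f :: "'a::euclidean_space \<Rightarrow> real"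
  assumes "f differentiable (at x)"
  shows "frechet_derivative f (at x) = (\<lambda>h. h \<bullet> grad f x)"
  using gderiv_grad[OF assms] unfolding gderiv_def by (metis frechet_derivative_at)

lemma higher_differentiable_on_subset:
  assumes "higher_differentiable_on S f n" "T \<subseteq> S"
  shows "higher_differentiable_on T f n"
  using assms by (induction n arbitrary: f) (auto intro: continuous_on_subset)

text \<open>A criterion in terms of the gradient, meant for the explicit functions of
  \<open>bump_C2_class\<close>; \<open>higher_differentiable_on\<close> itself speaks of directional
  derivatives, one direction at a time.\<close>

lemma C2_onI:
  fixes f :: "'a::euclidean_space \<Rightarrow> real"
  assumes "\<And>x. x \<in> S \<Longrightarrow> f differentiable (at x)"
    and "\<And>x. x \<in> S \<Longrightarrow> grad f differentiable (at x)"
    and "\<And>h k. continuous_on S (\<lambda>x. frechet_derivative (\<lambda>y. frechet_derivative f (at y) h) (at x) k)"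
    and "open S"
  shows "C2_on S f"
proof -
  have "(\<lambda>y. frechet_derivative f (at y) h) differentiable (at x)" if x: "x \<in> S" for x h
  proof -
    obtain D where D: "(grad f has_derivative D) (at x)"
      using assms(2)[OF x] differentiable_def by blast
    have "((\<lambda>y. h \<bullet> grad f y) has_derivative (\<lambda>k. h \<bullet> D k)) (at x)"
      by (rule has_derivative_inner_right[OF D])
    then have "((\<lambda>y. frechet_derivative f (at y) h) has_derivative (\<lambda>k. h \<bullet> D k)) (at x)"
      by (rule has_derivative_transform_within_open[OF _ \<open>open S\<close> x])
        (simp add: frechet_derivative_eq_grad assms(1))
    then show ?thesis
      by (rule differentiableI)
  qed
  with assms(1,3) show ?thesis
    by (simp add: numeral_2_eq_2)
qed

lemma C2_on_differentiable:
  assumes "C2_on S f" "x \<in> S"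
  shows "f differentiable (at x)"
  using assms by (simp add: numeral_2_eq_2)

lemma C2_on_gderiv:
  assumes "C2_on S f" "x \<in> S"
  shows "GDERIV f x :> grad f x"
  by (rule gderiv_grad[OF C2_on_differentiable[OF assms]])

lemma C2_on_grad_differentiable:
  fixes f :: "'a::euclidean_space \<Rightarrow> real"
  assumes C: "C2_on S f" and "open S" "x \<in> S"
  shows "grad f differentiable (at x)"
proof -
  have "(\<lambda>y. grad f y \<bullet> b) differentiable (at x)" if "b \<in> Basis" for b
  proof -
    have "(\<lambda>y. frechet_derivative f (at y) b) differentiable (at x)"
      using C \<open>x \<in> S\<close> by (simp add: numeral_2_eq_2)
    then obtain D where D: "((\<lambda>y. frechet_derivative f (at y) b) has_derivative D) (at x)"
      using differentiable_def by blast
    have "((\<lambda>y. grad f y \<bullet> b) has_derivative D) (at x)"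
      by (rule has_derivative_transform_within_open[OF D \<open>open S\<close> \<open>x \<in> S\<close>])
        (simp add: frechet_derivative_eq_grad C2_on_differentiable[OF C] inner_commute)
    then show ?thesis
      by (rule differentiableI)
  qed
  then show ?thesis
    by (simp add: differentiable_componentwise_within[of "grad f"])
qed

text \<open>Only increments of \<open>g\<close> from the centre \<open>z\<close> are controlled,
  which is what differentiability of a gradient at one point provides. The mean value theorem gives
  \<open>K\<close> where the integral remainder would give \<open>K / 2\<close>; this is the origin
  of the factors 2 in the final semi-concavity constants.\<close>

lemma taylor_gradient_bound:
  fixes f :: "'a::euclidean_space \<Rightarrow> real"
  assumes D: "\<And>z. z \<in> S \<Longrightarrow> GDERIV f z :> g z" and K: "0 \<le> K"
    and L: "\<And>y. y \<in> S \<Longrightarrow> norm (g y - g z) \<le> K * norm (y - z)"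
    and S: "convex S" "z \<in> S" "z' \<in> S"
  shows "\<bar>f z' - f z - g z \<bullet> (z' - z)\<bar> \<le> K * (norm (z' - z))\<^sup>2"
proof -
  define \<phi> where "\<phi> = (\<lambda>s. f (z + s *\<^sub>R (z' - z)))"
  have inS: "z + s *\<^sub>R (z' - z) \<in> S" if "0 \<le> s" "s \<le> 1" for s
  proof -
    have "z + s *\<^sub>R (z' - z) = (1 - s) *\<^sub>R z + s *\<^sub>R z'"
      by (simp add: algebra_simps)
    with that S show ?thesis by (simp add: convexD)
  qed
  have "(\<phi> has_derivative (\<lambda>r. (r *\<^sub>R (z' - z)) \<bullet> g (z + s *\<^sub>R (z' - z)))) (at s within {0..1})"
    if "0 \<le> s" "s \<le> 1" for s
  proof -
    have 1: "((\<lambda>s. z + s *\<^sub>R (z' - z)) has_derivative (\<lambda>r. r *\<^sub>R (z' - z))) (at s within {0..1})"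
      by (auto intro!: derivative_eq_intros)
    have 2: "(f has_derivative (\<lambda>h. h \<bullet> g (z + s *\<^sub>R (z' - z)))) (at (z + s *\<^sub>R (z' - z)))"
      using D[OF inS[OF that]] by (simp add: gderiv_def)
    show ?thesis
      unfolding \<phi>_def using has_derivative_compose[OF 1 2] by simp
  qed
  from mvt_very_simple[OF zero_le_one this] obtain s where s: "0 \<le> s" "s \<le> 1"
    and eq: "\<phi> 1 - \<phi> 0 = (z' - z) \<bullet> g (z + s *\<^sub>R (z' - z))"
    by auto
  have "f z' - f z - g z \<bullet> (z' - z) = (z' - z) \<bullet> (g (z + s *\<^sub>R (z' - z)) - g z)"
    using eq by (simp add: \<phi>_def inner_diff_right inner_commute)
  also have "\<bar>\<dots>\<bar> \<le> norm (z' - z) * norm (g (z + s *\<^sub>R (z' - z)) - g z)"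
    by (rule Cauchy_Schwarz_ineq2)
  also have "\<dots> \<le> norm (z' - z) * (K * norm (s *\<^sub>R (z' - z)))"
    using L[OF inS[OF s]] by (intro mult_left_mono) simp_all
  also have "\<dots> \<le> norm (z' - z) * (K * norm (z' - z))"
    using s K
    by (intro mult_left_mono) (simp_all add: mult_left_le_one_le)
  finally show ?thesis
    by (simp add: power2_eq_square algebra_simps)
qed

lemma taylor_lipschitz_gradient:
  fixes f :: "'a::euclidean_space \<Rightarrow> real"
  assumes D: "\<And>z. z \<in> S \<Longrightarrow> GDERIV f z :> g z" and L: "K-lipschitz_on S g"
    and S: "convex S" "z \<in> S" "z' \<in> S"
  shows "\<bar>f z' - f z - g z \<bullet> (z' - z)\<bar> \<le> K * (norm (z' - z))\<^sup>2"
  using lipschitz_onD[OF L _ S(2)] lipschitz_on_nonneg[OF L]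
  by (intro taylor_gradient_bound[OF D _ _ S]) (simp_all add: dist_norm)

text \<open>For viscosity test functions: near the contact point they are replaced by their first
  order part and a quadratic error.\<close>

lemma C2_on_local_taylor:
  fixes f :: "'a::euclidean_space \<Rightarrow> real"
  assumes C: "C2_on S f" and S: "open S" "z \<in> S"
  obtains K d where "0 \<le> K" "0 < d"
    "\<And>y. dist z y < d \<Longrightarrow> \<bar>f y - f z - grad f z \<bullet> (y - z)\<bar> \<le> K * (norm (y - z))\<^sup>2"
proof -
  obtain D where D: "(grad f has_derivative D) (at z)"
    using C2_on_grad_differentiable[OF C S] differentiable_def by blast
  then interpret D: bounded_linear D by (rule has_derivative_bounded_linear)
  obtain N where N: "\<And>h. norm (D h) \<le> norm h * N" "0 \<le> N" using D.nonneg_bounded by blast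
  obtain d1 where d1: "0 < d1" "ball z d1 \<subseteq> S" using S openE by blast
  obtain d2 where d2: "0 < d2"
    "\<And>y. norm (y - z) < d2 \<Longrightarrow> norm (grad f y - grad f z - D (y - z)) \<le> 1 * norm (y - z)"
    using D zero_less_one unfolding has_derivative_at_alt by metis
  define d where "d = min d1 d2"
  show ?thesis
  proof (rule that[of "N + 1" d])
    fix y assume "dist z y < d"
    then show "\<bar>f y - f z - grad f z \<bullet> (y - z)\<bar> \<le> (N + 1) * (norm (y - z))\<^sup>2"
    proof (intro taylor_gradient_bound[of "ball z d"])
      fix y' assume y': "y' \<in> ball z d"
      then show "GDERIV f y' :> grad f y'"
        using d1(2) by (intro C2_on_gderiv[OF C]) (auto simp: d_def)
      have "norm (grad f y' - grad f z - D (y' - z)) \<le> norm (y' - z)"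
        using d2(2)[of y'] y' by (simp add: d_def dist_norm norm_minus_commute)
      moreover have "norm (grad f y' - grad f z) \<le> norm (grad f y' - grad f z - D (y' - z)) + norm (D (y' - z))"
        by (metis diff_add_cancel norm_triangle_ineq)
      ultimately show "norm (grad f y' - grad f z) \<le> (N + 1) * norm (y' - z)"
        using N(1)[of "y' - z"] by (simp add: algebra_simps)
    qed (use N d1 d2 in \<open>auto simp: d_def intro: convex_ball\<close>)
  qed (use N d1 d2 in \<open>auto simp: d_def\<close>)
qed

text \<open>The second difference does not change when \<open>h\<close> and \<open>k\<close> are exchanged, whence the symmetry of \<open>D\<close>.\<close>

lemma second_difference_bound:
  fixes f :: "'a::euclidean_space \<Rightarrow> real"
  assumes G: "\<And>y. y \<in> ball x d \<Longrightarrow> GDERIV f y :> g y"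
    and D: "bounded_linear D" and e: "0 \<le> e"
    and err: "\<And>y. y \<in> ball x d \<Longrightarrow> norm (g y - g x - D (y - x)) \<le> e * norm (y - x)"
    and s: "0 < s" "s * (norm h + norm k) < d"
  shows "\<bar>f (x + s *\<^sub>R h + s *\<^sub>R k) - f (x + s *\<^sub>R h) - f (x + s *\<^sub>R k) + f x - s\<^sup>2 * (k \<bullet> D h)\<bar>
     \<le> 2 * e * s\<^sup>2 * (norm h + norm k)\<^sup>2"
proof -
  interpret D: bounded_linear D by (rule D)
  define N where "N = norm h + norm k"
  have in_ball: "x + (a * s) *\<^sub>R h + (b * s) *\<^sub>R k \<in> ball x d"
    and norm_le: "norm ((a * s) *\<^sub>R h + (b * s) *\<^sub>R k) \<le> s * N"
    if "0 \<le> a" "a \<le> 1" "0 \<le> b" "b \<le> 1" for a b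
  proof -
    have "norm ((a * s) *\<^sub>R h + (b * s) *\<^sub>R k) \<le> (a * s) * norm h + (b * s) * norm k"
      using that s(1) by (intro order.trans[OF norm_triangle_ineq]) simp
    also have "\<dots> \<le> s * norm h + s * norm k"
      using that s(1) by (intro add_mono mult_right_mono) (simp_all add: mult_left_le_one_le)
    finally show le: "norm ((a * s) *\<^sub>R h + (b * s) *\<^sub>R k) \<le> s * N"
      by (simp add: N_def algebra_simps)
    have "dist x (x + (a * s) *\<^sub>R h + (b * s) *\<^sub>R k) = norm ((a * s) *\<^sub>R h + (b * s) *\<^sub>R k)"
      by (metis add.assoc dist_add_cancel dist_0_norm add.right_neutral)
    then show "x + (a * s) *\<^sub>R h + (b * s) *\<^sub>R k \<in> ball x d"
      using le s(2) by (simp add: N_def)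
  qed
  \<comment> \<open>The mean value theorem is applied in \<open>r\<close> to the difference of
    \<open>f\<close> along two parallel segments. Corresponding points \<open>y1 r\<close> and
    \<open>y2 r\<close> differ by \<open>s *\<^sub>R h\<close>, so the linear parts of the two
    gradients differ by \<open>s *\<^sub>R D h\<close>, whatever \<open>r\<close> is.\<close>
  define \<phi> where "\<phi> = (\<lambda>r. f (x + s *\<^sub>R h + (r * s) *\<^sub>R k) - f (x + (r * s) *\<^sub>R k))"
  define y1 y2 where "y1 r = x + s *\<^sub>R h + (r * s) *\<^sub>R k" and "y2 r = x + (r * s) *\<^sub>R k" for r
  have y: "y1 r \<in> ball x d" "y2 r \<in> ball x d" "norm (y1 r - x) \<le> s * N" "norm (y2 r - x) \<le> s * N"
    if "0 \<le> r" "r \<le> 1" for r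
    using in_ball[of 1 r] in_ball[of 0 r] norm_le[of 1 r] norm_le[of 0 r] that
    by (simp_all add: y1_def y2_def add.assoc)
  have "(\<phi> has_derivative (\<lambda>t. (t * s) *\<^sub>R k \<bullet> g (y1 r) - (t * s) *\<^sub>R k \<bullet> g (y2 r))) (at r within {0..1})"
    if r: "0 \<le> r" "r \<le> 1" for r
  proof -
    have 1: "(y1 has_derivative (\<lambda>t. (t * s) *\<^sub>R k)) (at r within {0..1})"
      unfolding y1_def by (auto intro!: derivative_eq_intros)
    have 2: "(y2 has_derivative (\<lambda>t. (t * s) *\<^sub>R k)) (at r within {0..1})"
      unfolding y2_def by (auto intro!: derivative_eq_intros)
    have 3: "(f has_derivative (\<lambda>h. h \<bullet> g (y1 r))) (at (y1 r))"
      "(f has_derivative (\<lambda>h. h \<bullet> g (y2 r))) (at (y2 r))"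
      using G[OF y(1)[OF r]] G[OF y(2)[OF r]] by (simp_all add: gderiv_def)
    show ?thesis
      using has_derivative_diff[OF has_derivative_compose[OF 1 3(1)] has_derivative_compose[OF 2 3(2)]]
      by (simp add: \<phi>_def y1_def y2_def)
  qed
  from mvt_very_simple[OF zero_le_one this] obtain r where r: "0 \<le> r" "r \<le> 1"
    and eq: "\<phi> 1 - \<phi> 0 = s *\<^sub>R k \<bullet> g (y1 r) - s *\<^sub>R k \<bullet> g (y2 r)"
    by auto
  have D_eq: "D (y1 r - x) - D (y2 r - x) = s *\<^sub>R D h"
    by (simp add: y1_def y2_def D.add D.scaleR)
  have "\<phi> 1 - \<phi> 0 - s\<^sup>2 * (k \<bullet> D h) = s *\<^sub>R k \<bullet> (g (y1 r) - g (y2 r) - s *\<^sub>R D h)"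
    by (simp add: eq inner_diff_right power2_eq_square)
  also have "g (y1 r) - g (y2 r) - s *\<^sub>R D h
      = (g (y1 r) - g x - D (y1 r - x)) - (g (y2 r) - g x - D (y2 r - x))"
    using D_eq by (simp add: algebra_simps)
  also have "\<bar>s *\<^sub>R k \<bullet> \<dots>\<bar> \<le> norm (s *\<^sub>R k) * norm \<dots>"
    by (rule Cauchy_Schwarz_ineq2)
  also have "\<dots> \<le> (s * N) * (e * (s * N) + e * (s * N))"
  proof (intro mult_mono)
    have "norm ((g (y1 r) - g x - D (y1 r - x)) - (g (y2 r) - g x - D (y2 r - x)))
        \<le> e * norm (y1 r - x) + e * norm (y2 r - x)"
      by (intro order.trans[OF norm_triangle_ineq4] add_mono err y r)
    also have "\<dots> \<le> e * (s * N) + e * (s * N)"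
      using e by (intro add_mono mult_left_mono y r)
    finally show "norm ((g (y1 r) - g x - D (y1 r - x)) - (g (y2 r) - g x - D (y2 r - x)))
      \<le> e * (s * N) + e * (s * N)" .
  qed (use s(1) in \<open>simp_all add: N_def\<close>)
  finally show ?thesis
    by (simp add: \<phi>_def N_def power2_eq_square algebra_simps)
qed

lemma gradient_derivative_symmetric:
  fixes f :: "'a::euclidean_space \<Rightarrow> real"
  assumes S: "open S" "x \<in> S" and G: "\<And>y. y \<in> S \<Longrightarrow> GDERIV f y :> g y"
    and D: "(g has_derivative D) (at x)"
  shows "k \<bullet> D h = h \<bullet> D k"
proof (rule ccontr)
  assume ne: "k \<bullet> D h \<noteq> h \<bullet> D k"
  define N where "N = norm h + norm k"
  \<comment> \<open>With this \<open>e\<close> the two estimates of the second difference bound the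
    gap by half of itself.\<close>
  define e where "e = \<bar>k \<bullet> D h - h \<bullet> D k\<bar> / (8 * (N\<^sup>2 + 1))"
  have N: "N \<ge> 0" "N\<^sup>2 + 1 > 0" by (simp_all add: N_def add_nonneg_pos)
  have e: "e > 0" using ne N by (simp add: e_def)
  obtain d1 where d1: "d1 > 0" "ball x d1 \<subseteq> S"
    using S openE by blast
  obtain d2 where d2: "d2 > 0"
    "\<And>y. norm (y - x) < d2 \<Longrightarrow> norm (g y - g x - D (y - x)) \<le> e * norm (y - x)"
    using D e unfolding has_derivative_at_alt by metis
  define d where "d = min d1 d2"
  have d: "d > 0" using d1 d2 by (simp add: d_def)
  define s where "s = d / (2 * (N + 1))"
  have s: "s > 0" "s * N < d"
    using d N(1) by (auto simp: s_def field_simps intro: add_nonneg_pos)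
  have bl: "bounded_linear D" using D by (rule has_derivative_bounded_linear)
  have G': "GDERIV f y :> g y" if "y \<in> ball x d" for y
    using that d1 G by (auto simp: d_def)
  have err: "norm (g y - g x - D (y - x)) \<le> e * norm (y - x)" if "y \<in> ball x d" for y
  proof (rule d2(2))
    show "norm (y - x) < d2"
      using that by (simp add: d_def dist_norm norm_minus_commute)
  qed
  have 1: "\<bar>f (x + s *\<^sub>R h + s *\<^sub>R k) - f (x + s *\<^sub>R h) - f (x + s *\<^sub>R k) + f x - s\<^sup>2 * (k \<bullet> D h)\<bar>
     \<le> 2 * e * s\<^sup>2 * N\<^sup>2"
    using second_difference_bound[OF G' bl less_imp_le[OF e] err s(1), where h=h and k=k] s(2) by (simp add: N_def)
  have 2: "\<bar>f (x + s *\<^sub>R k + s *\<^sub>R h) - f (x + s *\<^sub>R k) - f (x + s *\<^sub>R h) + f x - s\<^sup>2 * (h \<bullet> D k)\<bar>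
     \<le> 2 * e * s\<^sup>2 * N\<^sup>2"
    using second_difference_bound[OF G' bl less_imp_le[OF e] err s(1), where h=k and k=h] s(2)
    by (simp add: N_def add.commute)
  have "\<bar>s\<^sup>2 * (k \<bullet> D h) - s\<^sup>2 * (h \<bullet> D k)\<bar> \<le> 4 * e * s\<^sup>2 * N\<^sup>2"
    using 1 2 by (simp add: algebra_simps)
  then have "s\<^sup>2 * \<bar>k \<bullet> D h - h \<bullet> D k\<bar> \<le> s\<^sup>2 * (4 * e * N\<^sup>2)"
    by (simp add: abs_mult flip: right_diff_distrib) (simp add: algebra_simps)
  then have "\<bar>k \<bullet> D h - h \<bullet> D k\<bar> \<le> 4 * e * N\<^sup>2"
    using s(1) by simp
  also have "\<dots> \<le> 4 * e * (N\<^sup>2 + 1)"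
    using e by simp
  also have "\<dots> = \<bar>k \<bullet> D h - h \<bullet> D k\<bar> / 2"
    using N by (simp add: e_def field_simps)
  finally show False using ne by simp
qed

text \<open>The deviation \<open>h\<close> of \<open>f\<close> from its chord is continuous and
  vanishes at both ends. If it were negative somewhere, take the leftmost minimum point
  \<open>a\<close>: the midpoint inequality around \<open>a\<close> forces the value at
  \<open>a - d\<close> to be minimal too, which contradicts the choice of \<open>a\<close>.\<close>

lemma midpoint_concave_imp_concave:
  fixes f :: "'a::euclidean_space \<Rightarrow> real"
  assumes S: "convex S" and cont: "continuous_on S f"
    and mid: "\<And>x y. x \<in> S \<Longrightarrow> y \<in> S \<Longrightarrow> (f x + f y) / 2 \<le> f ((1 / 2) *\<^sub>R (x + y))"
  shows "concave_on S f"
  unfolding concave_on_iff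
proof (intro conjI ballI allI impI S)
  fix x y and u v :: real
  assume xy: "x \<in> S" "y \<in> S" and uv: "0 \<le> u" "0 \<le> v" "u + v = 1"
  define c where "c r = x + r *\<^sub>R (y - x)" for r :: real
  have c_eq: "c r = (1 - r) *\<^sub>R x + r *\<^sub>R y" for r
    by (simp add: c_def algebra_simps)
  define h where "h r = f (c r) - ((1 - r) * f x + r * f y)" for r
  have cS: "c r \<in> S" if "r \<in> {0..1}" for r
    using that xy S by (simp add: c_eq convexD)
  have "continuous_on {0..1} c"
    unfolding c_def by (intro continuous_intros)
  then have "continuous_on {0..1} h"
    unfolding h_def
    by (intro continuous_intros continuous_on_compose2[OF cont]) (use cS in auto)
  then obtain m where m: "m \<in> {0..1}" "\<And>r. r \<in> {0..1} \<Longrightarrow> h m \<le> h r"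
    using continuous_attains_inf[of "{0..1::real}" h] by auto
  have "h r \<ge> 0" if r: "r \<in> {0..1}" for r
  proof (rule ccontr)
    assume "\<not> h r \<ge> 0"
    then have neg: "h m < 0" using m(2)[OF r] by linarith
    define Z where "Z = {r \<in> {0..1}. h r \<le> h m}"
    have "closed Z"
      unfolding Z_def using \<open>continuous_on {0..1} h\<close>
      by (intro continuous_on_closed_Collect_le continuous_on_const closed_atLeastAtMost)
    then have "compact Z"
      using compact_Int_closed[OF compact_Icc[of 0 1]] by (metis Int_absorb1 Z_def Collect_subset)
    have "m \<in> Z" using m by (simp add: Z_def)
    obtain a where a: "a \<in> Z" "\<And>r. r \<in> Z \<Longrightarrow> a \<le> r"
      using compact_attains_inf[OF \<open>compact Z\<close>] \<open>m \<in> Z\<close> by blast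
    have ha: "h a = h m" "a \<in> {0..1}" using a m by (auto simp: Z_def intro: antisym)
    have "h 0 = 0" "h 1 = 0" by (simp_all add: h_def c_def)
    with neg ha have "a \<noteq> 0" "a \<noteq> 1" by auto
    define d where "d = min a (1 - a)"
    have d: "d > 0" "a - d \<in> {0..1}" "a + d \<in> {0..1}"
      using ha(2) \<open>a \<noteq> 0\<close> \<open>a \<noteq> 1\<close> by (auto simp: d_def min_def)
    have "c (a - d) + c (a + d) = 2 *\<^sub>R c a"
      by (simp add: c_def scaleR_add_left scaleR_diff_left scaleR_2)
    then have "(1 / 2) *\<^sub>R (c (a - d) + c (a + d)) = c a" by simp
    then have "(f (c (a - d)) + f (c (a + d))) / 2 \<le> f (c a)"
      using mid[OF cS[OF d(2)] cS[OF d(3)]] by simp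
    then have "h (a - d) + h (a + d) \<le> h m + h m"
      unfolding ha(1)[symmetric] by (simp add: h_def field_simps)
    moreover have "h (a + d) \<ge> h m" using m(2) d by auto
    moreover have "h (a - d) > h m"
      using a(2)[of "a - d"] d by (auto simp: Z_def not_le[symmetric])
    ultimately show False by simp
  qed
  from this[of v] uv have "(1 - v) * f x + v * f y \<le> f (c v)" by (simp add: h_def)
  moreover have "1 - v = u" using uv by simp
  ultimately show "u * f x + v * f y \<le> f (u *\<^sub>R x + v *\<^sub>R y)"
    by (simp add: c_eq)
qed

section \<open>Lipschitz functions and the size of their gradients\<close>

lemma is_lipschitzI: "C-lipschitz_on UNIV u \<Longrightarrow> is_lipschitz u"
  by (auto simp: is_lipschitz_def)

lemma Lip_le: "C-lipschitz_on UNIV u \<Longrightarrow> Lip u \<le> C"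
  unfolding Lip_def by (intro cInf_lower bdd_belowI[of _ 0]) (auto dest: lipschitz_on_nonneg)

lemma lipschitz_on_Lip:
  fixes u :: "'a::euclidean_space \<Rightarrow> real"
  assumes "is_lipschitz u"
  shows "(Lip u)-lipschitz_on UNIV u"
proof (rule lipschitz_onI)
  obtain C where C: "C-lipschitz_on UNIV u" using assms by (auto simp: is_lipschitz_def)
  show "0 \<le> Lip u"
    unfolding Lip_def using C by (intro cInf_greatest) (auto dest: lipschitz_on_nonneg)
  fix x y
  show "dist (u x) (u y) \<le> Lip u * dist x y"
  proof (cases "x = y")
    case False
    have "dist (u x) (u y) / dist x y \<le> Lip u"
      unfolding Lip_def using C False
      by (intro cInf_greatest) (auto simp: field_simps dest: lipschitz_onD)
    then show ?thesis using False by (simp add: field_simps)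
  qed simp
qed

text \<open>A small step along \<open>p\<close> raises \<open>f\<close> by nearly
  \<open>norm p\<close> times its length, and the Lipschitz bound allows at most \<open>C\<close>
  times its length.\<close>

lemma norm_gradient_le:
  fixes f :: "'a::euclidean_space \<Rightarrow> real"
  assumes L: "C-lipschitz_on UNIV f" and D: "GDERIV f x :> p"
  shows "norm p \<le> C"
proof (rule ccontr)
  assume "\<not> norm p \<le> C"
  then have lt: "C < norm p" by simp
  have C: "0 \<le> C" using L by (rule lipschitz_on_nonneg)
  define e where "e = (norm p - C) / 2"
  have e: "e > 0" using lt by (simp add: e_def)
  obtain d where d: "d > 0"
    "\<And>y. norm (y - x) < d \<Longrightarrow> norm (f y - f x - (y - x) \<bullet> p) \<le> e * norm (y - x)"
    using D e unfolding gderiv_def has_derivative_at_alt by metis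
  define s where "s = d / (2 * norm p)"
  have p: "norm p > 0" using lt C by linarith
  have s: "s > 0" using d p by (simp add: s_def)
  define y where "y = x + s *\<^sub>R p"
  have ny: "norm (y - x) = s * norm p" using s by (simp add: y_def)
  also have "\<dots> < d" using d p by (simp add: s_def)
  finally have "\<bar>f y - f x - (y - x) \<bullet> p\<bar> \<le> e * (s * norm p)"
    using d(2)[of y] ny by simp
  moreover have "\<bar>f y - f x\<bar> \<le> C * (s * norm p)"
    using lipschitz_onD[OF L, of y x] ny by (simp add: dist_norm)
  moreover have "(y - x) \<bullet> p = s * norm p * norm p"
    by (simp add: y_def dot_square_norm power2_eq_square)
  ultimately have "s * norm p * norm p \<le> (e + C) * (s * norm p)"
    by (simp add: algebra_simps)
  then have "norm p * (s * norm p) \<le> (e + C) * (s * norm p)" by (simp add: algebra_simps)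
  then have "norm p \<le> e + C" using s p by (meson mult_le_cancel_right_pos mult_pos_pos)
  then show False using lt by (simp add: e_def field_simps)
qed

section \<open>Classical solutions\<close>

lemma d2_norm_nonneg:
  fixes f :: "'a::euclidean_space \<Rightarrow> real"
  assumes "C2_on UNIV f"
  shows "0 \<le> d2_norm f x"
proof -
  have "(grad f has_derivative frechet_derivative (grad f) (at x)) (at x)"
    using C2_on_grad_differentiable[OF assms] by (simp flip: frechet_derivative_works)
  then show ?thesis
    unfolding d2_norm_def by (intro onorm_pos_le has_derivative_bounded_linear)
qed

lemma lipschitz_grad_of_d2_norm:
  fixes f :: "'a::euclidean_space \<Rightarrow> real"
  assumes C: "C2_on UNIV f" and r: "\<And>x. d2_norm f x \<le> r"
  shows "r-lipschitz_on UNIV (grad f)"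
proof (rule lipschitz_onI)
  fix x y
  have "(grad f has_derivative frechet_derivative (grad f) (at z)) (at z)" for z
    using C2_on_grad_differentiable[OF C] by (simp flip: frechet_derivative_works)
  then have "norm (grad f x - grad f y) \<le> r * norm (x - y)"
    using r unfolding d2_norm_def by (intro differentiable_bound[OF convex_UNIV]) auto
  then show "dist (grad f x) (grad f y) \<le> r * dist x y" by (simp add: dist_norm)
qed (use d2_norm_nonneg[OF C] r order.trans in blast)

lemma lipschitz_of_gradient_bound:
  fixes f :: "'a::euclidean_space \<Rightarrow> real"
  assumes S: "convex S" and D: "\<And>z. z \<in> S \<Longrightarrow> GDERIV f z :> g z"
    and B: "\<And>z. z \<in> S \<Longrightarrow> norm (g z) \<le> C" and C: "0 \<le> C"
  shows "C-lipschitz_on S f"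
proof (rule lipschitz_onI[OF _ C])
  fix x y assume "x \<in> S" "y \<in> S"
  have "norm (f x - f y) \<le> C * norm (x - y)"
  proof (rule differentiable_bound[OF S _ _ \<open>x \<in> S\<close> \<open>y \<in> S\<close>])
    fix z assume z: "z \<in> S"
    show "(f has_derivative (\<lambda>h. h \<bullet> g z)) (at z within S)"
      using D[OF z] by (simp add: gderiv_def has_derivative_at_withinI)
    show "onorm (\<lambda>h. h \<bullet> g z) \<le> C"
    proof (rule onorm_bound[OF C])
      fix h
      have "norm (h \<bullet> g z) \<le> norm h * norm (g z)"
        using Cauchy_Schwarz_ineq2 by simp
      also have "\<dots> \<le> norm h * C"
        by (intro mult_left_mono B z) simp
      finally show "norm (h \<bullet> g z) \<le> C * norm h" by (simp add: mult.commute)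
    qed
  qed
  then show "dist (f x) (f y) \<le> C * dist x y" by (simp add: dist_norm)
qed

lemma lipschitz_of_derivative_bound:
  fixes g :: "'a::euclidean_space \<Rightarrow> 'b::euclidean_space"
  assumes S: "convex S" and D: "\<And>z. z \<in> S \<Longrightarrow> (g has_derivative D z) (at z)"
    and B: "\<And>z k. z \<in> S \<Longrightarrow> norm (D z k) \<le> K * norm k" and K: "0 \<le> K"
  shows "K-lipschitz_on S g"
proof (rule lipschitz_onI[OF _ K])
  fix x y assume "x \<in> S" "y \<in> S"
  have "norm (g x - g y) \<le> K * norm (x - y)"
    using D B K
    by (intro differentiable_bound[OF S _ _ \<open>x \<in> S\<close> \<open>y \<in> S\<close>, of _ D])
      (auto intro: has_derivative_at_withinI onorm_bound)
  then show "dist (g x) (g y) \<le> K * dist x y" by (simp add: dist_norm)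
qed

lemma gronwall_norm:
  fixes \<delta> :: "real \<Rightarrow> 'a::euclidean_space"
  assumes st: "s \<le> t"
    and D: "\<And>\<tau>. \<tau> \<in> {s..t} \<Longrightarrow> (\<delta> has_vector_derivative \<delta>' \<tau>) (at \<tau>)"
    and B: "\<And>\<tau>. \<tau> \<in> {s..t} \<Longrightarrow> norm (\<delta>' \<tau>) \<le> M * norm (\<delta> \<tau>)"
  shows "norm (\<delta> t) \<le> exp (M * (t - s)) * norm (\<delta> s)"
proof -
  \<comment> \<open>The squared norm stays differentiable where \<open>\<delta>\<close> vanishes;
    the weight turns the growth bound into monotonicity.\<close>
  define y where "y \<tau> = (\<delta> \<tau> \<bullet> \<delta> \<tau>) * exp (- 2 * M * \<tau>)" for \<tau>
  have "y t \<le> y s"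
  proof (rule DERIV_nonpos_imp_nonincreasing[OF st])
    fix \<tau> assume "s \<le> \<tau>" "\<tau> \<le> t"
    then have \<tau>: "\<tau> \<in> {s..t}" by simp
    have "((\<lambda>\<tau>. \<delta> \<tau> \<bullet> \<delta> \<tau>) has_derivative (\<lambda>h. h * (2 * (\<delta> \<tau> \<bullet> \<delta>' \<tau>)))) (at \<tau>)"
      using has_derivative_inner[OF D[OF \<tau>, unfolded has_vector_derivative_def]
          D[OF \<tau>, unfolded has_vector_derivative_def]]
      by (simp add: inner_commute algebra_simps)
    then have "((\<lambda>\<tau>. \<delta> \<tau> \<bullet> \<delta> \<tau>) has_real_derivative 2 * (\<delta> \<tau> \<bullet> \<delta>' \<tau>)) (at \<tau>)"
      by (rule has_derivative_imp_has_field_derivative) (rule refl)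
    then have d: "(y has_real_derivative
        2 * (\<delta> \<tau> \<bullet> \<delta>' \<tau>) * exp (- 2 * M * \<tau>) + (\<delta> \<tau> \<bullet> \<delta> \<tau>) * (exp (- 2 * M * \<tau>) * (- 2 * M))) (at \<tau>)"
      unfolding y_def by (auto intro!: derivative_eq_intros)
    have "\<delta> \<tau> \<bullet> \<delta>' \<tau> \<le> norm (\<delta> \<tau>) * norm (\<delta>' \<tau>)"
      by (rule norm_cauchy_schwarz)
    also have "\<dots> \<le> norm (\<delta> \<tau>) * (M * norm (\<delta> \<tau>))"
      by (intro mult_left_mono B \<tau>) simp
    finally have "(\<delta> \<tau> \<bullet> \<delta>' \<tau>) \<le> M * (\<delta> \<tau> \<bullet> \<delta> \<tau>)"
      by (simp add: dot_square_norm power2_eq_square algebra_simps)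
    then have "2 * exp (- 2 * M * \<tau>) * (\<delta> \<tau> \<bullet> \<delta>' \<tau>) \<le> 2 * exp (- 2 * M * \<tau>) * (M * (\<delta> \<tau> \<bullet> \<delta> \<tau>))"
      by (intro mult_left_mono) simp_all
    then have "2 * (\<delta> \<tau> \<bullet> \<delta>' \<tau>) * exp (- 2 * M * \<tau>) + (\<delta> \<tau> \<bullet> \<delta> \<tau>) * (exp (- 2 * M * \<tau>) * (- 2 * M)) \<le> 0"
      by (simp add: algebra_simps)
    then show "\<exists>z. (y has_real_derivative z) (at \<tau>) \<and> z \<le> 0"
      using d by blast
  qed
  then have "(norm (\<delta> t))\<^sup>2 * exp (- 2 * M * t) * exp (2 * M * t)
      \<le> (norm (\<delta> s))\<^sup>2 * exp (- 2 * M * s) * exp (2 * M * t)"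
    unfolding y_def dot_square_norm by (rule mult_right_mono) simp
  then have "(norm (\<delta> t))\<^sup>2 \<le> (norm (\<delta> s))\<^sup>2 * exp (2 * (M * (t - s)))"
    by (simp add: mult.assoc flip: exp_add) (simp add: algebra_simps)
  also have "\<dots> = (exp (M * (t - s)) * norm (\<delta> s))\<^sup>2"
    by (simp add: power_mult_distrib exp_double)
  finally show ?thesis
    by (rule power2_le_imp_le) simp
qed

locale hamiltonian =
  fixes H :: "('a::euclidean_space) hamiltonian" and A :: real
  assumes admissible: "admissible_hamiltonian H A"
begin

lemma C2_H: "C2_on UNIV H"
  using admissible by (simp add: admissible_hamiltonian_def)

lemma norm_grad_H: "norm (grad H (t, x, p)) \<le> A * (1 + norm p)"
  using admissible by (simp add: admissible_hamiltonian_def)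

lemma A_nonneg: "0 \<le> A"
  using order.trans[OF norm_ge_zero norm_grad_H[of 0 0 0]] by simp

lemma lipschitz_grad_H: "A-lipschitz_on UNIV (grad H)"
  using admissible by (auto simp: admissible_hamiltonian_def intro!: lipschitz_grad_of_d2_norm)

lemma gderiv_H: "GDERIV H z :> grad H z"
  using C2_on_gderiv[OF C2_H] by simp

lemma continuous_H: "continuous_on UNIV H"
  using C2_on_differentiable[OF C2_H]
  by (auto intro!: differentiable_imp_continuous_on simp: differentiable_on_def differentiable_at_imp_differentiable_on)

lemma norm_grad_H_le:
  assumes "norm p \<le> \<Lambda>"
  shows "norm (grad H (t, x, p)) \<le> A * (1 + \<Lambda>)"
  using norm_grad_H[of t x p] assms A_nonneg
  by (meson add_left_mono mult_left_mono order.trans)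

lemma H_lipschitz:
  assumes "norm p \<le> \<Lambda>" "norm p' \<le> \<Lambda>"
  shows "\<bar>H (t, x, p) - H (t', x', p')\<bar> \<le> A * (1 + \<Lambda>) * (\<bar>t - t'\<bar> + norm (x - x') + norm (p - p'))"
proof -
  have \<Lambda>: "0 \<le> \<Lambda>" using assms(1) norm_ge_zero order.trans by blast
  have "(A * (1 + \<Lambda>))-lipschitz_on (UNIV \<times> UNIV \<times> cball 0 \<Lambda>) H"
    using A_nonneg \<Lambda>
    by (intro lipschitz_of_gradient_bound[of _ _ "grad H"] convex_Times convex_UNIV convex_cball gderiv_H)
      (auto intro: norm_grad_H_le)
  then have "\<bar>H (t, x, p) - H (t', x', p')\<bar> \<le> A * (1 + \<Lambda>) * norm ((t, x, p) - (t', x', p'))"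
    using assms lipschitz_onD by (fastforce simp: dist_norm)
  also have "norm ((t, x, p) - (t', x', p')) \<le> \<bar>t - t'\<bar> + (norm (x - x') + norm (p - p'))"
    using norm_Pair_le[of "t - t'" "(x - x', p - p')"] norm_Pair_le[of "x - x'" "p - p'"] by simp
  finally show ?thesis
    using A_nonneg \<Lambda> by (simp add: mult_left_mono add.assoc)
qed

text \<open>This bounds the full Hessian in \<open>(t, x)\<close> of a classical solution, given
  \<open>\<Lambda>\<close> for the spatial gradient and \<open>\<rho>\<close> for the spatial
  Hessian. Here \<open>m\<close> bounds the derivative of the spatial gradient: the summand
  \<open>\<rho>\<close> is for space directions, the other one for the time direction. The outer
  expression adds the derivative of the time component, obtained from the equation.\<close>

definition hess_bound :: "real \<Rightarrow> real \<Rightarrow> real" where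
  "hess_bound \<Lambda> \<rho> = (let m = A * (1 + \<Lambda>) * (1 + \<rho>) + \<rho> in A * (1 + \<Lambda>) * (1 + m) + m)"

lemma hess_bound_nonneg: "0 \<le> \<Lambda> \<Longrightarrow> 0 \<le> \<rho> \<Longrightarrow> 0 \<le> hess_bound \<Lambda> \<rho>"
  using A_nonneg by (simp add: hess_bound_def Let_def)

section \<open>Second derivatives of classical solutions\<close>

lemma classical_gderiv:
  assumes "classical_solution_on H \<Omega> f" "z \<in> \<Omega>"
  shows "GDERIV f z :> grad f z"
  using assms C2_on_gderiv by (auto simp: classical_solution_on_def)

lemma classical_HJ:
  assumes "classical_solution_on H \<Omega> f" "(t, x) \<in> \<Omega>"
  shows "fst (grad f (t, x)) = - H (t, x, snd (grad f (t, x)))"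
  using assms unfolding classical_solution_on_def HJ_def by fastforce

lemma classical_grad_has_derivative:
  assumes "classical_solution_on H \<Omega> f" "open \<Omega>" "z \<in> \<Omega>"
  shows "(grad f has_derivative frechet_derivative (grad f) (at z)) (at z)"
  using assms C2_on_grad_differentiable
  by (auto simp: classical_solution_on_def simp flip: frechet_derivative_works)

text \<open>\<open>HJ H f\<close> is constant on the open set \<open>\<Omega>\<close>, so its
  derivative vanishes. This expresses the time component of the Hessian through its space
  component.\<close>

lemma differentiated_HJ:
  assumes f: "classical_solution_on H \<Omega> f" and \<Omega>: "open \<Omega>" "z \<in> \<Omega>"
    and D: "(grad f has_derivative D) (at z)"
  shows "fst (D k) + (fst k, snd k, snd (D k)) \<bullet> grad H (fst z, snd z, snd (grad f z)) = 0"
proof -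
  have fst: "((\<lambda>w. fst (grad f w)) has_derivative (\<lambda>k. fst (D k))) (at z)"
    and snd: "((\<lambda>w. snd (grad f w)) has_derivative (\<lambda>k. snd (D k))) (at z)"
    using D by (auto intro: has_derivative_fst has_derivative_snd)
  have "((\<lambda>w. (fst w, snd w, snd (grad f w))) has_derivative (\<lambda>k. (fst k, snd k, snd (D k)))) (at z)"
    by (intro has_derivative_Pair snd has_derivative_fst has_derivative_snd has_derivative_ident)
  from has_derivative_compose[OF this gderiv_H[unfolded gderiv_def]]
  have "((\<lambda>w. H (fst w, snd w, snd (grad f w))) has_derivative
      (\<lambda>k. (fst k, snd k, snd (D k)) \<bullet> grad H (fst z, snd z, snd (grad f z)))) (at z)" .
  from has_derivative_add[OF fst this]
  have 1: "((\<lambda>w. HJ H f w) has_derivative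
      (\<lambda>k. fst (D k) + (fst k, snd k, snd (D k)) \<bullet> grad H (fst z, snd z, snd (grad f z)))) (at z)"
    by (simp add: HJ_def)
  have "((\<lambda>w. HJ H f w) has_derivative (\<lambda>k. 0)) (at z)"
    by (rule has_derivative_transform_within_open[OF has_derivative_const[of 0] \<Omega>])
      (use f in \<open>simp add: classical_solution_on_def\<close>)
  from has_derivative_unique[OF 1 this] show ?thesis by metis
qed

lemma classical_hessian_symmetric:
  assumes f: "classical_solution_on H \<Omega> f" and \<Omega>: "open \<Omega>" "z \<in> \<Omega>"
    and D: "(grad f has_derivative D) (at z)"
  shows "k \<bullet> D h = h \<bullet> D k"
  using gradient_derivative_symmetric[OF \<Omega> _ D] classical_gderiv[OF f] by blast

text \<open>The space block is bounded by \<open>\<rho>\<close>. For the mixed derivative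
  \<open>e\<close>, symmetry turns \<open>e \<bullet> e\<close> into the time component of
  \<open>D (0, e)\<close>, which the differentiated equation bounds through the space block. The
  time component in an arbitrary direction then follows from the equation again.\<close>

lemma classical_hessian_bound:
  assumes f: "classical_solution_on H \<Omega> f" and \<Omega>: "open \<Omega>" "z \<in> \<Omega>"
    and D: "(grad f has_derivative D) (at z)"
    and \<Lambda>: "norm (snd (grad f z)) \<le> \<Lambda>" and \<rho>: "\<And>y. norm (snd (D (0, y))) \<le> \<rho> * norm y" "0 \<le> \<rho>"
  shows "norm (D k) \<le> hess_bound \<Lambda> \<rho> * norm k"
proof -
  interpret D: bounded_linear D using D by (rule has_derivative_bounded_linear)
  define c where "c = A * (1 + \<Lambda>)"
  define m where "m = c * (1 + \<rho>) + \<rho>"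
  have c: "0 \<le> c"
    using A_nonneg \<Lambda> norm_ge_zero[of "snd (grad f z)"] unfolding c_def
    by (intro mult_nonneg_nonneg) linarith+
  have m: "0 \<le> m" using c \<rho> by (simp add: m_def)
  have fst_le: "\<bar>fst (D k)\<bar> \<le> c * (norm k + norm (snd (D k)))" for k
  proof -
    have "\<bar>fst (D k)\<bar> = \<bar>(fst k, snd k, snd (D k)) \<bullet> grad H (fst z, snd z, snd (grad f z))\<bar>"
      using differentiated_HJ[OF f \<Omega> D, of k] by linarith
    also have "\<dots> \<le> norm (fst k, snd k, snd (D k)) * norm (grad H (fst z, snd z, snd (grad f z)))"
      by (rule Cauchy_Schwarz_ineq2)
    also have "\<dots> \<le> norm (fst k, snd k, snd (D k)) * c"
      unfolding c_def by (intro mult_left_mono norm_grad_H_le \<Lambda>) simp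
    finally have le: "\<bar>fst (D k)\<bar> \<le> norm (fst k, snd k, snd (D k)) * c" .
    have "norm (fst k, snd k, snd (D k)) \<le> norm k + norm (snd (D k))"
    proof -
      have "(fst k, snd k, snd (D k)) = (fst k, snd k, 0) + (0, 0, snd (D k))" by simp
      then have "norm (fst k, snd k, snd (D k)) \<le> norm (fst k, snd k, 0::'a) + norm (0::real, 0::'a, snd (D k))"
        by (metis norm_triangle_ineq)
      also have "norm (fst k, snd k, 0::'a) = norm k"
        by (cases k) (simp add: norm_Pair)
      also have "norm (0::real, 0::'a, snd (D k)) = norm (snd (D k))"
        by (simp add: norm_Pair)
      finally show ?thesis .
    qed
    from order.trans[OF le mult_right_mono[OF this c]] show ?thesis
      by (simp add: mult.commute)
  qed
  have time: "norm (snd (D (1, 0))) \<le> c * (1 + \<rho>)"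
  proof -
    define e where "e = snd (D (1, 0))"
    have "e \<bullet> e = (0, e) \<bullet> D (1, 0)" by (cases "D (1, 0)") (simp add: e_def)
    also have "\<dots> = (1, 0) \<bullet> D (0, e)"
      by (rule classical_hessian_symmetric[OF f \<Omega> D])
    also have "\<dots> = fst (D (0, e))" by (cases "D (0, e)") simp
    also have "\<dots> \<le> c * (norm (0::real, e) + norm (snd (D (0, e))))"
      using fst_le[of "(0, e)"] by linarith
    also have "\<dots> \<le> c * (norm e + \<rho> * norm e)"
      using c \<rho>(1) by (intro mult_left_mono add_mono) (simp_all add: norm_Pair)
    finally have "norm e * norm e \<le> (c * (1 + \<rho>)) * norm e"
      by (simp add: dot_square_norm power2_eq_square algebra_simps)
    then have "norm e \<le> c * (1 + \<rho>)"
      using c \<rho> by (cases "e = 0") auto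
    then show ?thesis by (simp add: e_def)
  qed
  have snd_le: "norm (snd (D k)) \<le> m * norm k"
  proof -
    have "D k = fst k *\<^sub>R D (1, 0) + D (0, snd k)"
      by (simp flip: D.scaleR D.add)
    then have "norm (snd (D k)) \<le> \<bar>fst k\<bar> * norm (snd (D (1, 0))) + norm (snd (D (0, snd k)))"
      by (metis norm_triangle_ineq norm_scaleR snd_add snd_scaleR)
    also have "\<dots> \<le> norm k * (c * (1 + \<rho>)) + \<rho> * norm k"
    proof (intro add_mono mult_mono time)
      show "\<bar>fst k\<bar> \<le> norm k" using norm_fst_le[of "fst k" "snd k"] by simp
      have "norm (snd (D (0, snd k))) \<le> \<rho> * norm (snd k)" by (rule \<rho>)
      also have "\<dots> \<le> \<rho> * norm k"
        using norm_snd_le[of "snd k" "fst k"] \<rho>(2) by (simp add: mult_left_mono)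
      finally show "norm (snd (D (0, snd k))) \<le> \<rho> * norm k" .
    qed simp_all
    finally show ?thesis by (simp add: m_def algebra_simps)
  qed
  have "norm (D k) \<le> \<bar>fst (D k)\<bar> + norm (snd (D k))"
    using norm_Pair_le[of "fst (D k)" "snd (D k)"] by simp
  also have "\<dots> \<le> c * (norm k + m * norm k) + m * norm k"
    by (intro add_mono order.trans[OF fst_le] mult_left_mono snd_le order.refl c)
  also have "\<dots> = hess_bound \<Lambda> \<rho> * norm k"
    by (simp add: hess_bound_def Let_def m_def c_def algebra_simps)
  finally show ?thesis .
qed

text \<open>Along the Hamiltonian vector field, \<open>\<partial>\<^sub>x f\<close> satisfies the equation for \<open>p\<close>.\<close>

lemma classical_characteristic:
  assumes f: "classical_solution_on H \<Omega> f" and \<Omega>: "open \<Omega>" "z \<in> \<Omega>"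
    and D: "(grad f has_derivative D) (at z)"
  shows "snd (D (1, snd (snd (grad H (fst z, snd z, snd (grad f z))))))
      = - fst (snd (grad H (fst z, snd z, snd (grad f z))))"
proof -
  define G where "G = grad H (fst z, snd z, snd (grad f z))"
  have "e \<bullet> snd (D (1, snd (snd G))) = e \<bullet> (- fst (snd G))" for e
  proof -
    have "e \<bullet> snd (D (1, snd (snd G))) = (0, e) \<bullet> D (1, snd (snd G))"
      by (cases "D (1, snd (snd G))") simp
    also have "\<dots> = (1, snd (snd G)) \<bullet> D (0, e)"
      by (rule classical_hessian_symmetric[OF f \<Omega> D])
    also have "\<dots> = fst (D (0, e)) + snd (snd G) \<bullet> snd (D (0, e))"
      by (cases "D (0, e)") simp
    also have "\<dots> = e \<bullet> (- fst (snd G))"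
      using differentiated_HJ[OF f \<Omega> D, of "(0, e)", folded G_def]
      by (cases G) (auto simp: inner_commute)
    finally show ?thesis .
  qed
  then show ?thesis unfolding G_def by (metis vector_eq_ldot)
qed

text \<open>By the equation, the derivative of \<open>f\<close> along \<open>q\<close> and the
  integrand of the action differ by the first order Taylor remainder of \<open>H\<close> in
  \<open>p\<close>, between \<open>p \<tau>\<close> and the gradient \<open>P \<tau>\<close>; it is
  quadratic in \<open>\<delta>\<close> and needs no sign, hence no convexity of \<open>H\<close>.
  Gronwall's inequality bounds \<open>\<delta>\<close> by its initial value.\<close>

lemma action_comparison:
  assumes f: "classical_solution_on H \<Omega> f" and \<Omega>: "open \<Omega>" "{s..t} \<times> UNIV \<subseteq> \<Omega>" and st: "s \<le> t"
    and K: "\<And>z k. z \<in> {s..t} \<times> UNIV \<Longrightarrow> norm (frechet_derivative (grad f) (at z) k) \<le> K * norm k" "0 \<le> K"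
    and qp: "hamiltonian_trajectory H q p"
  shows "\<bar>f (t, q t) - f (s, q s) -
      integral {s..t} (\<lambda>\<tau>. p \<tau> \<bullet> vector_derivative q (at \<tau>) - H (\<tau>, q \<tau>, p \<tau>))\<bar>
    \<le> A * (exp (A * (1 + K) * (t - s)) * norm (snd (grad f (s, q s)) - p s))\<^sup>2 * (t - s)"
proof -
  define X where "X \<tau> = snd (snd (grad H (\<tau>, q \<tau>, p \<tau>)))" for \<tau>
  define P where "P \<tau> = snd (grad f (\<tau>, q \<tau>))" for \<tau>
  define Y where "Y \<tau> = snd (snd (grad H (\<tau>, q \<tau>, P \<tau>)))" for \<tau>
  define D where "D \<tau> = frechet_derivative (grad f) (at (\<tau>, q \<tau>))" for \<tau>
  define \<delta> where "\<delta> \<tau> = P \<tau> - p \<tau>" for \<tau>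
  have in\<Omega>: "(\<tau>, y) \<in> \<Omega>" if "\<tau> \<in> {s..t}" for \<tau> y
    using that \<Omega>(2) by auto
  have q: "(q has_vector_derivative X \<tau>) (at \<tau>)"
    and p: "(p has_vector_derivative - fst (snd (grad H (\<tau>, q \<tau>, p \<tau>)))) (at \<tau>)" for \<tau>
    using qp by (simp_all add: hamiltonian_trajectory_def X_def)
  have curve: "((\<lambda>\<tau>. (\<tau>, q \<tau>)) has_derivative (\<lambda>h. h *\<^sub>R (1, X \<tau>))) (at \<tau>)" for \<tau>
    using has_derivative_Pair[OF has_derivative_ident q[unfolded has_vector_derivative_def]]
    by simp
  have gradH_diff: "norm (snd (grad H (\<tau>, q \<tau>, P \<tau>)) - snd (grad H (\<tau>, q \<tau>, p \<tau>))) \<le> A * norm (\<delta> \<tau>)" for \<tau>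
  proof -
    have "norm (snd (grad H (\<tau>, q \<tau>, P \<tau>)) - snd (grad H (\<tau>, q \<tau>, p \<tau>)))
        \<le> norm (grad H (\<tau>, q \<tau>, P \<tau>) - grad H (\<tau>, q \<tau>, p \<tau>))"
      by (metis norm_snd_le prod.collapse snd_diff)
    also have "\<dots> \<le> A * norm ((\<tau>, q \<tau>, P \<tau>) - (\<tau>, q \<tau>, p \<tau>))"
      using lipschitz_onD[OF lipschitz_grad_H UNIV_I UNIV_I] unfolding dist_norm .
    also have "\<dots> = A * norm (\<delta> \<tau>)"
      by (simp add: \<delta>_def norm_Pair)
    finally show ?thesis .
  qed
  have bound: "norm (\<delta> \<tau>) \<le> exp (A * (1 + K) * (t - s)) * norm (\<delta> s)" if \<tau>: "\<tau> \<in> {s..t}" for \<tau>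
  proof -
    have "norm (\<delta> \<tau>) \<le> exp (A * (1 + K) * (\<tau> - s)) * norm (\<delta> s)"
    proof (rule gronwall_norm)
      show "s \<le> \<tau>" using \<tau> by simp
      fix r assume "r \<in> {s..\<tau>}"
      then have r: "r \<in> {s..t}" using \<tau> by auto
      have D: "(grad f has_derivative D r) (at (r, q r))"
        unfolding D_def by (rule classical_grad_has_derivative[OF f \<Omega>(1) in\<Omega>[OF r]])
      interpret D: bounded_linear "D r" using D by (rule has_derivative_bounded_linear)
      have "(P has_vector_derivative snd (D r (1, X r))) (at r)"
        unfolding P_def has_vector_derivative_def
        using has_derivative_snd[OF has_derivative_compose[OF curve D]]
        by (simp only: D.scaleR snd_scaleR)
      from has_vector_derivative_diff[OF this p]
      show "(\<delta> has_vector_derivative snd (D r (1, X r)) + fst (snd (grad H (r, q r, p r)))) (at r)"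
        by (simp add: \<delta>_def[abs_def])
      have "snd (D r (1, Y r)) = - fst (snd (grad H (r, q r, P r)))"
        using classical_characteristic[OF f \<Omega>(1) in\<Omega>[OF r] D] by (simp add: Y_def P_def)
      \<comment> \<open>The identity for characteristics concerns the velocity \<open>Y\<close> that
        belongs to \<open>P\<close>, whereas \<open>q\<close> moves with the velocity
        \<open>X\<close> that belongs to \<open>p\<close>. The Hessian is applied to the difference,
        which is of order \<open>\<delta>\<close>.\<close>
      moreover have "D r (1, X r) = D r (1, Y r) + D r (0, X r - Y r)"
        by (simp flip: D.add)
      ultimately have eq: "snd (D r (1, X r)) + fst (snd (grad H (r, q r, p r)))
          = snd (D r (0, X r - Y r)) - (fst (snd (grad H (r, q r, P r))) - fst (snd (grad H (r, q r, p r))))"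
        by simp
      have "norm (snd (D r (0, X r - Y r))) \<le> norm (D r (0, X r - Y r))"
        by (metis norm_snd_le prod.collapse)
      also have "\<dots> \<le> K * norm (X r - Y r)"
        using K(1)[of "(r, q r)" "(0, X r - Y r)"] r by (simp add: D_def norm_Pair)
      also have "\<dots> \<le> K * (A * norm (\<delta> r))"
      proof (intro mult_left_mono K(2))
        have "norm (X r - Y r) = norm (snd (snd (grad H (r, q r, P r)) - snd (grad H (r, q r, p r))))"
          by (simp add: X_def Y_def norm_minus_commute)
        also have "\<dots> \<le> norm (snd (grad H (r, q r, P r)) - snd (grad H (r, q r, p r)))"
          by (metis norm_snd_le prod.collapse)
        finally show "norm (X r - Y r) \<le> A * norm (\<delta> r)"
          using gradH_diff order.trans by blast
      qed
      finally have 1: "norm (snd (D r (0, X r - Y r))) \<le> K * (A * norm (\<delta> r))" .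
      have "norm (fst (snd (grad H (r, q r, P r))) - fst (snd (grad H (r, q r, p r))))
         = norm (fst (snd (grad H (r, q r, P r)) - snd (grad H (r, q r, p r))))"
        by simp
      also have "\<dots> \<le> norm (snd (grad H (r, q r, P r)) - snd (grad H (r, q r, p r)))"
        by (metis norm_fst_le prod.collapse)
      finally have 2: "norm (fst (snd (grad H (r, q r, P r))) - fst (snd (grad H (r, q r, p r)))) \<le> A * norm (\<delta> r)"
        using gradH_diff order.trans by blast
      show "norm (snd (D r (1, X r)) + fst (snd (grad H (r, q r, p r)))) \<le> A * (1 + K) * norm (\<delta> r)"
        unfolding eq using norm_triangle_ineq4 add_mono[OF 1 2] order.trans
        by (fastforce simp: algebra_simps)
    qed
    also have "\<dots> \<le> exp (A * (1 + K) * (t - s)) * norm (\<delta> s)"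
      using \<tau> A_nonneg K(2) by (intro mult_right_mono) (simp_all add: mult_left_mono)
    finally show ?thesis .
  qed
  define E where "E \<tau> = - H (\<tau>, q \<tau>, P \<tau>) + X \<tau> \<bullet> P \<tau>" for \<tau>
  define act where "act \<tau> = p \<tau> \<bullet> vector_derivative q (at \<tau>) - H (\<tau>, q \<tau>, p \<tau>)" for \<tau>
  have act: "act \<tau> = p \<tau> \<bullet> X \<tau> - H (\<tau>, q \<tau>, p \<tau>)" for \<tau>
    using vector_derivative_at[OF q] by (simp add: act_def)
  have "(E has_integral f (t, q t) - f (s, q s)) {s..t}"
  proof (rule fundamental_theorem_of_calculus[OF st, where f = "\<lambda>\<tau>. f (\<tau>, q \<tau>)"])
    fix \<tau> assume \<tau>: "\<tau> \<in> {s..t}"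
    have "((\<lambda>\<tau>. f (\<tau>, q \<tau>)) has_derivative (\<lambda>h. (h *\<^sub>R (1, X \<tau>)) \<bullet> grad f (\<tau>, q \<tau>))) (at \<tau>)"
      using has_derivative_compose[OF curve classical_gderiv[OF f in\<Omega>[OF \<tau>], unfolded gderiv_def]] .
    moreover have "(h *\<^sub>R (1, X \<tau>)) \<bullet> grad f (\<tau>, q \<tau>) = h *\<^sub>R E \<tau>" for h
      using classical_HJ[OF f in\<Omega>[OF \<tau>, of "q \<tau>"]]
      by (cases "grad f (\<tau>, q \<tau>)") (simp add: E_def P_def algebra_simps)
    ultimately show "((\<lambda>\<tau>. f (\<tau>, q \<tau>)) has_vector_derivative E \<tau>) (at \<tau> within {s..t})"
      by (simp add: has_vector_derivative_def has_derivative_at_withinI)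
  qed
  moreover have "continuous_on {s..t} act"
  proof -
    have cq: "continuous_on {s..t} q" and cp: "continuous_on {s..t} p"
      using q p by (auto intro!: continuous_at_imp_continuous_on has_vector_derivative_continuous)
    have cg: "continuous_on UNIV (grad H)"
      by (rule lipschitz_on_continuous_on[OF lipschitz_grad_H])
    show ?thesis
      unfolding act[abs_def] X_def
      by (intro continuous_intros cq cp continuous_on_compose2[OF cg] continuous_on_compose2[OF continuous_H]) auto
  qed
  then have "(act has_integral integral {s..t} act) {s..t}"
    by (intro integrable_integral integrable_continuous_interval)
  ultimately have int: "((\<lambda>\<tau>. E \<tau> - act \<tau>) has_integral f (t, q t) - f (s, q s) - integral {s..t} act) {s..t}"
    by (rule has_integral_diff)
  define R where "R = A * (exp (A * (1 + K) * (t - s)) * norm (\<delta> s))\<^sup>2"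
  have "norm (E \<tau> - act \<tau>) \<le> R" if \<tau>: "\<tau> \<in> {s..t}" for \<tau>
  proof -
    have "\<bar>H (\<tau>, q \<tau>, P \<tau>) - H (\<tau>, q \<tau>, p \<tau>)
        - grad H (\<tau>, q \<tau>, p \<tau>) \<bullet> ((\<tau>, q \<tau>, P \<tau>) - (\<tau>, q \<tau>, p \<tau>))\<bar>
      \<le> A * (norm ((\<tau>, q \<tau>, P \<tau>) - (\<tau>, q \<tau>, p \<tau>)))\<^sup>2"
      by (rule taylor_lipschitz_gradient[OF gderiv_H lipschitz_grad_H]) auto
    moreover have "grad H (\<tau>, q \<tau>, p \<tau>) \<bullet> ((\<tau>, q \<tau>, P \<tau>) - (\<tau>, q \<tau>, p \<tau>)) = X \<tau> \<bullet> P \<tau> - p \<tau> \<bullet> X \<tau>"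
      by (cases "grad H (\<tau>, q \<tau>, p \<tau>)") (simp add: X_def inner_diff_right inner_commute)
    moreover have "norm ((\<tau>, q \<tau>, P \<tau>) - (\<tau>, q \<tau>, p \<tau>)) = norm (\<delta> \<tau>)"
      by (simp add: \<delta>_def norm_Pair)
    ultimately have "\<bar>E \<tau> - act \<tau>\<bar> \<le> A * (norm (\<delta> \<tau>))\<^sup>2"
      by (simp add: E_def act algebra_simps abs_minus_commute)
    also have "\<dots> \<le> R"
      unfolding R_def by (intro mult_left_mono power_mono bound[OF \<tau>] A_nonneg) simp
    finally show ?thesis by simp
  qed
  moreover have "0 \<le> R" using A_nonneg by (simp add: R_def)
  ultimately have "norm (f (t, q t) - f (s, q s) - integral {s..t} act) \<le> R * (t - s)"
    using has_integral_bound_real[OF _ finite.emptyI int] st by simp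
  then show ?thesis
    by (simp add: R_def act_def[abs_def] \<delta>_def P_def)
qed

end

section \<open>Functions of class C2 with bounded differentials\<close>

lemma higher_differentiable_on_cong:
  assumes "higher_differentiable_on S f n" "open S" "\<And>x. x \<in> S \<Longrightarrow> f x = g x"
  shows "higher_differentiable_on S g n"
  using assms
proof (induction n arbitrary: f g)
  case 0
  then show ?case by (simp cong: continuous_on_cong)
next
  case (Suc n)
  have d: "(f has_derivative frechet_derivative f (at x)) (at x)" if "x \<in> S" for x
    using Suc.prems(1) that by (simp flip: frechet_derivative_works)
  have g: "(g has_derivative frechet_derivative f (at x)) (at x)" if "x \<in> S" for x
    by (rule has_derivative_transform_within_open[OF d[OF that] \<open>open S\<close> that Suc.prems(3)])
  then have "g differentiable (at x)" if "x \<in> S" for x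
    using that differentiableI by blast
  moreover have "higher_differentiable_on S (\<lambda>x. frechet_derivative g (at x) h) n" for h
    by (rule Suc.IH[of "\<lambda>x. frechet_derivative f (at x) h"])
      (use Suc.prems frechet_derivative_at[OF g] in auto)
  ultimately show ?case by simp
qed

lemma higher_differentiable_on_linear_combination:
  assumes "higher_differentiable_on S f n" "higher_differentiable_on S g n" "open S"
  shows "higher_differentiable_on S (\<lambda>x. a * f x + b * g x) n"
  using assms
proof (induction n arbitrary: f g)
  case 0
  then show ?case by (auto intro!: continuous_intros)
next
  case (Suc n)
  have d: "((\<lambda>x. a * f x + b * g x) has_derivative
      (\<lambda>h. a * frechet_derivative f (at x) h + b * frechet_derivative g (at x) h)) (at x)"
    if "x \<in> S" for x
    using Suc.prems(1,2) that
    by (intro has_derivative_add has_derivative_mult_right) (simp_all flip: frechet_derivative_works)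
  then have "(\<lambda>x. a * f x + b * g x) differentiable (at x)" if "x \<in> S" for x
    using that differentiableI by blast
  moreover have "higher_differentiable_on S (\<lambda>x. frechet_derivative (\<lambda>x. a * f x + b * g x) (at x) h) n" for h
    by (rule higher_differentiable_on_cong[OF Suc.IH[of "\<lambda>x. frechet_derivative f (at x) h"
            "\<lambda>x. frechet_derivative g (at x) h"]])
      (use Suc.prems in \<open>auto simp flip: frechet_derivative_at[OF d]\<close>)
  ultimately show ?case by simp
qed

lemma higher_differentiable_on_slice:
  fixes f :: "real \<times> 'a::euclidean_space \<Rightarrow> real"
  assumes "higher_differentiable_on \<Omega> f n" "open \<Omega>" "{t} \<times> UNIV \<subseteq> \<Omega>"
  shows "higher_differentiable_on UNIV (\<lambda>x. f (t, x)) n"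
  using assms
proof (induction n arbitrary: f)
  case 0
  then show ?case
    by (auto intro!: continuous_on_compose2[of \<Omega> f] continuous_intros)
next
  case (Suc n)
  have d: "((\<lambda>x. f (t, x)) has_derivative (\<lambda>h. frechet_derivative f (at (t, x)) (0, h))) (at x)" for x
  proof (rule has_derivative_compose[of "\<lambda>x. (t, x)"])
    show "((\<lambda>x. (t, x)) has_derivative (\<lambda>h. (0, h))) (at x)"
      by (intro has_derivative_Pair has_derivative_const has_derivative_ident)
    show "(f has_derivative frechet_derivative f (at (t, x))) (at (t, x))"
      using Suc.prems by (auto simp flip: frechet_derivative_works)
  qed
  then have "(\<lambda>x. f (t, x)) differentiable (at x)" for x
    using differentiableI by blast
  moreover have "higher_differentiable_on UNIV (\<lambda>x. frechet_derivative (\<lambda>x. f (t, x)) (at x) h) n" for h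
    using Suc.IH[of "\<lambda>z. frechet_derivative f (at z) (0, h)"] Suc.prems
    by (simp flip: frechet_derivative_at[OF d])
  ultimately show ?case by simp
qed

definition C2_class :: "real \<Rightarrow> real \<Rightarrow> ('a::euclidean_space \<Rightarrow> real) set" where
  "C2_class \<rho> \<Lambda> = {\<phi>. C2_on UNIV \<phi> \<and> (\<forall>x. d2_norm \<phi> x \<le> \<rho>) \<and> \<Lambda>-lipschitz_on UNIV \<phi>}"

lemma C2_class_gderiv: "\<phi> \<in> C2_class \<rho> \<Lambda> \<Longrightarrow> GDERIV \<phi> x :> grad \<phi> x"
  using C2_on_gderiv by (auto simp: C2_class_def)

lemma C2_class_norm_grad: "\<phi> \<in> C2_class \<rho> \<Lambda> \<Longrightarrow> norm (grad \<phi> x) \<le> \<Lambda>"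
  using norm_gradient_le C2_class_gderiv by (fastforce simp: C2_class_def)

lemma C2_class_lipschitz: "\<phi> \<in> C2_class \<rho> \<Lambda> \<Longrightarrow> \<Lambda>-lipschitz_on UNIV \<phi>"
  by (simp add: C2_class_def)

lemma C2_class_lipschitz_grad: "\<phi> \<in> C2_class \<rho> \<Lambda> \<Longrightarrow> \<rho>-lipschitz_on UNIV (grad \<phi>)"
  by (auto simp: C2_class_def intro: lipschitz_grad_of_d2_norm)

lemma C2_class_nonneg:
  assumes "\<phi> \<in> C2_class \<rho> \<Lambda>"
  shows "0 \<le> \<rho>" "0 \<le> \<Lambda>"
  using lipschitz_on_nonneg[OF C2_class_lipschitz_grad[OF assms]]
    lipschitz_on_nonneg[OF C2_class_lipschitz[OF assms]] by auto

lemma C2_class_taylor: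
  assumes "\<phi> \<in> C2_class \<rho> \<Lambda>"
  shows "\<bar>\<phi> y - \<phi> x - grad \<phi> x \<bullet> (y - x)\<bar> \<le> \<rho> * (norm (y - x))\<^sup>2"
  by (rule taylor_lipschitz_gradient[OF _ C2_class_lipschitz_grad[OF assms]])
    (simp_all add: C2_class_gderiv[OF assms])

lemma grad_linear_combination:
  fixes f g :: "'a::euclidean_space \<Rightarrow> real"
  assumes "GDERIV f x :> grad f x" "GDERIV g x :> grad g x"
  shows "grad (\<lambda>x. a * f x + b * g x) x = a *\<^sub>R grad f x + b *\<^sub>R grad g x"
proof (rule grad_eqI)
  have "((\<lambda>x. a * f x + b * g x) has_derivative (\<lambda>h. a * (h \<bullet> grad f x) + b * (h \<bullet> grad g x))) (at x)"
    using assms by (intro has_derivative_add has_derivative_mult_right) (simp_all add: gderiv_def)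
  then show "GDERIV (\<lambda>x. a * f x + b * g x) x :> a *\<^sub>R grad f x + b *\<^sub>R grad g x"
    by (simp add: gderiv_def inner_add_right)
qed

lemma C2_class_convex:
  assumes f: "f \<in> C2_class \<rho> \<Lambda>" and g: "g \<in> C2_class \<rho> \<Lambda>" and ab: "0 \<le> a" "0 \<le> b" "a + b = 1"
  shows "(\<lambda>x. a * f x + b * g x) \<in> C2_class \<rho> \<Lambda>"
  unfolding C2_class_def
proof (intro CollectI conjI allI)
  show "C2_on UNIV (\<lambda>x. a * f x + b * g x)"
    using f g higher_differentiable_on_linear_combination unfolding C2_class_def by blast
  have "(a * \<Lambda> + b * \<Lambda>)-lipschitz_on UNIV (\<lambda>x. a * f x + b * g x)"
    using ab C2_class_lipschitz[OF f] C2_class_lipschitz[OF g]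
    by (intro lipschitz_on_add lipschitz_on_cmult_real_nonneg)
  then show "\<Lambda>-lipschitz_on UNIV (\<lambda>x. a * f x + b * g x)"
    using ab by (simp flip: distrib_right)
  fix x
  have Df: "(grad h has_derivative frechet_derivative (grad h) (at x)) (at x)"
    and on: "onorm (frechet_derivative (grad h) (at x)) \<le> \<rho>" if "h \<in> C2_class \<rho> \<Lambda>" for h :: "'a \<Rightarrow> real"
    using that C2_on_grad_differentiable
    by (auto simp: C2_class_def d2_norm_def simp flip: frechet_derivative_works)
  let ?D = "\<lambda>k. a *\<^sub>R frechet_derivative (grad f) (at x) k + b *\<^sub>R frechet_derivative (grad g) (at x) k"
  have "((\<lambda>x. a *\<^sub>R grad f x + b *\<^sub>R grad g x) has_derivative ?D) (at x)"
    by (intro has_derivative_add has_derivative_scaleR_right Df f g)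
  moreover have "grad (\<lambda>x. a * f x + b * g x) = (\<lambda>x. a *\<^sub>R grad f x + b *\<^sub>R grad g x)"
    using f g by (intro ext grad_linear_combination C2_class_gderiv)
  ultimately have "d2_norm (\<lambda>x. a * f x + b * g x) x = onorm ?D"
    by (simp add: d2_norm_def flip: frechet_derivative_at)
  also have "\<dots> \<le> \<rho>"
  proof (rule onorm_bound[OF C2_class_nonneg(1)[OF f]])
    fix k
    have le: "norm (frechet_derivative (grad h) (at x) k) \<le> \<rho> * norm k" if "h \<in> C2_class \<rho> \<Lambda>" for h :: "'a \<Rightarrow> real"
      using onorm[OF has_derivative_bounded_linear[OF Df[OF that]], of k] on[OF that]
      by (meson mult_right_mono norm_ge_zero order.trans)
    have "norm (?D k) \<le> a * norm (frechet_derivative (grad f) (at x) k) + b * norm (frechet_derivative (grad g) (at x) k)"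
      using ab by (intro order.trans[OF norm_triangle_ineq]) simp
    also have "\<dots> \<le> a * (\<rho> * norm k) + b * (\<rho> * norm k)"
      using ab f g by (intro add_mono mult_left_mono le)
    also have "\<dots> = (a + b) * (\<rho> * norm k)" by (simp add: algebra_simps)
    finally show "norm (?D k) \<le> \<rho> * norm k" using ab by simp
  qed
  finally show "d2_norm (\<lambda>x. a * f x + b * g x) x \<le> \<rho>" .
qed

text \<open>The form in which \<open>evolution_properties\<close> presents the domain of a classical
  solution, with extended real end points.\<close>

lemma strip_eq: "strip s \<tau> = {t. ereal s - \<tau> < ereal t \<and> ereal t < ereal s + \<tau>} \<times> UNIV"
  by (cases \<tau>) (auto simp: strip_def abs_real_def)

lemma open_strip: "open (strip s \<tau> :: (real \<times> 'a::euclidean_space) set)"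
proof -
  have "open {t. ereal \<bar>t - s\<bar> < \<tau>}"
  proof (cases \<tau>)
    case (real r)
    then have "{t. ereal \<bar>t - s\<bar> < \<tau>} = {s - r<..<s + r}" by (auto simp: abs_real_def)
    then show ?thesis by simp
  qed simp_all
  then show ?thesis by (simp add: strip_def open_Times)
qed

lemma Icc_subset_strip:
  assumes "ereal \<sigma> < \<tau>"
  shows "{s..s + \<sigma>} \<times> UNIV \<subseteq> strip s \<tau>"
proof -
  have "ereal \<bar>t - s\<bar> < \<tau>" if "t \<in> {s..s + \<sigma>}" for t
    using that by (intro order.strict_trans1[OF _ assms]) auto
  then show ?thesis
    by (auto simp: strip_def)
qed

locale hamilton_jacobi = hamiltonian H A for H :: "('a::euclidean_space) hamiltonian" and A :: real +
  fixes Q :: "real \<Rightarrow> ennreal \<Rightarrow> ennreal" and G V :: "'a evolution"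
  assumes growth: "hessian_growth H A Q"
    and G: "variational_resolution H A G"
    and V: "viscosity_resolution H A V"
begin

section \<open>Lifespans and general properties of the evolutions\<close>

lemma Q_mono_time: "0 \<le> s \<Longrightarrow> s \<le> t \<Longrightarrow> Q s r \<le> Q t r"
  using growth by (simp add: hessian_growth_def)

lemma Q_semigroup: "0 \<le> s \<Longrightarrow> 0 \<le> t \<Longrightarrow> Q (t + s) r = Q t (Q s r)"
  using growth by (simp add: hessian_growth_def)

lemma Q_zero: "Q 0 r = r"
  using growth by (simp add: hessian_growth_def)

lemma lifespan_pos: "r < \<infinity> \<Longrightarrow> 0 < lifespan Q r"
  using growth by (simp add: hessian_growth_def)

lemma Q_finite:
  assumes "0 \<le> t" "ereal t < lifespan Q r"
  shows "Q t r < \<infinity>"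
proof -
  obtain t' where "ereal t < ereal t'" "0 \<le> t'" "Q t' r < \<infinity>"
    using assms(2) unfolding lifespan_def less_Sup_iff by auto
  then show ?thesis
    using Q_mono_time[of t t' r] assms(1) by (simp add: order.strict_trans1)
qed

lemma lifespan_shift:
  assumes "0 \<le> s" "0 \<le> t" "ereal (s + t) < lifespan Q r"
  shows "ereal t < lifespan Q (Q s r)"
proof -
  obtain t' where t': "ereal (s + t) < ereal t'" "0 \<le> t'" "Q t' r < \<infinity>"
    using assms(3) unfolding lifespan_def less_Sup_iff by auto
  then have "t' - s > t" by simp
  moreover have "Q (t' - s) (Q s r) < \<infinity>"
    using Q_semigroup[of s "t' - s" r] t' assms by simp
  ultimately show ?thesis
    using assms(2) unfolding lifespan_def less_Sup_iff by (intro bexI[of _ "ereal (t' - s)"]) auto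
qed

lemma evolution_GV: "evolution_properties H A G" "evolution_properties H A V"
  using G V by (simp_all add: variational_resolution_def viscosity_resolution_def)

lemma evolution_lipschitz:
  assumes R: "evolution_properties H A R" and u: "\<Lambda>-lipschitz_on UNIV u" and st: "s \<le> t"
  shows "((\<Lambda> + 1) * exp (A * (t - s)) - 1)-lipschitz_on UNIV (R s t u)"
proof -
  have l: "is_lipschitz u" using u by (rule is_lipschitzI)
  have lR: "is_lipschitz (R s t u)"
    using R l st by (auto simp: evolution_properties_def)
  have "Lip (R s t u) \<le> (Lip u + 1) * exp (A * (t - s)) - 1"
    using R l st by (auto simp: evolution_properties_def)
  also have "\<dots> \<le> (\<Lambda> + 1) * exp (A * (t - s)) - 1"
    using Lip_le[OF u] by simp
  finally show ?thesis
    by (rule lipschitz_on_mono[OF lipschitz_on_Lip[OF lR] order.refl])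
qed

lemma evolution_close:
  assumes R: "evolution_properties H A R" and u: "\<Lambda>-lipschitz_on UNIV u" and st: "s \<le> t"
  shows "\<bar>R s t u x - u x\<bar> \<le> A * (t - s) * ((\<Lambda> + 1) * exp (A * (t - s)))\<^sup>2"
proof -
  have l: "is_lipschitz u" using u by (rule is_lipschitzI)
  have "\<bar>R s t u x - u x\<bar> \<le> A * (t - s) * ((Lip u + 1) * exp (A * (t - s)))\<^sup>2"
    using R l st by (auto simp: evolution_properties_def)
  also have "\<dots> \<le> A * (t - s) * ((\<Lambda> + 1) * exp (A * (t - s)))\<^sup>2"
    using A_nonneg st Lip_le[OF u] lipschitz_on_nonneg[OF lipschitz_on_Lip[OF l]]
    by (intro mult_left_mono power_mono mult_right_mono) simp_all
  finally show ?thesis .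
qed

lemma evolution_refl:
  assumes "evolution_properties H A R" "\<Lambda>-lipschitz_on UNIV u"
  shows "R s s u = u"
  using evolution_close[OF assms, of s s] by auto

lemma evolution_mono:
  assumes "evolution_properties H A R" "\<Lambda>-lipschitz_on UNIV u" "\<Lambda>'-lipschitz_on UNIV w"
    and "\<And>x. u x \<le> w x" "s \<le> t"
  shows "R s t u x \<le> R s t w x"
  using assms(1)[unfolded evolution_properties_def, THEN conjunct2, THEN conjunct1,
      THEN spec[of _ s], THEN spec[of _ t], THEN spec[of _ u], THEN spec[of _ w]]
    is_lipschitzI[OF assms(2)] is_lipschitzI[OF assms(3)] assms(4,5)
  by simp

text \<open>What is needed later of a classical solution issued from \<open>\<phi>\<close>: bounds
  that are uniform up to both end times, and agreement with every evolution, so that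
  \<open>G\<close> and \<open>V\<close> may be exchanged along it.\<close>

definition regular_flow :: "real \<Rightarrow> real \<Rightarrow> real \<Rightarrow> real \<Rightarrow> ('a \<Rightarrow> real) \<Rightarrow> (real \<times> 'a \<Rightarrow> real) \<Rightarrow> bool" where
  "regular_flow s t \<Lambda> K \<phi> f \<longleftrightarrow>
     (\<forall>x. f (s, x) = \<phi> x) \<and>
     (\<exists>\<Omega>. open \<Omega> \<and> {s..t} \<times> UNIV \<subseteq> \<Omega> \<and> classical_solution_on H \<Omega> f) \<and>
     (\<forall>z\<in>{s..t} \<times> UNIV. norm (snd (grad f z)) \<le> \<Lambda> \<and>
        (\<forall>k. norm (frechet_derivative (grad f) (at z) k) \<le> K * norm k)) \<and>
     (\<forall>R. evolution_properties H A R \<longrightarrow> (\<forall>r\<in>{s..t}. \<forall>x. R s r \<phi> x = f (r, x)))"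

lemma classical_evolution:
  assumes R: "evolution_properties H A R"
    and f: "classical_solution_on H (strip s \<tau>) f" "\<And>x. f (s, x) = \<phi> x"
    and l: "\<Lambda>-lipschitz_on UNIV \<phi>" and t: "s \<le> t" "ereal (t - s) < \<tau>"
  shows "R s t \<phi> x = f (t, x)"
proof -
  have \<phi>: "\<phi> = (\<lambda>y. f (s, y))" using f(2) by auto
  have "(t, x) \<in> strip s \<tau>" "(s, x) \<in> strip s \<tau>"
    using t by (auto simp: strip_def intro: order.strict_trans1[of _ "ereal (t - s)"])
  then have "ereal s - \<tau> < ereal s" "ereal t < ereal s + \<tau>"
    by (auto simp: strip_eq)
  moreover have "is_lipschitz (\<lambda>y. f (s, y))"
    using l \<phi> is_lipschitzI by metis
  ultimately show ?thesis
    using R[unfolded evolution_properties_def, THEN conjunct2, THEN conjunct2,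
        THEN spec[of _ "ereal s - \<tau>"], THEN spec[of _ "ereal s + \<tau>"], THEN spec[of _ f],
        THEN spec[of _ s], THEN spec[of _ t]] f(1) t(1)
    unfolding strip_eq \<phi> by simp
qed

text \<open>The bounds \<open>\<rho>'\<close> and \<open>\<Lambda>'\<close> are left free, so that
  one pair of constants can serve all starting times. The growth function bounds the spatial Hessian
  only; \<open>classical_hessian_bound\<close> passes to all of \<open>(t, x)\<close>.\<close>

lemma regular_flow_exists:
  assumes \<phi>: "\<phi> \<in> C2_class \<rho> \<Lambda>" and t: "s \<le> t" "ereal (t - s) < lifespan Q (ennreal \<rho>)"
    and \<rho>': "Q (t - s) (ennreal \<rho>) \<le> ennreal \<rho>'" "0 \<le> \<rho>'"
    and \<Lambda>': "(\<Lambda> + 1) * exp (A * (t - s)) - 1 \<le> \<Lambda>'"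
  obtains f where "regular_flow s t \<Lambda>' (hess_bound \<Lambda>' \<rho>') \<phi> f"
    and "\<And>r. r \<in> {s..t} \<Longrightarrow> (\<lambda>x. f (r, x)) \<in>
        C2_class (enn2real (Q (r - s) (ennreal \<rho>))) ((\<Lambda> + 1) * exp (A * (r - s)) - 1)"
proof -
  let ?L = "lifespan Q (ennreal \<rho>)"
  note \<rho> = C2_class_nonneg(1)[OF \<phi>] and \<Lambda> = C2_class_nonneg(2)[OF \<phi>]
  have C: "C2_on UNIV \<phi>" "\<forall>x. d2_norm \<phi> x \<le> \<rho>" "\<Lambda>-lipschitz_on UNIV \<phi>"
    using \<phi> by (auto simp: C2_class_def)
  note sol = growth[unfolded hessian_growth_def, THEN conjunct2, THEN conjunct2, THEN conjunct2,
      THEN conjunct2, THEN conjunct2, THEN conjunct1, THEN spec[of _ s], THEN spec[of _ \<rho>],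
      THEN spec[of _ \<phi>], THEN mp, OF conjI[OF \<rho> conjI[OF C(1,2)]]]
  from conjunct1[OF sol] obtain f
    where f: "classical_solution_on H (strip s ?L) f" "\<forall>x. f (s, x) = \<phi> x"
    by (elim exE conjE)
  note d2 = sol[THEN conjunct2, THEN conjunct2, THEN spec[of _ f], THEN mp, OF conjI[OF f]]
  have sub: "{s..t} \<times> UNIV \<subseteq> strip s ?L"
    using Icc_subset_strip[OF t(2), of s] by simp
  have ev: "R s r \<phi> x = f (r, x)" if "evolution_properties H A R" "r \<in> {s..t}" for R r x
    using that t(2)
    by (intro classical_evolution[OF that(1) f(1) f(2)[rule_format] C(3)])
      (auto intro: order.strict_trans1[of _ "ereal (t - s)"])
  have slice: "(\<lambda>x. f (r, x)) \<in> C2_class (enn2real (Q (r - s) (ennreal \<rho>))) ((\<Lambda> + 1) * exp (A * (r - s)) - 1)"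
    if r: "r \<in> {s..t}" for r
    unfolding C2_class_def
  proof (intro CollectI conjI allI)
    show C2: "C2_on UNIV (\<lambda>x. f (r, x))"
      using f(1) sub r open_strip
      by (intro higher_differentiable_on_slice[of "strip s ?L"]) (auto simp: classical_solution_on_def)
    show "((\<Lambda> + 1) * exp (A * (r - s)) - 1)-lipschitz_on UNIV (\<lambda>x. f (r, x))"
      using evolution_lipschitz[OF evolution_GV(2) C(3), of s r] ev[OF evolution_GV(2) r] r
      by (simp cong: lipschitz_on_cong)
    fix x :: 'a
    have "ereal (r - s) < ?L" using r t(2) by (auto intro: order.strict_trans1[of _ "ereal (t - s)"])
    then have fin: "Q (r - s) (ennreal \<rho>) < \<infinity>" using r by (intro Q_finite) auto
    have "(r, x) \<in> strip s ?L" using r sub by auto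
    from d2[rule_format, OF this] r
    have "ennreal (d2_norm (\<lambda>y. f (r, y)) x) \<le> Q (r - s) (ennreal \<rho>)"
      by simp
    from enn2real_mono[OF this] fin show "d2_norm (\<lambda>y. f (r, y)) x \<le> enn2real (Q (r - s) (ennreal \<rho>))"
      using d2_norm_nonneg[OF C2] by simp
  qed
  have "norm (snd (grad f z)) \<le> \<Lambda>' \<and>
      (\<forall>k. norm (frechet_derivative (grad f) (at z) k) \<le> hess_bound \<Lambda>' \<rho>' * norm k)"
    if z: "z \<in> {s..t} \<times> UNIV" for z
  proof -
    obtain r x where rx: "z = (r, x)" "r \<in> {s..t}" using z by auto
    have inS: "(r, y) \<in> strip s ?L" for y using sub rx by auto
    define D where "D = frechet_derivative (grad f) (at z)"
    have D: "(grad f has_derivative D) (at z)"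
      unfolding D_def using inS rx open_strip by (intro classical_grad_has_derivative[OF f(1)]) auto
    have gslice: "grad (\<lambda>y. f (r, y)) y = snd (grad f (r, y))" for y
    proof (rule grad_eqI)
      have "((\<lambda>y. (r, y)) has_derivative (\<lambda>h. (0, h))) (at y)"
        by (intro has_derivative_Pair has_derivative_const has_derivative_ident)
      from has_derivative_compose[OF this classical_gderiv[OF f(1) inS, unfolded gderiv_def]]
      show "GDERIV (\<lambda>y. f (r, y)) y :> snd (grad f (r, y))"
        by (cases "grad f (r, y)") (simp add: gderiv_def)
    qed
    have 1: "norm (snd (grad f z)) \<le> \<Lambda>'"
    proof -
      have "(\<Lambda> + 1) * exp (A * (r - s)) - 1 \<le> (\<Lambda> + 1) * exp (A * (t - s)) - 1"
        using rx A_nonneg \<Lambda> by (simp add: mult_left_mono)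
      then show ?thesis
        using C2_class_norm_grad[OF slice[OF rx(2)], of x] gslice \<Lambda>' rx by simp
    qed
    have "((\<lambda>y. (r, y)) has_derivative (\<lambda>h. (0, h))) (at x)"
      by (intro has_derivative_Pair has_derivative_const has_derivative_ident)
    from has_derivative_snd[OF has_derivative_compose[OF this D[unfolded rx]]]
    have D0: "((\<lambda>y. snd (grad f (r, y))) has_derivative (\<lambda>h. snd (D (0, h)))) (at x)" .
    have "norm (snd (D (0, y))) \<le> \<rho>' * norm y" for y
    proof -
      have "onorm (\<lambda>h. snd (D (0, h))) = d2_norm (\<lambda>y. f (r, y)) x"
        using D0 by (simp add: d2_norm_def gslice[abs_def] flip: frechet_derivative_at)
      also have "\<dots> \<le> enn2real (Q (r - s) (ennreal \<rho>))"
        using slice[OF rx(2)] by (simp add: C2_class_def)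
      also have "\<dots> \<le> \<rho>'"
      proof (rule enn2real_leI[OF \<rho>'(2)])
        show "Q (r - s) (ennreal \<rho>) \<le> ennreal \<rho>'"
          using rx by (intro order.trans[OF Q_mono_time \<rho>'(1)]) auto
      qed
      finally show ?thesis
        using onorm[OF has_derivative_bounded_linear[OF D0], of y]
        by (meson mult_right_mono norm_ge_zero order.trans)
    qed
    then have "norm (D k) \<le> hess_bound \<Lambda>' \<rho>' * norm k" for k
      using inS rx open_strip by (intro classical_hessian_bound[OF f(1) _ _ D 1 _ \<rho>'(2)]) auto
    then show ?thesis using 1 by (simp add: D_def)
  qed
  then have "regular_flow s t \<Lambda>' (hess_bound \<Lambda>' \<rho>') \<phi> f"
    unfolding regular_flow_def
    by (intro conjI allI impI ballI exI[of _ "strip s ?L"] f f(2)[rule_format] sub ev open_strip) auto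
  from that[OF this slice] show ?thesis .
qed

end

section \<open>Variational solutions and infima of classical solutions\<close>

text \<open>The epsilon form of a finite infimum: it comes without side conditions on boundedness
  and contains that \<open>S\<close> is not empty.\<close>

definition is_pointwise_inf :: "('a \<Rightarrow> real) set \<Rightarrow> ('a \<Rightarrow> real) \<Rightarrow> bool" where
  "is_pointwise_inf S u \<longleftrightarrow> (\<forall>f\<in>S. \<forall>x. u x \<le> f x) \<and> (\<forall>x. \<forall>e>0. \<exists>f\<in>S. f x \<le> u x + e)"

definition convex_family :: "('a \<Rightarrow> real) set \<Rightarrow> bool" where
  "convex_family S \<longleftrightarrow> (\<forall>f\<in>S. \<forall>g\<in>S. \<forall>a\<ge>0. \<forall>b\<ge>0. a + b = 1 \<longrightarrow> (\<lambda>x. a * f x + b * g x) \<in> S)"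

lemma is_pointwise_inf_le: "is_pointwise_inf S u \<Longrightarrow> f \<in> S \<Longrightarrow> u x \<le> f x"
  by (simp add: is_pointwise_inf_def)

lemma is_pointwise_inf_near:
  assumes "is_pointwise_inf S u" "0 < e"
  obtains f where "f \<in> S" "f x \<le> u x + e"
  using assms unfolding is_pointwise_inf_def by blast

lemma is_pointwise_inf_lipschitz:
  fixes u :: "'a::metric_space \<Rightarrow> real"
  assumes inf: "is_pointwise_inf S u" and S: "\<And>f. f \<in> S \<Longrightarrow> \<Lambda>-lipschitz_on UNIV f"
  shows "\<Lambda>-lipschitz_on UNIV u"
proof -
  have le: "u x \<le> u y + \<Lambda> * dist x y" for x y
  proof (rule field_le_epsilon)
    fix e :: real assume "e > 0"
    then obtain f where f: "f \<in> S" "f y \<le> u y + e"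
      by (rule is_pointwise_inf_near[OF inf])
    have "u x \<le> f x" using inf f(1) by (rule is_pointwise_inf_le)
    also have "f x \<le> f y + \<Lambda> * dist x y"
      using lipschitz_onD[OF S[OF f(1)], of x y] by (simp add: dist_real_def abs_le_iff)
    finally show "u x \<le> u y + \<Lambda> * dist x y + e" using f by simp
  qed
  obtain f where "f \<in> S"
    by (rule is_pointwise_inf_near[OF inf zero_less_one])
  then have "0 \<le> \<Lambda>" using S lipschitz_on_nonneg by blast
  then show ?thesis
  proof (intro lipschitz_onI)
    show "dist (u x) (u y) \<le> \<Lambda> * dist x y" for x y
      using le[of x y] le[of y x] by (simp add: dist_real_def abs_le_iff dist_commute)
  qed
qed

text \<open>If \<open>w = grad \<phi> y - p\<close> were large, a step of length \<open>r\<close>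
  against \<open>w\<close> would lower \<open>\<phi> - u\<close> by \<open>r * norm w\<close> up to
  small errors, and \<open>\<phi>\<close> would fall below \<open>u\<close>. The Hessian bound
  \<open>\<rho>\<close> makes the admissible gap \<open>\<eta>\<close> independent of
  \<open>\<phi>\<close>; \<open>r\<close> is chosen so that the gap and both expansion errors are at
  most \<open>e * r / 4\<close> each.\<close>

lemma gradient_of_almost_touching:
  fixes u :: "'a::euclidean_space \<Rightarrow> real"
  assumes u: "GDERIV u y :> p" and e: "0 < e" and \<rho>: "0 \<le> \<rho>"
  obtains \<eta> where "0 < \<eta>"
    and "\<And>\<phi> \<Lambda>. \<lbrakk>\<phi> \<in> C2_class \<rho> \<Lambda>; \<And>x. u x \<le> \<phi> x; \<phi> y \<le> u y + \<eta>\<rbrakk> \<Longrightarrow> norm (grad \<phi> y - p) \<le> e"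
proof -
  obtain d where d: "d > 0"
    "\<And>x. norm (x - y) < d \<Longrightarrow> norm (u x - u y - (x - y) \<bullet> p) \<le> e / 4 * norm (x - y)"
    using u e unfolding gderiv_def has_derivative_at_alt by (metis zero_less_divide_iff zero_less_numeral)
  define r where "r = min (d / 2) (e / (4 * (\<rho> + 1)))"
  have r: "0 < r" "r < d" using d e \<rho> by (auto simp: r_def)
  have \<rho>r: "\<rho> * r \<le> e / 4"
  proof -
    have "\<rho> * r \<le> (\<rho> + 1) * (e / (4 * (\<rho> + 1)))"
      using r \<rho> by (intro mult_mono) (auto simp: r_def)
    also have "\<dots> = e / 4" using \<rho> by (simp add: field_simps)
    finally show ?thesis .
  qed
  show ?thesis
  proof (rule that[of "e * r / 4"])
    show "0 < e * r / 4" using e r by simp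
    fix \<phi> \<Lambda> assume \<phi>: "\<phi> \<in> C2_class \<rho> \<Lambda>" and ge: "\<And>x. u x \<le> \<phi> x" and near: "\<phi> y \<le> u y + e * r / 4"
    define w where "w = grad \<phi> y - p"
    show "norm (grad \<phi> y - p) \<le> e"
    proof (rule ccontr)
      assume "\<not> norm (grad \<phi> y - p) \<le> e"
      then have w: "norm w > e" by (simp add: w_def)
      define h where "h = - (r / norm w) *\<^sub>R w"
      have nh: "norm h = r" using w e r by (auto simp: h_def)
      have wh: "w \<bullet> h = - (r * norm w)"
        using w e by (auto simp: h_def dot_square_norm power2_eq_square)
      have 1: "\<phi> (y + h) \<le> \<phi> y + grad \<phi> y \<bullet> h + \<rho> * r\<^sup>2"
        using C2_class_taylor[OF \<phi>, of "y + h" y] by (simp add: nh abs_le_iff)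
      have 2: "u y + h \<bullet> p - e / 4 * r \<le> u (y + h)"
      proof -
        have "\<bar>u (y + h) - u y - h \<bullet> p\<bar> \<le> e / 4 * r"
          using d(2)[of "y + h"] nh r by simp
        then show ?thesis by linarith
      qed
      have 3: "grad \<phi> y \<bullet> h = h \<bullet> p - r * norm w"
        using wh by (simp add: w_def inner_diff_left inner_commute[of h])
      have "r * norm w \<le> e * r / 4 + \<rho> * r\<^sup>2 + e / 4 * r"
        using 1 2 ge[of "y + h"] near unfolding 3 by linarith
      also have "\<dots> = r * (e / 4 + \<rho> * r + e / 4)"
        by (simp add: power2_eq_square algebra_simps)
      finally have "norm w \<le> e / 4 + \<rho> * r + e / 4" using r by simp
      with \<rho>r w e show False by simp
    qed
  qed
qed

text \<open>The set \<open>\<Gamma>\<close> of vectors that satisfy the conclusion contains all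
  limits of gradients of \<open>u\<close>, and it is convex because \<open>S\<close> is: value and
  gradient of a combination are the combined values and gradients. Hence it contains the convex
  hull.\<close>

lemma clarke_differential_touching:
  fixes u :: "'a::euclidean_space \<Rightarrow> real"
  assumes inf: "is_pointwise_inf S u" and conv: "convex_family S" and S: "S \<subseteq> C2_class \<rho> \<Lambda>"
    and l: "l \<in> clarke_differential u x" and e: "0 < e"
  shows "\<exists>\<phi>\<in>S. \<phi> x \<le> u x + e \<and> norm (grad \<phi> x - l) \<le> e"
proof -
  define \<Gamma> where "\<Gamma> = {l. \<exists>\<phi>\<in>S. \<phi> x \<le> u x + e \<and> norm (grad \<phi> x - l) \<le> e}"
  have uL: "\<Lambda>-lipschitz_on UNIV u"
    using S by (intro is_pointwise_inf_lipschitz[OF inf] C2_class_lipschitz) auto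
  have "convex \<Gamma>"
  proof (rule convexI)
    fix l1 l2 and a b :: real
    assume "l1 \<in> \<Gamma>" "l2 \<in> \<Gamma>" and ab: "0 \<le> a" "0 \<le> b" "a + b = 1"
    then obtain f g where f: "f \<in> S" "f x \<le> u x + e" "norm (grad f x - l1) \<le> e"
      and g: "g \<in> S" "g x \<le> u x + e" "norm (grad g x - l2) \<le> e"
      by (auto simp: \<Gamma>_def)
    let ?h = "\<lambda>x. a * f x + b * g x"
    have "?h \<in> S" using conv f g ab by (auto simp: convex_family_def)
    moreover have "?h x \<le> u x + e"
    proof -
      have "?h x \<le> a * (u x + e) + b * (u x + e)"
        using ab f g by (intro add_mono mult_left_mono)
      also have "\<dots> = (a + b) * (u x + e)" by (simp add: algebra_simps)
      finally show ?thesis using ab by simp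
    qed
    moreover have "norm (grad ?h x - (a *\<^sub>R l1 + b *\<^sub>R l2)) \<le> e"
    proof -
      have "grad ?h x = a *\<^sub>R grad f x + b *\<^sub>R grad g x"
        using f g S by (intro grad_linear_combination C2_class_gderiv) auto
      then have "grad ?h x - (a *\<^sub>R l1 + b *\<^sub>R l2) = a *\<^sub>R (grad f x - l1) + b *\<^sub>R (grad g x - l2)"
        by (simp add: algebra_simps)
      also have "norm \<dots> \<le> a * norm (grad f x - l1) + b * norm (grad g x - l2)"
        using ab by (intro order.trans[OF norm_triangle_ineq]) simp
      also have "\<dots> \<le> a * e + b * e"
        using ab f g by (intro add_mono mult_left_mono)
      also have "\<dots> = (a + b) * e" by (simp add: algebra_simps)
      finally show ?thesis using ab by simp
    qed
    ultimately show "a *\<^sub>R l1 + b *\<^sub>R l2 \<in> \<Gamma>"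
      unfolding \<Gamma>_def by (intro CollectI bexI[of _ ?h] conjI)
  qed
  moreover have "l \<in> \<Gamma>" if X: "X \<longlonglongrightarrow> x" "\<And>n. u differentiable (at (X n))" "(\<lambda>n. grad u (X n)) \<longlonglongrightarrow> l"
    for X :: "nat \<Rightarrow> 'a" and l
  proof -
    obtain f where "f \<in> S" by (rule is_pointwise_inf_near[OF inf zero_less_one])
    then have nn: "0 \<le> \<rho>" "0 \<le> \<Lambda>" using C2_class_nonneg S by blast+
    \<comment> \<open>Over a distance \<open>d\<close> the gradient of \<open>\<phi>\<close> and the
      values of \<open>\<phi>\<close> and \<open>u\<close> each change by at most
      \<open>e / 4\<close>, so that a function almost touching at a nearby point of
      differentiability also serves at \<open>x\<close>.\<close>
    define d where "d = e / (4 * (\<rho> + \<Lambda> + 1))"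
    have d: "0 < d" "\<rho> * d \<le> e / 4" "\<Lambda> * d \<le> e / 4"
      using e nn by (auto simp: d_def field_simps mult_left_mono intro!: mult_nonneg_nonneg)
    have "\<forall>\<^sub>F n in sequentially. dist (X n) x < d" "\<forall>\<^sub>F n in sequentially. dist (grad u (X n)) l < e / 4"
      using tendstoD[OF X(1) d(1)] tendstoD[OF X(3), of "e / 4"] e by simp_all
    then have "\<forall>\<^sub>F n in sequentially. dist (X n) x < d \<and> dist (grad u (X n)) l < e / 4"
      by (rule eventually_conj)
    then obtain n where n: "dist (X n) x < d" "dist (grad u (X n)) l < e / 4"
      by (auto simp: eventually_sequentially)
    define y where "y = X n"
    obtain \<eta> where \<eta>: "0 < \<eta>"
      "\<And>\<phi> \<Lambda>. \<lbrakk>\<phi> \<in> C2_class \<rho> \<Lambda>; \<And>x. u x \<le> \<phi> x; \<phi> y \<le> u y + \<eta>\<rbrakk> \<Longrightarrow> norm (grad \<phi> y - grad u y) \<le> e / 4"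
      using gradient_of_almost_touching[OF gderiv_grad[OF X(2)[of n]], of "e / 4" \<rho>] e nn(1)
      unfolding y_def by (metis zero_less_divide_iff zero_less_numeral)
    have "0 < min \<eta> (e / 2)" using \<eta>(1) e by simp
    then obtain \<phi> where \<phi>: "\<phi> \<in> S" "\<phi> y \<le> u y + min \<eta> (e / 2)"
      by (rule is_pointwise_inf_near[OF inf])
    have \<phi>C: "\<phi> \<in> C2_class \<rho> \<Lambda>" using \<phi> S by auto
    have "norm (grad \<phi> y - grad u y) \<le> e / 4"
      using \<phi> is_pointwise_inf_le[OF inf \<phi>(1)] by (intro \<eta>(2)[OF \<phi>C]) simp_all
    moreover have "norm (grad \<phi> x - grad \<phi> y) \<le> \<rho> * d"
      using lipschitz_onD[OF C2_class_lipschitz_grad[OF \<phi>C], of x y] n(1) nn(1)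
      by (simp add: dist_norm y_def norm_minus_commute)
        (meson less_imp_le mult_left_mono order.trans)
    moreover have "norm (grad u y - l) < e / 4" using n(2) by (simp add: dist_norm y_def)
    moreover have "grad \<phi> x - l = (grad \<phi> x - grad \<phi> y) + (grad \<phi> y - grad u y) + (grad u y - l)"
      by simp
    then have "norm (grad \<phi> x - l) \<le> norm (grad \<phi> x - grad \<phi> y) + norm (grad \<phi> y - grad u y) + norm (grad u y - l)"
      by (simp only:) (intro norm_triangle_le add_mono order.refl norm_triangle_ineq)
    ultimately have 1: "norm (grad \<phi> x - l) \<le> e" using d(2) e by linarith
    have close: "\<bar>w y - w x\<bar> \<le> e / 4" if "\<Lambda>-lipschitz_on UNIV w" for w :: "'a \<Rightarrow> real"
    proof -
      have "\<bar>w y - w x\<bar> \<le> \<Lambda> * dist y x"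
        using lipschitz_onD[OF that, of y x] by (simp add: dist_real_def)
      also have "\<dots> \<le> \<Lambda> * d" using n(1) nn by (intro mult_left_mono) (auto simp: y_def)
      finally show ?thesis using d by simp
    qed
    have "\<phi> x \<le> u x + e"
      using close[OF uL] close[OF C2_class_lipschitz[OF \<phi>C]] \<phi>(2) min.cobounded2[of \<eta> "e / 2"]
      by linarith
    with 1 \<phi>(1) show ?thesis by (auto simp: \<Gamma>_def)
  qed
  then have "{l. \<exists>X. X \<longlonglongrightarrow> x \<and> (\<forall>n::nat. u differentiable (at (X n))) \<and> (\<lambda>n. grad u (X n)) \<longlonglongrightarrow> l} \<subseteq> \<Gamma>"
    by blast
  ultimately have "clarke_differential u x \<subseteq> \<Gamma>"
    unfolding clarke_differential_def by (intro hull_minimal)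
  then show ?thesis using l by (auto simp: \<Gamma>_def)
qed

context hamilton_jacobi
begin

section \<open>Expansions along a regular flow\<close>

lemma regular_flow_classical:
  assumes "regular_flow s t \<Lambda> K \<phi> f"
  obtains \<Omega> where "open \<Omega>" "{s..t} \<times> UNIV \<subseteq> \<Omega>" "classical_solution_on H \<Omega> f"
  using assms by (auto simp: regular_flow_def)

lemma regular_flow_initial: "regular_flow s t \<Lambda> K \<phi> f \<Longrightarrow> f (s, x) = \<phi> x"
  by (simp add: regular_flow_def)

lemma regular_flow_hessian:
  "regular_flow s t \<Lambda> K \<phi> f \<Longrightarrow> z \<in> {s..t} \<times> UNIV \<Longrightarrow>
    norm (frechet_derivative (grad f) (at z) k) \<le> K * norm k"
  unfolding regular_flow_def by blast

lemma regular_flow_gderiv: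
  assumes "regular_flow s t \<Lambda> K \<phi> f" "z \<in> {s..t} \<times> UNIV"
  shows "GDERIV f z :> grad f z"
  using assms classical_gderiv regular_flow_classical by (metis subsetD)

lemma regular_flow_evolution:
  assumes "regular_flow s t \<Lambda> K \<phi> f" "evolution_properties H A R" "r \<in> {s..t}"
  shows "R s r \<phi> x = f (r, x)"
  using assms by (auto simp: regular_flow_def)

lemma regular_flow_lipschitz_grad:
  assumes f: "regular_flow s t \<Lambda> K \<phi> f" and K: "0 \<le> K"
  shows "K-lipschitz_on ({s..t} \<times> UNIV) (grad f)"
proof (rule lipschitz_of_derivative_bound[OF _ _ _ K])
  show "convex ({s..t} \<times> UNIV :: (real \<times> 'a) set)"
    by (intro convex_Times convex_UNIV) simp
  fix z :: "real \<times> 'a" assume z: "z \<in> {s..t} \<times> UNIV"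
  obtain \<Omega> where \<Omega>: "open \<Omega>" "{s..t} \<times> UNIV \<subseteq> \<Omega>" "classical_solution_on H \<Omega> f"
    using f by (rule regular_flow_classical)
  show "(grad f has_derivative frechet_derivative (grad f) (at z)) (at z)"
    using z \<Omega>(2) by (intro classical_grad_has_derivative[OF \<Omega>(3,1)]) blast
  show "norm (frechet_derivative (grad f) (at z) k) \<le> K * norm k" for k
    by (rule regular_flow_hessian[OF f z])
qed

lemma regular_flow_taylor:
  assumes f: "regular_flow s t \<Lambda> K \<phi> f" and K: "0 \<le> K"
    and z: "z \<in> {s..t} \<times> UNIV" "z' \<in> {s..t} \<times> UNIV"
  shows "\<bar>f z' - f z - grad f z \<bullet> (z' - z)\<bar> \<le> K * (norm (z' - z))\<^sup>2"
  by (rule taylor_lipschitz_gradient[OF regular_flow_gderiv[OF f]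
        regular_flow_lipschitz_grad[OF f K] _ z])
    (auto intro: convex_Times)

text \<open>Expand at the barycentre; the linear terms cancel in the weighted sum.\<close>

lemma regular_flow_semiconcave:
  assumes f: "regular_flow s t \<Lambda> K \<phi> f" and K: "0 \<le> K"
    and z: "z1 \<in> {s..t} \<times> UNIV" "z2 \<in> {s..t} \<times> UNIV"
    and ab: "0 \<le> a" "0 \<le> b" "a + b = 1"
  shows "a * f z1 + b * f z2 \<le> f (a *\<^sub>R z1 + b *\<^sub>R z2) + K * (a * b) * (norm (z1 - z2))\<^sup>2"
proof -
  define z where "z = a *\<^sub>R z1 + b *\<^sub>R z2"
  have "convex ({s..t} \<times> UNIV :: (real \<times> 'a) set)"
    by (intro convex_Times convex_UNIV) simp
  then have zS: "z \<in> {s..t} \<times> UNIV"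
    unfolding z_def using z ab by (rule convexD)
  have d1: "z1 - z = b *\<^sub>R (z1 - z2)"
  proof -
    have "z1 - z = (1 - a) *\<^sub>R z1 - b *\<^sub>R z2" by (simp add: z_def algebra_simps)
    also have "1 - a = b" using ab by simp
    finally show ?thesis by (simp add: algebra_simps)
  qed
  have d2: "z2 - z = - a *\<^sub>R (z1 - z2)"
  proof -
    have "z2 - z = (1 - b) *\<^sub>R z2 - a *\<^sub>R z1" by (simp add: z_def algebra_simps)
    also have "1 - b = a" using ab by simp
    finally show ?thesis by (simp add: algebra_simps)
  qed
  define c where "c = grad f z \<bullet> (z1 - z2)"
  define N where "N = (norm (z1 - z2))\<^sup>2"
  have 1: "f z1 \<le> f z + b * c + K * (b\<^sup>2 * N)"
    using regular_flow_taylor[OF f K zS z(1)] unfolding d1 N_def c_def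
    by (simp add: power_mult_distrib abs_le_iff)
  have 2: "f z2 \<le> f z - a * c + K * (a\<^sup>2 * N)"
    using regular_flow_taylor[OF f K zS z(2)] unfolding d2 N_def c_def
    by (simp add: power_mult_distrib abs_le_iff)
  have "a * f z1 + b * f z2 \<le> a * (f z + b * c + K * (b\<^sup>2 * N)) + b * (f z - a * c + K * (a\<^sup>2 * N))"
    by (intro add_mono mult_left_mono 1 2 ab)
  also have "\<dots> = (a + b) * f z + K * (a * b) * ((a + b) * N)"
    by (simp add: algebra_simps power2_eq_square)
  finally show ?thesis using ab by (simp add: z_def N_def)
qed

lemma regular_flow_grad_initial:
  assumes f: "regular_flow s t \<Lambda> K \<phi> f" and st: "s \<le> t"
  shows "grad f (s, x) = (- H (s, x, grad \<phi> x), grad \<phi> x)"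
proof -
  obtain \<Omega> where \<Omega>: "open \<Omega>" "{s..t} \<times> UNIV \<subseteq> \<Omega>" "classical_solution_on H \<Omega> f"
    using f by (rule regular_flow_classical)
  have in\<Omega>: "(s, x) \<in> \<Omega>" using \<Omega>(2) st by auto
  have "grad \<phi> x = snd (grad f (s, x))"
  proof (rule grad_eqI)
    have "((\<lambda>y. (s, y)) has_derivative (\<lambda>h. (0, h))) (at x)"
      by (intro has_derivative_Pair has_derivative_const has_derivative_ident)
    from has_derivative_compose[OF this classical_gderiv[OF \<Omega>(3) in\<Omega>, unfolded gderiv_def]]
    show "GDERIV \<phi> x :> snd (grad f (s, x))"
      by (cases "grad f (s, x)") (simp add: gderiv_def regular_flow_initial[OF f])
  qed
  then show ?thesis
    using classical_HJ[OF \<Omega>(3) in\<Omega>] by (simp add: prod_eq_iff)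
qed

lemma regular_flow_expansion:
  assumes f: "regular_flow s t \<Lambda> K \<phi> f" and K: "0 \<le> K" and r: "r \<in> {s..t}"
  shows "\<bar>f (r, x) - (\<phi> x - (r - s) * H (s, x, grad \<phi> x))\<bar> \<le> K * (r - s)\<^sup>2"
  using regular_flow_taylor[OF f K, of "(s, x)" "(r, x)"] r
    regular_flow_grad_initial[OF f, of x] regular_flow_initial[OF f, of x]
  by (simp add: norm_Pair algebra_simps)

lemma regular_flow_grad_close:
  assumes f: "regular_flow s t \<Lambda> K \<phi> f" and K: "0 \<le> K" and r: "r \<in> {s..t}"
  shows "norm (grad (\<lambda>x. f (r, x)) x - grad \<phi> x) \<le> K * (r - s)"
proof -
  have "((\<lambda>y. (r, y)) has_derivative (\<lambda>h. (0, h))) (at x)"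
    by (intro has_derivative_Pair has_derivative_const has_derivative_ident)
  moreover have "(f has_derivative (\<lambda>h. h \<bullet> grad f (r, x))) (at (r, x))"
    using regular_flow_gderiv[OF f, of "(r, x)"] r by (simp add: gderiv_def)
  ultimately have "((\<lambda>y. f (r, y)) has_derivative (\<lambda>h. (0, h) \<bullet> grad f (r, x))) (at x)"
    by (rule has_derivative_compose)
  then have "GDERIV (\<lambda>y. f (r, y)) x :> snd (grad f (r, x))"
    by (cases "grad f (r, x)") (simp add: gderiv_def)
  then have "grad (\<lambda>x. f (r, x)) x - grad \<phi> x = snd (grad f (r, x) - grad f (s, x))"
    using grad_eqI regular_flow_grad_initial[OF f, of x] r by fastforce
  then have "norm (grad (\<lambda>x. f (r, x)) x - grad \<phi> x) \<le> norm (grad f (r, x) - grad f (s, x))"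
    by (metis norm_snd_le prod.collapse)
  also have "\<dots> \<le> K * norm ((r, x) - (s, x))"
    using lipschitz_onD[OF regular_flow_lipschitz_grad[OF f K], of "(r, x)" "(s, x)"] r
    by (simp add: dist_norm)
  also have "\<dots> = K * (r - s)" using r by (simp add: norm_Pair)
  finally show ?thesis .
qed

lemma regular_flow_action:
  assumes f: "regular_flow s t \<Lambda> K \<phi> f" and K: "0 \<le> K" and st: "s \<le> t"
    and qp: "hamiltonian_trajectory H q p"
  shows "\<bar>f (t, q t) - \<phi> (q s) -
      integral {s..t} (\<lambda>\<tau>. p \<tau> \<bullet> vector_derivative q (at \<tau>) - H (\<tau>, q \<tau>, p \<tau>))\<bar>
    \<le> A * (exp (A * (1 + K) * (t - s)) * norm (grad \<phi> (q s) - p s))\<^sup>2 * (t - s)"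
proof -
  obtain \<Omega> where \<Omega>: "open \<Omega>" "{s..t} \<times> UNIV \<subseteq> \<Omega>" "classical_solution_on H \<Omega> f"
    using f by (rule regular_flow_classical)
  from action_comparison[OF \<Omega>(3,1,2) st regular_flow_hessian[OF f] K qp] show ?thesis
    using regular_flow_grad_initial[OF f st] regular_flow_initial[OF f] by simp
qed

text \<open>The trajectory ending at \<open>x\<close> provides a point \<open>q s\<close> and an
  element \<open>p s\<close> of the Clarke differential there. A function of \<open>S\<close> that
  almost touches \<open>u\<close> at \<open>q s\<close> with gradient close to \<open>p s\<close>
  has a classical solution whose value at \<open>(t, x)\<close> is almost the action. It is written
  with \<open>V\<close>, which agrees with \<open>G\<close> along classical solutions and is
  Markov.\<close>

lemma variational_step:
  assumes inf: "is_pointwise_inf S u" and conv: "convex_family S" and S: "S \<subseteq> C2_class \<rho> \<Lambda>"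
    and t: "s \<le> t" "ereal (t - s) < lifespan Q (ennreal \<rho>)" and e: "0 < e"
  shows "\<exists>\<phi>\<in>S. V s t \<phi> x \<le> G s t u x + e"
proof (cases "s = t")
  \<comment> \<open>The representation by a trajectory is available for \<open>s < t\<close>
    only.\<close>
  case True
  have uL: "\<Lambda>-lipschitz_on UNIV u"
    using S by (intro is_pointwise_inf_lipschitz[OF inf] C2_class_lipschitz) auto
  obtain \<phi> where \<phi>: "\<phi> \<in> S" "\<phi> x \<le> u x + e"
    using is_pointwise_inf_near[OF inf e] by blast
  have "V s t \<phi> = \<phi>"
    using evolution_refl[OF evolution_GV(2) C2_class_lipschitz[of \<phi> \<rho> \<Lambda>]] S \<phi> True by blast
  moreover have "G s t u = u"
    using evolution_refl[OF evolution_GV(1) uL] True by simp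
  ultimately show ?thesis using \<phi> by (intro bexI[of _ \<phi>]) simp_all
next
  case False
  then have st: "s < t" using t by simp
  have uL: "\<Lambda>-lipschitz_on UNIV u"
    using S by (intro is_pointwise_inf_lipschitz[OF inf] C2_class_lipschitz) auto
  then have "variational_solution H s u (\<lambda>(t, x). G s t u x)"
    using G is_lipschitzI unfolding variational_resolution_def by blast
  then have "\<exists>q p. hamiltonian_trajectory H q p \<and> q t = x \<and> p s \<in> clarke_differential u (q s) \<and>
      G s t u x = u (q s) + integral {s..t} (\<lambda>\<tau>. p \<tau> \<bullet> vector_derivative q (at \<tau>) - H (\<tau>, q \<tau>, p \<tau>))"
    using st unfolding variational_solution_def by simp
  then obtain q p where qp: "hamiltonian_trajectory H q p" and q: "q t = x"
    and p: "p s \<in> clarke_differential u (q s)"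
    and val: "G s t u x = u (q s) + integral {s..t} (\<lambda>\<tau>. p \<tau> \<bullet> vector_derivative q (at \<tau>) - H (\<tau>, q \<tau>, p \<tau>))"
    by blast
  define \<rho>' where "\<rho>' = enn2real (Q (t - s) (ennreal \<rho>))"
  define \<Lambda>' where "\<Lambda>' = (\<Lambda> + 1) * exp (A * (t - s)) - 1"
  define K where "K = hess_bound \<Lambda>' \<rho>'"
  have \<rho>': "Q (t - s) (ennreal \<rho>) \<le> ennreal \<rho>'" "0 \<le> \<rho>'"
    using Q_finite[OF _ t(2)] t(1) by (simp_all add: \<rho>'_def)
  obtain f0 where "f0 \<in> S" by (rule is_pointwise_inf_near[OF inf zero_less_one])
  then have nn: "0 \<le> \<Lambda>" using C2_class_nonneg S by blast
  have "1 * 1 \<le> (\<Lambda> + 1) * exp (A * (t - s))"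
    using nn A_nonneg t(1) by (intro mult_mono) simp_all
  then have \<Lambda>': "0 \<le> \<Lambda>'" by (simp add: \<Lambda>'_def)
  have K: "0 \<le> K" unfolding K_def by (intro hess_bound_nonneg \<Lambda>' \<rho>')
  define C where "C = A * (exp (A * (1 + K) * (t - s)))\<^sup>2 * (t - s)"
  have C: "0 \<le> C" using A_nonneg t by (simp add: C_def)
  \<comment> \<open>The value of \<open>\<phi>\<close> at \<open>q s\<close> costs \<open>e'\<close>
    and the action costs \<open>C * e'\<^sup>2\<close>; \<open>e' \<le> 1\<close> makes the latter
    at most \<open>C * e'\<close>.\<close>
  define e' where "e' = min 1 (e / (2 * (C + 1)))"
  have e': "0 < e'" "e' \<le> 1" using e C by (auto simp: e'_def)
  have Ce': "(C + 1) * e' \<le> e / 2"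
  proof -
    have "(C + 1) * e' \<le> (C + 1) * (e / (2 * (C + 1)))"
      using C by (intro mult_left_mono) (auto simp: e'_def)
    also have "\<dots> = e / 2" using C by (simp add: field_simps)
    finally show ?thesis .
  qed
  obtain \<phi> where \<phi>: "\<phi> \<in> S" "\<phi> (q s) \<le> u (q s) + e'" "norm (grad \<phi> (q s) - p s) \<le> e'"
    using clarke_differential_touching[OF inf conv S p e'(1)] by blast
  have "\<phi> \<in> C2_class \<rho> \<Lambda>" using \<phi>(1) S by blast
  from regular_flow_exists[OF this t \<rho>' order.refl]
  obtain f where f: "regular_flow s t \<Lambda>' K \<phi> f"
    unfolding K_def \<Lambda>'_def by blast
  have "A * (exp (A * (1 + K) * (t - s)) * norm (grad \<phi> (q s) - p s))\<^sup>2 * (t - s)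
      = C * (norm (grad \<phi> (q s) - p s))\<^sup>2"
    by (simp add: C_def power_mult_distrib)
  also have "\<dots> \<le> C * (1 * e')"
    using \<phi>(3) e' C unfolding power2_eq_square by (intro mult_left_mono mult_mono) auto
  finally have "f (t, x) \<le> \<phi> (q s) + integral {s..t} (\<lambda>\<tau>. p \<tau> \<bullet> vector_derivative q (at \<tau>) - H (\<tau>, q \<tau>, p \<tau>)) + C * e'"
    using regular_flow_action[OF f K t(1) qp] unfolding q by (simp add: abs_le_iff)
  then have "f (t, x) \<le> G s t u x + (C + 1) * e'"
    using \<phi>(2) val by (simp add: algebra_simps)
  moreover have "V s t \<phi> x = f (t, x)"
    using regular_flow_evolution[OF f evolution_GV(2)] t by simp
  ultimately show ?thesis using \<phi>(1) Ce' e by (intro bexI[of _ \<phi>]) auto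
qed

end

section \<open>Alternating evolutions and convex combinations\<close>

locale semiconcave_cauchy = hamilton_jacobi H A Q G V
  for H :: "('a::euclidean_space) hamiltonian" and A :: real
    and Q :: "real \<Rightarrow> ennreal \<Rightarrow> ennreal" and G V :: "'a evolution" +
  fixes F0 :: "('a \<Rightarrow> real) set" and u0 :: "'a \<Rightarrow> real" and B L :: real
  assumes F0: "F0 \<subseteq> C2_class B L" and B_nonneg: "0 \<le> B"
    and u0: "is_pointwise_inf F0 u0"
begin

abbreviation life :: ereal where "life \<equiv> lifespan Q (ennreal B)"

text \<open>\<open>hess\<close> and \<open>lip\<close> are the bounds inherited at time
  \<open>t\<close> from \<open>B\<close> and \<open>L\<close>. Where \<open>Q\<close> is infinite,
  \<open>enn2real\<close> returns 0, so \<open>hess\<close> serves as a bound only at times below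
  \<open>life\<close>.\<close>

definition hess :: "real \<Rightarrow> real" where "hess t = enn2real (Q t (ennreal B))"

definition lip :: "real \<Rightarrow> real" where "lip t = (L + 1) * exp (A * t) - 1"

definition const :: "real \<Rightarrow> real" where "const T = hess_bound (lip T) (hess T)"

text \<open>The set \<open>M\<^sub>t\<close> of the overview. The stages may have any lengths and
  there may be any number of them; nothing is tied to a grid of times, so \<open>evolve\<close> can
  restart from every intermediate time.\<close>

inductive reach :: "real \<Rightarrow> ('a \<Rightarrow> real) \<Rightarrow> bool" where
  initial: "f \<in> F0 \<Longrightarrow> reach 0 f"
| evolve: "reach s f \<Longrightarrow> s \<le> t \<Longrightarrow> ereal t < life \<Longrightarrow> reach t (V s t f)"
| convex: "reach t f \<Longrightarrow> reach t g \<Longrightarrow> 0 \<le> a \<Longrightarrow> 0 \<le> b \<Longrightarrow> a + b = 1 \<Longrightarrow>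
    reach t (\<lambda>x. a * f x + b * g x)"

section \<open>Bounds on the functions reached\<close>

lemma F0_nonempty: "F0 \<noteq> {}"
  using is_pointwise_inf_near[OF u0 zero_less_one] by blast

lemma L_nonneg: "0 \<le> L"
  using F0_nonempty F0 C2_class_nonneg(2) by blast

lemma u0_lipschitz: "L-lipschitz_on UNIV u0"
  using F0 by (intro is_pointwise_inf_lipschitz[OF u0] C2_class_lipschitz) auto

lemma life_pos: "0 < life"
  by (rule lifespan_pos) simp

lemma life_less: "ereal t < life \<Longrightarrow> s \<le> t \<Longrightarrow> ereal s < life"
  by (rule order.strict_trans1[of _ "ereal t"]) simp_all

lemma hess_zero: "hess 0 = B"
  using B_nonneg by (simp add: hess_def Q_zero)

lemma lip_zero: "lip 0 = L"
  by (simp add: lip_def)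

lemma ennreal_hess: "0 \<le> t \<Longrightarrow> ereal t < life \<Longrightarrow> ennreal (hess t) = Q t (ennreal B)"
  using Q_finite by (simp add: hess_def)

lemma hess_nonneg: "0 \<le> hess t"
  by (simp add: hess_def)

lemma lip_mono: "s \<le> t \<Longrightarrow> lip s \<le> lip t"
  using A_nonneg L_nonneg by (simp add: lip_def mult_left_mono)

lemma lip_nonneg: "0 \<le> t \<Longrightarrow> 0 \<le> lip t"
  using lip_mono[of 0 t] L_nonneg by (simp add: lip_zero)

lemma lip_semigroup: "(lip s + 1) * exp (A * (t - s)) - 1 = lip t"
  by (simp add: lip_def mult.assoc flip: exp_add) (simp add: algebra_simps)

lemma const_nonneg: "0 \<le> T \<Longrightarrow> 0 \<le> const T"
  unfolding const_def by (intro hess_bound_nonneg lip_nonneg hess_nonneg)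

lemma life_shift:
  assumes "0 \<le> s" "s \<le> t" "ereal t < life"
  shows "ereal (t - s) < lifespan Q (ennreal (hess s))"
  using lifespan_shift[of s "t - s" "ennreal B"] assms life_less[OF assms(3,2)]
  by (simp add: ennreal_hess)

lemma Q_hess:
  assumes "0 \<le> s" "s \<le> t" "ereal t < life"
  shows "Q (t - s) (ennreal (hess s)) = ennreal (hess t)"
  using Q_semigroup[of s "t - s" "ennreal B"] assms life_less[OF assms(3,2)]
  by (simp add: ennreal_hess)

text \<open>By the semigroup laws, restarting from the bounds at time \<open>s\<close> reproduces
  the bounds at time \<open>r\<close>. The constants therefore depend on \<open>T\<close> alone and
  not on the number of stages.\<close>

lemma class_flow:
  assumes \<phi>: "\<phi> \<in> C2_class (hess s) (lip s)" and t: "0 \<le> s" "s \<le> T" "ereal T < life"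
  obtains f where "regular_flow s T (lip T) (const T) \<phi> f"
    and "\<And>r. r \<in> {s..T} \<Longrightarrow> (\<lambda>x. f (r, x)) \<in> C2_class (hess r) (lip r)"
proof (rule regular_flow_exists[OF \<phi> t(2) life_shift[OF t]])
  show "Q (T - s) (ennreal (hess s)) \<le> ennreal (hess T)"
    using Q_hess[OF t] by simp
  show "0 \<le> hess T" by (rule hess_nonneg)
  show "(lip s + 1) * exp (A * (T - s)) - 1 \<le> lip T"
    by (simp add: lip_semigroup)
  fix f assume f: "regular_flow s T (lip T) (hess_bound (lip T) (hess T)) \<phi> f"
    and slice: "\<And>r. r \<in> {s..T} \<Longrightarrow> (\<lambda>x. f (r, x)) \<in>
        C2_class (enn2real (Q (r - s) (ennreal (hess s)))) ((lip s + 1) * exp (A * (r - s)) - 1)"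
  have "(\<lambda>x. f (r, x)) \<in> C2_class (hess r) (lip r)" if r: "r \<in> {s..T}" for r
    using slice[OF r] Q_hess[of s r] r t(1) life_less[OF t(3)] hess_nonneg
    by (simp add: lip_semigroup)
  with f show thesis by (intro that) (simp_all add: const_def)
qed

lemma reach_class:
  assumes "reach t f"
  shows "0 \<le> t \<and> ereal t < life \<and> f \<in> C2_class (hess t) (lip t)"
  using assms
proof induction
  case (initial f)
  then show ?case using F0 life_pos by (auto simp: hess_zero lip_zero zero_ereal_def)
next
  case (evolve s f t)
  then obtain h where h: "regular_flow s t (lip t) (const t) f h"
    and slice: "\<And>r. r \<in> {s..t} \<Longrightarrow> (\<lambda>x. h (r, x)) \<in> C2_class (hess r) (lip r)"
    using class_flow by metis
  have "V s t f = (\<lambda>x. h (t, x))"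
    using regular_flow_evolution[OF h evolution_GV(2), of t] evolve by auto
  with slice[of t] evolve show ?case by simp
next
  case (convex t f g a b)
  then show ?case using C2_class_convex by blast
qed

lemma reach_time: "reach t f \<Longrightarrow> 0 \<le> t" "reach t f \<Longrightarrow> ereal t < life"
  using reach_class by blast+

lemma reach_C2_class: "reach t f \<Longrightarrow> f \<in> C2_class (hess t) (lip t)"
  using reach_class by blast

lemma reach_flow:
  assumes "reach s \<phi>" "s \<le> T" "ereal T < life"
  obtains f where "regular_flow s T (lip T) (const T) \<phi> f"
    and "\<And>r x. r \<in> {s..T} \<Longrightarrow> f (r, x) = V s r \<phi> x"
proof -
  obtain f where f: "regular_flow s T (lip T) (const T) \<phi> f"
    using class_flow[OF reach_C2_class[OF assms(1)] reach_time(1)[OF assms(1)] assms(2,3)] by blast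
  show ?thesis
    using that[OF f] regular_flow_evolution[OF f evolution_GV(2)] by metis
qed

lemma V_G_reach:
  assumes "reach s \<phi>" "s \<le> t" "ereal t < life"
  shows "G s t \<phi> x = V s t \<phi> x"
proof -
  obtain f where f: "regular_flow s t (lip t) (const t) \<phi> f"
    and eq: "\<And>r x. r \<in> {s..t} \<Longrightarrow> f (r, x) = V s r \<phi> x"
    using reach_flow[OF assms] by blast
  show ?thesis
    using regular_flow_evolution[OF f evolution_GV(1), of t x] eq[of t x] assms(2) by simp
qed

lemma V_markov:
  assumes "\<Lambda>-lipschitz_on UNIV u" "r \<le> s" "s \<le> t"
  shows "V s t (V r s u) = V r t u"
  using V is_lipschitzI[OF assms(1)] assms(2,3) by (simp add: viscosity_resolution_def)

text \<open>A common lower bound survives convex combinations, and it survives an evolution by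
  monotonicity and the Markov property; this is why it is formed with \<open>V\<close> and not with
  \<open>G\<close>. It also makes the infimum \<open>W\<close> finite.\<close>

lemma V_u0_le_reach:
  assumes "reach t f"
  shows "V 0 t u0 x \<le> f x"
  using assms
proof (induction arbitrary: x)
  case (initial f)
  then show ?case
    using evolution_refl[OF evolution_GV(2) u0_lipschitz] is_pointwise_inf_le[OF u0] by simp
next
  case (evolve s f t)
  have s: "0 \<le> s" using evolve reach_time by blast
  have "V 0 t u0 x = V s t (V 0 s u0) x"
    using V_markov[OF u0_lipschitz s] evolve by simp
  also have "\<dots> \<le> V s t f x"
    using evolve s
    by (intro evolution_mono[OF evolution_GV(2) evolution_lipschitz[OF evolution_GV(2) u0_lipschitz s]
          C2_class_lipschitz[OF reach_C2_class]]) simp_all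
  finally show ?case .
next
  case (convex t f g a b)
  have "V 0 t u0 x = (a + b) * V 0 t u0 x" using convex by simp
  also have "\<dots> \<le> a * f x + b * g x"
    unfolding distrib_right using convex by (intro add_mono mult_left_mono)
  finally show ?case .
qed

section \<open>The infimum of the functions reached\<close>

definition W :: "real \<Rightarrow> 'a \<Rightarrow> real" where
  "W t x = (INF f\<in>Collect (reach t). f x)"

lemma reach_nonempty:
  assumes "0 \<le> t" "ereal t < life"
  shows "\<exists>f. reach t f"
  using assms F0_nonempty initial evolve by blast

lemma W_inf:
  assumes t: "0 \<le> t" "ereal t < life"
  shows "is_pointwise_inf (Collect (reach t)) (W t)"
  unfolding is_pointwise_inf_def
proof (intro conjI ballI allI impI)
  have bdd: "bdd_below ((\<lambda>f. f x) ` Collect (reach t))" for x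
    using V_u0_le_reach by (auto intro!: bdd_belowI2)
  show "W t x \<le> f x" if "f \<in> Collect (reach t)" for f x
    unfolding W_def by (rule cINF_lower[OF bdd that])
  show "\<exists>f\<in>Collect (reach t). f x \<le> W t x + e" if "0 < e" for x and e :: real
  proof -
    have "\<exists>f\<in>Collect (reach t). f x < W t x + e"
      using that reach_nonempty[OF t] bdd
      unfolding W_def by (subst cINF_less_iff[symmetric]) auto
    then show ?thesis using less_imp_le by blast
  qed
qed

lemma W_le: "reach t f \<Longrightarrow> W t x \<le> f x"
  using is_pointwise_inf_le[OF W_inf] reach_time by blast

lemma W_near:
  assumes "0 \<le> t" "ereal t < life" "0 < e"
  obtains f where "reach t f" "f x \<le> W t x + e"
  using is_pointwise_inf_near[OF W_inf[OF assms(1,2)] assms(3)] by blast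

lemma W_ge: "0 \<le> t \<Longrightarrow> ereal t < life \<Longrightarrow> V 0 t u0 x \<le> W t x"
  by (rule field_le_epsilon) (meson W_near V_u0_le_reach order.trans)

lemma W_lipschitz:
  assumes "0 \<le> t" "ereal t < life"
  shows "(lip t)-lipschitz_on UNIV (W t)"
  using reach_C2_class C2_class_lipschitz by (intro is_pointwise_inf_lipschitz[OF W_inf[OF assms]]) blast

lemma W_zero: "W 0 = u0"
proof
  fix x
  have 0: "ereal 0 < life" using life_pos by (simp add: zero_ereal_def)
  have "W 0 x \<le> u0 x"
    by (rule field_le_epsilon) (meson is_pointwise_inf_near[OF u0] W_le initial order.trans)
  moreover have "u0 x \<le> W 0 x"
    using W_ge[OF order.refl 0, of x] evolution_refl[OF evolution_GV(2) u0_lipschitz] by simp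
  ultimately show "W 0 x = u0 x" by simp
qed

lemma reach_convex_family: "convex_family (Collect (reach t))"
  using convex by (auto simp: convex_family_def)

lemma G_W_near:
  assumes t: "0 \<le> s" "s \<le> t" "ereal t < life" and e: "0 < e"
  shows "\<exists>\<phi>. reach s \<phi> \<and> V s t \<phi> x \<le> G s t (W s) x + e"
proof -
  have "Collect (reach s) \<subseteq> C2_class (hess s) (lip s)" using reach_C2_class by blast
  from variational_step[OF W_inf[OF t(1) life_less[OF t(3,2)]] reach_convex_family this t(2) life_shift[OF t] e]
  show ?thesis by blast
qed

lemma G_W_le:
  assumes "reach s \<phi>" "s \<le> t" "ereal t < life"
  shows "G s t (W s) x \<le> V s t \<phi> x"
proof -
  have "G s t (W s) x \<le> G s t \<phi> x"
    using assms W_le reach_time[OF assms(1)]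
    by (intro evolution_mono[OF evolution_GV(1) W_lipschitz C2_class_lipschitz[OF reach_C2_class]]) simp_all
  then show ?thesis using V_G_reach[OF assms] by simp
qed

lemma W_le_G_W:
  assumes "0 \<le> s" "s \<le> t" "ereal t < life"
  shows "W t x \<le> G s t (W s) x"
proof (rule field_le_epsilon)
  fix e :: real assume "0 < e"
  then obtain \<phi> where "reach s \<phi>" "V s t \<phi> x \<le> G s t (W s) x + e"
    using G_W_near[OF assms] by blast
  then show "W t x \<le> G s t (W s) x + e"
    using W_le[OF evolve] assms order.trans by blast
qed

text \<open>The error rate of one evolution stage from \<open>m\<close> to \<open>r\<close>, per
  unit of \<open>(r - m) * (t - s)\<close>. Replacing \<open>H\<close> at time \<open>m\<close> and
  gradient \<open>grad f x\<close> by its frozen value costs \<open>A * (1 + lip T)\<close> times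
  the elapsed time plus the gradient drift, the latter of rate \<open>const T\<close>; the second
  summand is the error of the expansion in time.\<close>

definition shadow_const :: "real \<Rightarrow> real" where
  "shadow_const T = A * (1 + lip T) * (1 + const T) + const T"

text \<open>At a fixed point \<open>x\<close>, freeze \<open>H\<close> at \<open>h p = H (s, x, p)\<close>. Up to second order errors, a function
  reached at time \<open>r\<close> is described by a function \<open>\<phi>\<close> reached at time \<open>s\<close> with the same gradient and by
  an average speed \<open>\<kappa>\<close>. The last two inequalities say that the value at time \<open>t\<close>, extrapolated either
  with speed \<open>\<kappa>\<close> from time \<open>s\<close> or with speed \<open>h (grad \<phi> x)\<close> from time \<open>r\<close>, is not below \<open>j\<close>; each of
  them is needed to propagate the other through convex combinations and evolutions.\<close>

lemma reach_shadow:
  assumes \<psi>: "reach r \<psi>" and sr: "0 \<le> s" "s \<le> r" and rt: "r \<le> t" and t: "t \<le> T" "ereal T < life"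
    and j: "\<And>\<phi>. reach s \<phi> \<Longrightarrow> j \<le> \<phi> x - (t - s) * H (s, x, grad \<phi> x)"
  shows "\<exists>\<phi> \<kappa>. reach s \<phi> \<and> norm (grad \<psi> x - grad \<phi> x) \<le> const T * (r - s) \<and>
     \<phi> x - (r - s) * \<kappa> - shadow_const T * (r - s) * (t - s) \<le> \<psi> x \<and>
     j \<le> \<phi> x - (t - s) * \<kappa> \<and>
     j \<le> \<phi> x - (r - s) * \<kappa> - (t - r) * H (s, x, grad \<phi> x)"
  using \<psi> sr(2) rt
proof induction
  case (initial f)
  then have "s = 0" using sr(1) by simp
  then show ?case using initial j[of f] reach.initial[of f]
    by (intro exI[of _ f] exI[of _ "H (s, x, grad f x)"]) simp
next
  case (evolve m f r)
  define K where "K = const T"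
  define c where "c = A * (1 + lip T)"
  define C where "C = shadow_const T"
  have m: "0 \<le> m" using evolve reach_time by blast
  have T: "0 \<le> T" using sr evolve t by linarith
  have K: "0 \<le> K" unfolding K_def by (rule const_nonneg[OF T])
  have c: "0 \<le> c" using A_nonneg lip_nonneg[OF T] by (simp add: c_def)
  have C_def': "C = c * (1 + K) + K" by (simp add: C_def c_def K_def shadow_const_def)
  have KC: "K \<le> C" using c K by (simp add: C_def')
  have rT: "r \<le> T" and st: "s \<le> t" using evolve t by auto
  show ?case
  proof (cases "m \<le> s")
    \<comment> \<open>The stage straddles \<open>s\<close>: the Markov property cuts it there, and
      the function at time \<open>s\<close> is its own shadow.\<close>
    case True
    define \<phi> where "\<phi> = V m s f"
    have \<phi>: "reach s \<phi>"
      unfolding \<phi>_def using evolve True life_less[OF t(2)] t by (intro reach.evolve) auto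
    have \<psi>: "V m r f = V s r \<phi>"
      unfolding \<phi>_def using evolve True
      by (intro V_markov[symmetric, OF C2_class_lipschitz[OF reach_C2_class]]) auto
    obtain F where F: "regular_flow s T (lip T) K \<phi> F"
      and eq: "\<And>r x. r \<in> {s..T} \<Longrightarrow> F (r, x) = V s r \<phi> x"
      using reach_flow[OF \<phi> _ t(2)] evolve t unfolding K_def by (metis order.trans)
    have rI: "r \<in> {s..T}" using evolve rT by auto
    have "\<phi> x - (r - s) * H (s, x, grad \<phi> x) - K * (r - s)\<^sup>2 \<le> V s r \<phi> x"
      using regular_flow_expansion[OF F K rI, of x] eq[OF rI, of x] by (simp add: abs_le_iff)
    moreover have "K * (r - s)\<^sup>2 \<le> C * (r - s) * (t - s)"
    proof -
      have "K * ((r - s) * (r - s)) \<le> C * ((r - s) * (t - s))"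
        using evolve KC K by (intro mult_mono mult_left_mono) auto
      then show ?thesis by (simp add: power2_eq_square mult.assoc)
    qed
    moreover have "norm (grad (V s r \<phi>) x - grad \<phi> x) \<le> K * (r - s)"
      using regular_flow_grad_close[OF F K rI, of x] by (simp add: eq[OF rI])
    moreover have "j \<le> \<phi> x - (r - s) * H (s, x, grad \<phi> x) - (t - r) * H (s, x, grad \<phi> x)"
      using j[OF \<phi>] by (simp add: algebra_simps)
    ultimately show ?thesis
      unfolding \<psi> K_def[symmetric] C_def[symmetric]
      using j[OF \<phi>] \<phi> by (intro exI[of _ \<phi>] exI[of _ "H (s, x, grad \<phi> x)"]) auto
  next
    case False
    then have sm: "s \<le> m" and mr: "m \<le> r" using evolve by auto
    obtain \<phi> \<kappa> where \<phi>: "reach s \<phi>" and near: "norm (grad f x - grad \<phi> x) \<le> K * (m - s)"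
      and val: "\<phi> x - (m - s) * \<kappa> - C * (m - s) * (t - s) \<le> f x"
      and j1: "j \<le> \<phi> x - (t - s) * \<kappa>"
      and j2: "j \<le> \<phi> x - (m - s) * \<kappa> - (t - m) * H (s, x, grad \<phi> x)"
      using evolve.IH[OF sm] mr evolve.prems unfolding K_def C_def by auto
    define h where "h = H (s, x, grad \<phi> x)"
    obtain F where F: "regular_flow m T (lip T) K f F"
      and eq: "\<And>r x. r \<in> {m..T} \<Longrightarrow> F (r, x) = V m r f x"
      using reach_flow[OF evolve.hyps(1) _ t(2)] mr rT unfolding K_def by (metis order.trans)
    have rI: "r \<in> {m..T}" using mr rT by auto
    have rs: "0 < r - s" using False mr by simp
    define \<kappa>' where "\<kappa>' = ((m - s) * \<kappa> + (r - m) * h) / (r - s)"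
    have \<kappa>': "(r - s) * \<kappa>' = (m - s) * \<kappa> + (r - m) * h"
      using rs by (simp add: \<kappa>'_def)
    have 1: "norm (grad (V m r f) x - grad \<phi> x) \<le> K * (r - s)"
    proof -
      have "norm (grad (V m r f) x - grad f x) \<le> K * (r - m)"
        using regular_flow_grad_close[OF F K rI, of x] by (simp add: eq[OF rI])
      then have "norm ((grad (V m r f) x - grad f x) + (grad f x - grad \<phi> x)) \<le> K * (r - m) + K * (m - s)"
        using near by (intro norm_triangle_le add_mono)
      then show ?thesis by (simp add: algebra_simps)
    qed
    have 2: "\<phi> x - (r - s) * \<kappa>' - C * (r - s) * (t - s) \<le> V m r f x"
    proof -
      have "norm (grad f x) \<le> lip T" "norm (grad \<phi> x) \<le> lip T"
        using C2_class_norm_grad[OF reach_C2_class[OF evolve.hyps(1)], of x]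
          C2_class_norm_grad[OF reach_C2_class[OF \<phi>], of x]
          lip_mono[of m T] lip_mono[of s T] sm mr rT by linarith+
      then have "\<bar>H (m, x, grad f x) - h\<bar> \<le> c * ((m - s) + norm (grad f x - grad \<phi> x))"
        using H_lipschitz[of "grad f x" "lip T" "grad \<phi> x" m x s x] sm by (simp add: h_def c_def)
      also have "\<dots> \<le> c * ((m - s) + K * (m - s))"
        using near c by (intro mult_left_mono) simp_all
      also have "\<dots> = c * (1 + K) * (m - s)" by (simp add: algebra_simps)
      also have "\<dots> \<le> c * (1 + K) * (t - s)"
        using c K mr evolve.prems by (intro mult_left_mono) simp_all
      finally have "H (m, x, grad f x) \<le> h + c * (1 + K) * (t - s)" by (simp add: abs_le_iff)
      then have "(r - m) * H (m, x, grad f x) \<le> (r - m) * (h + c * (1 + K) * (t - s))"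
        using mr by (intro mult_left_mono) simp_all
      moreover have "f x - (r - m) * H (m, x, grad f x) - K * (r - m)\<^sup>2 \<le> V m r f x"
        using regular_flow_expansion[OF F K rI, of x] eq[OF rI, of x] by (simp add: abs_le_iff)
      moreover have "K * (r - m)\<^sup>2 \<le> K * ((r - m) * (t - s))"
        using K mr sm evolve.prems unfolding power2_eq_square by (intro mult_left_mono) simp_all
      ultimately have "f x - (r - m) * (h + c * (1 + K) * (t - s)) - K * ((r - m) * (t - s)) \<le> V m r f x"
        by linarith
      moreover have "(r - m) * (h + c * (1 + K) * (t - s)) + K * ((r - m) * (t - s))
          = (r - m) * h + C * (r - m) * (t - s)"
        by (simp add: C_def' algebra_simps)
      moreover have "C * (r - s) * (t - s) = C * (m - s) * (t - s) + C * (r - m) * (t - s)"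
        by (simp add: algebra_simps)
      ultimately show ?thesis using val \<kappa>' by linarith
    qed
    have 4: "j \<le> \<phi> x - (r - s) * \<kappa>' - (t - r) * h"
      using j2 unfolding \<kappa>' h_def by (simp add: algebra_simps)
    \<comment> \<open>\<open>\<kappa>'\<close> is an average of \<open>\<kappa>\<close> and
      \<open>h\<close>. If \<open>h \<le> \<kappa>\<close>, it is at most \<open>\<kappa>\<close>
      and the old bound \<open>j1\<close> applies; otherwise it is at most \<open>h\<close>, and the
      bound that continues with speed \<open>h\<close> applies.\<close>
    have 3: "j \<le> \<phi> x - (t - s) * \<kappa>'"
    proof (cases "h \<le> \<kappa>")
      case True
      then have "(r - s) * \<kappa>' \<le> (r - s) * \<kappa>"
        unfolding \<kappa>' using mult_left_mono[OF True, of "r - m"] mr by (simp add: algebra_simps)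
      then have "\<kappa>' \<le> \<kappa>" using rs by simp
      then have "(t - s) * \<kappa>' \<le> (t - s) * \<kappa>" using st by (intro mult_left_mono) simp_all
      then show ?thesis using j1 by linarith
    next
      case False
      then have "(r - s) * \<kappa>' \<le> (r - s) * h"
        unfolding \<kappa>' using mult_left_mono[of \<kappa> h "m - s"] sm by (simp add: algebra_simps)
      then have "\<kappa>' \<le> h" using rs by simp
      then have "(t - r) * \<kappa>' \<le> (t - r) * h" using evolve.prems by (intro mult_left_mono) simp_all
      moreover have "(t - s) * \<kappa>' = (r - s) * \<kappa>' + (t - r) * \<kappa>'" by (simp add: algebra_simps)
      ultimately show ?thesis using 4 by linarith
    qed
    show ?thesis
      using \<phi> 1 2 3 4 unfolding K_def C_def h_def by blast
  qed
next
  case (convex r f g a b)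
  obtain \<phi>1 \<kappa>1 where 1: "reach s \<phi>1" "norm (grad f x - grad \<phi>1 x) \<le> const T * (r - s)"
     "\<phi>1 x - (r - s) * \<kappa>1 - shadow_const T * (r - s) * (t - s) \<le> f x"
     "j \<le> \<phi>1 x - (t - s) * \<kappa>1"
    using convex.IH(1)[OF convex.prems] by blast
  obtain \<phi>2 \<kappa>2 where 2: "reach s \<phi>2" "norm (grad g x - grad \<phi>2 x) \<le> const T * (r - s)"
     "\<phi>2 x - (r - s) * \<kappa>2 - shadow_const T * (r - s) * (t - s) \<le> g x"
     "j \<le> \<phi>2 x - (t - s) * \<kappa>2"
    using convex.IH(2)[OF convex.prems] by blast
  define \<phi> where "\<phi> = (\<lambda>x. a * \<phi>1 x + b * \<phi>2 x)"
  define \<kappa> where "\<kappa> = a * \<kappa>1 + b * \<kappa>2"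
  have \<phi>: "reach s \<phi>" unfolding \<phi>_def using 1 2 convex by (intro reach.convex)
  have combine: "a * l1 + b * l2 \<le> a * r1 + b * r2" if "l1 \<le> r1" "l2 \<le> r2" for l1 l2 r1 r2 :: real
    using that convex by (intro add_mono mult_left_mono)
  have unit: "a * y + b * y = y" for y
    using convex by (simp flip: distrib_right)
  have n: "norm (grad (\<lambda>x. a * f x + b * g x) x - grad \<phi> x) \<le> const T * (r - s)"
  proof -
    have gr: "grad (\<lambda>x. a * f x + b * g x) x = a *\<^sub>R grad f x + b *\<^sub>R grad g x"
      "grad \<phi> x = a *\<^sub>R grad \<phi>1 x + b *\<^sub>R grad \<phi>2 x"
      unfolding \<phi>_def using 1(1) 2(1) convex reach_C2_class C2_class_gderiv
      by (blast intro: grad_linear_combination)+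
    have "grad (\<lambda>x. a * f x + b * g x) x - grad \<phi> x = a *\<^sub>R (grad f x - grad \<phi>1 x) + b *\<^sub>R (grad g x - grad \<phi>2 x)"
      unfolding gr by (simp add: algebra_simps)
    also have "norm \<dots> \<le> a * norm (grad f x - grad \<phi>1 x) + b * norm (grad g x - grad \<phi>2 x)"
      using convex by (intro order.trans[OF norm_triangle_ineq]) simp
    also have "\<dots> \<le> a * (const T * (r - s)) + b * (const T * (r - s))"
      by (rule combine[OF 1(2) 2(2)])
    finally show ?thesis by (simp only: unit)
  qed
  have v: "\<phi> x - (r - s) * \<kappa> - shadow_const T * (r - s) * (t - s) \<le> a * f x + b * g x"
  proof -
    have "\<phi> x - (r - s) * \<kappa> - shadow_const T * (r - s) * (t - s)
       = a * (\<phi>1 x - (r - s) * \<kappa>1 - shadow_const T * (r - s) * (t - s))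
       + b * (\<phi>2 x - (r - s) * \<kappa>2 - shadow_const T * (r - s) * (t - s))"
      using unit[of "shadow_const T * (r - s) * (t - s)"]
      by (simp add: \<phi>_def \<kappa>_def algebra_simps)
    also have "\<dots> \<le> a * f x + b * g x" by (rule combine[OF 1(3) 2(3)])
    finally show ?thesis .
  qed
  have j1: "j \<le> \<phi> x - (t - s) * \<kappa>"
    using combine[OF 1(4) 2(4)] unit[of j] by (simp add: \<phi>_def \<kappa>_def algebra_simps)
  \<comment> \<open>\<open>H\<close> at the mixed gradient is not related to the mixed values of
    \<open>H\<close>, so this bound cannot be averaged. If the new frozen speed is at most
    \<open>\<kappa>\<close>, it follows from the averaged \<open>j1\<close>. Otherwise it follows
    from the hypothesis on \<open>j\<close> for the combination \<open>\<phi>\<close> itself, which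
    is again reached at time \<open>s\<close>.\<close>
  have j2: "j \<le> \<phi> x - (r - s) * \<kappa> - (t - r) * H (s, x, grad \<phi> x)"
  proof (cases "H (s, x, grad \<phi> x) \<le> \<kappa>")
    case True
    then have "(t - r) * H (s, x, grad \<phi> x) \<le> (t - r) * \<kappa>"
      using convex by (intro mult_left_mono) simp_all
    then show ?thesis using j1 by (simp add: algebra_simps)
  next
    case False
    then have "(r - s) * \<kappa> \<le> (r - s) * H (s, x, grad \<phi> x)"
      using convex by (intro mult_left_mono) simp_all
    then show ?thesis using j[OF \<phi>] by (simp add: algebra_simps)
  qed
  from \<phi> n v j1 j2 show ?case by blast
qed

text \<open>Otherwise the expansion of \<open>V s t \<phi> x\<close>, with error
  \<open>const T * (t - s)\<^sup>2\<close>, would make \<open>j\<close> a lower bound of all first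
  order extrapolations from time \<open>s\<close>. Then the shadow of \<open>\<psi>\<close> at
  \<open>r = t\<close> would force \<open>\<psi> x\<close> above itself by \<open>e\<close>. The
  function found depends on \<open>x\<close>.\<close>

lemma reach_backward:
  assumes \<psi>: "reach t \<psi>" and s: "0 \<le> s" "s \<le> t" and t: "t \<le> T" "ereal T < life" and e: "0 < e"
  shows "\<exists>\<phi>. reach s \<phi> \<and> V s t \<phi> x \<le> \<psi> x + (shadow_const T + const T) * (t - s)\<^sup>2 + e"
proof (rule ccontr)
  assume "\<not> ?thesis"
  then have gt: "\<psi> x + (shadow_const T + const T) * (t - s)\<^sup>2 + e < V s t \<phi> x" if "reach s \<phi>" for \<phi>
    using that by force
  define j where "j = \<psi> x + shadow_const T * (t - s)\<^sup>2 + e"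
  have T: "0 \<le> T" using s t by simp
  have "j \<le> \<phi> x - (t - s) * H (s, x, grad \<phi> x)" if \<phi>: "reach s \<phi>" for \<phi>
  proof -
    obtain F where F: "regular_flow s T (lip T) (const T) \<phi> F"
      and eq: "\<And>r x. r \<in> {s..T} \<Longrightarrow> F (r, x) = V s r \<phi> x"
      using reach_flow[OF \<phi> _ t(2)] s t by (metis order.trans)
    have "V s t \<phi> x \<le> \<phi> x - (t - s) * H (s, x, grad \<phi> x) + const T * (t - s)\<^sup>2"
      using regular_flow_expansion[OF F const_nonneg[OF T], of t x] eq[of t x] s t by (simp add: abs_le_iff)
    with gt[OF \<phi>] show ?thesis by (simp add: j_def algebra_simps)
  qed
  from reach_shadow[OF \<psi> s order.refl t this]
  obtain \<phi> \<kappa> where "\<phi> x - (t - s) * \<kappa> - shadow_const T * (t - s) * (t - s) \<le> \<psi> x" "j \<le> \<phi> x - (t - s) * \<kappa>"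
    by blast
  then show False using e by (simp add: j_def power2_eq_square mult.assoc)
qed

lemma W_backward:
  assumes s: "0 \<le> s" "s \<le> t" and t: "t \<le> T" "ereal T < life" and e: "0 < e"
  shows "\<exists>\<phi>. reach s \<phi> \<and> V s t \<phi> x \<le> W t x + (shadow_const T + const T) * (t - s)\<^sup>2 + e"
proof -
  obtain \<psi> where \<psi>: "reach t \<psi>" "\<psi> x \<le> W t x + e / 2"
    using W_near[of t "e / 2" x] s t life_less e by (metis half_gt_zero order.trans)
  obtain \<phi> where "reach s \<phi>" "V s t \<phi> x \<le> \<psi> x + (shadow_const T + const T) * (t - s)\<^sup>2 + e / 2"
    using reach_backward[OF \<psi>(1) s t, of "e / 2" x] e by auto
  with \<psi>(2) show ?thesis by (intro exI[of _ \<phi>]) auto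
qed

end

section \<open>Identification with the viscosity solution\<close>

lemma nonpos_if_le_linear:
  fixes X M :: real
  assumes "0 < d" "\<And>s. 0 < s \<Longrightarrow> s < d \<Longrightarrow> X \<le> M * s"
  shows "X \<le> 0"
proof (rule tendsto_lowerbound)
  show "((\<lambda>s. M * s) \<longlongrightarrow> 0) (at_right 0)"
    by (auto intro!: tendsto_eq_intros)
  show "\<forall>\<^sub>F s in at_right 0. X \<le> M * s"
    using assms by (auto simp: eventually_at_right_field)
qed simp

lemma concave_on_eq:
  assumes "concave_on S f" "\<And>x. x \<in> S \<Longrightarrow> f x = g x"
  shows "concave_on S g"
  unfolding concave_on_iff
proof (intro conjI ballI allI impI)
  show S: "convex S" using assms(1) by (rule concave_on_imp_convex)
  fix x y and u v :: real assume xy: "x \<in> S" "y \<in> S" and uv: "0 \<le> u" "0 \<le> v" "u + v = 1"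
  have "u *\<^sub>R x + v *\<^sub>R y \<in> S" using S xy uv by (rule convexD)
  moreover have "u * f x + v * f y \<le> f (u *\<^sub>R x + v *\<^sub>R y)"
    using assms(1) xy uv unfolding concave_on_iff by blast
  ultimately show "u * g x + v * g y \<le> g (u *\<^sub>R x + v *\<^sub>R y)" using assms(2) xy by simp
qed

lemma contact_cong:
  assumes "\<forall>\<^sub>F y in nhds z. w y = w' y"
  shows "contact_above \<phi> w z \<longleftrightarrow> contact_above \<phi> w' z"
    and "contact_below \<phi> w z \<longleftrightarrow> contact_below \<phi> w' z"
proof -
  have "w z = w' z" using assms by (rule eventually_nhds_x_imp_x)
  moreover have "(\<forall>\<^sub>F y in nhds z. w y \<le> \<phi> y) \<longleftrightarrow> (\<forall>\<^sub>F y in nhds z. w' y \<le> \<phi> y)"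
    using assms by (intro eventually_cong) (auto elim: eventually_mono)
  moreover have "(\<forall>\<^sub>F y in nhds z. \<phi> y \<le> w y) \<longleftrightarrow> (\<forall>\<^sub>F y in nhds z. \<phi> y \<le> w' y)"
    using assms by (intro eventually_cong) (auto elim: eventually_mono)
  ultimately show "contact_above \<phi> w z \<longleftrightarrow> contact_above \<phi> w' z"
    "contact_below \<phi> w z \<longleftrightarrow> contact_below \<phi> w' z"
    by (simp_all add: contact_above_def contact_below_def)
qed

text \<open>A substitute for a quadratic test function. It has gradient \<open>p\<close> at
  \<open>x0\<close> and is curved there, but it is Lipschitz with bounded Hessian on the whole
  space, so the evolutions apply to it and a classical solution starts from it.\<close>

lemma bump_C2_class:
  fixes p x0 :: "'a::euclidean_space" and k c :: real
  assumes c: "0 \<le> c"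
  defines "q \<equiv> (\<lambda>x. k + p \<bullet> (x - x0) + c * sqrt (1 + (x - x0) \<bullet> (x - x0)))"
  shows "q \<in> C2_class (2 * c) (norm p + c)" and "grad q x0 = p"
proof -
  define \<rho> where "\<rho> x = sqrt (1 + (x - x0) \<bullet> (x - x0))" for x
  have pos: "0 < 1 + (x - x0) \<bullet> (x - x0)" for x
    by (simp add: add_pos_nonneg)
  then have \<rho>: "0 < \<rho> x" for x by (simp add: \<rho>_def)
  have \<rho>2: "(\<rho> x)\<^sup>2 = 1 + (norm (x - x0))\<^sup>2" for x
    using pos[of x] by (simp add: \<rho>_def dot_square_norm)
  have \<rho>1: "1 \<le> \<rho> x" for x by (simp add: \<rho>_def)
  have n\<rho>: "norm (x - x0) \<le> \<rho> x" for x
    by (rule power2_le_imp_le) (use \<rho>2[of x] \<rho>[of x] in auto)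
  have D\<rho>: "(\<rho> has_derivative (\<lambda>h. ((x - x0) \<bullet> h) / \<rho> x)) (at x)" for x
  proof -
    have "((\<lambda>x. 1 + (x - x0) \<bullet> (x - x0)) has_derivative (\<lambda>h. 2 * ((x - x0) \<bullet> h))) (at x)"
      by (auto intro!: derivative_eq_intros simp: inner_commute)
    from has_derivative_real_sqrt[OF pos this] show ?thesis
      unfolding \<rho>_def[abs_def] by (simp add: field_simps)
  qed
  have q: "q = (\<lambda>x. k + p \<bullet> (x - x0) + c * \<rho> x)" by (simp add: q_def \<rho>_def)
  define g where "g x = p + (c / \<rho> x) *\<^sub>R (x - x0)" for x
  have gq: "GDERIV q x :> g x" for x
  proof -
    have "((\<lambda>x. k + p \<bullet> (x - x0)) has_derivative (\<lambda>h. p \<bullet> h)) (at x)"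
      by (auto intro!: derivative_eq_intros)
    from has_derivative_add[OF this has_derivative_mult_right[OF D\<rho>, of c]] show ?thesis
      by (simp add: gderiv_def q g_def inner_add_right inner_commute)
  qed
  have grad_q: "grad q = g" using gq by (auto intro: grad_eqI)
  show "grad q x0 = p" by (simp add: grad_q g_def)
  define D where "D x h = (c / \<rho> x) *\<^sub>R h - (c * ((x - x0) \<bullet> h) / (\<rho> x)^3) *\<^sub>R (x - x0)" for x h
  have Dg: "(g has_derivative D x) (at x)" for x
  proof -
    have "((\<lambda>x. c / \<rho> x) has_derivative (\<lambda>h. - (c * ((x - x0) \<bullet> h) / (\<rho> x)^3))) (at x)"
      using \<rho>[of x] by (auto intro!: derivative_eq_intros D\<rho> simp: field_simps power3_eq_cube)
    from has_derivative_scaleR[OF this has_derivative_diff[OF has_derivative_ident has_derivative_const]]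
    have "((\<lambda>x. (c / \<rho> x) *\<^sub>R (x - x0)) has_derivative D x) (at x)"
      by (simp add: D_def[abs_def] algebra_simps)
    from has_derivative_add[OF has_derivative_const[of p] this] show ?thesis
      by (simp add: g_def[abs_def])
  qed
  have bD: "norm (D x h) \<le> 2 * c * norm h" for x h
  proof -
    have "norm (D x h) \<le> c / \<rho> x * norm h + c * \<bar>(x - x0) \<bullet> h\<bar> / (\<rho> x)^3 * norm (x - x0)"
      unfolding D_def using c \<rho>[of x] by (intro order.trans[OF norm_triangle_ineq4]) (simp add: abs_mult)
    also have "\<dots> \<le> c * norm h + c * norm h"
    proof (intro add_mono)
      have "c / \<rho> x \<le> c / 1" using c \<rho>1[of x] by (intro divide_left_mono) auto
      then show "c / \<rho> x * norm h \<le> c * norm h" by (intro mult_right_mono) simp_all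
      have "\<bar>(x - x0) \<bullet> h\<bar> * norm (x - x0) \<le> (norm (x - x0) * norm h) * norm (x - x0)"
        by (intro mult_right_mono Cauchy_Schwarz_ineq2) simp
      also have "\<dots> \<le> (\<rho> x)^3 * norm h"
      proof -
        have "norm (x - x0) * norm (x - x0) * 1 \<le> \<rho> x * \<rho> x * \<rho> x"
          using n\<rho>[of x] \<rho>1[of x] by (intro mult_mono) auto
        then show ?thesis
          using mult_right_mono[of "norm (x - x0) * norm (x - x0)" "\<rho> x * \<rho> x * \<rho> x" "norm h"]
          by (simp add: power3_eq_cube mult_ac)
      qed
      finally have "c * (\<bar>(x - x0) \<bullet> h\<bar> * norm (x - x0)) \<le> c * ((\<rho> x)^3 * norm h)"
        by (rule mult_left_mono[OF _ c])
      then show "c * \<bar>(x - x0) \<bullet> h\<bar> / (\<rho> x)^3 * norm (x - x0) \<le> c * norm h"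
        using \<rho>[of x] by (simp add: field_simps)
    qed
    finally show ?thesis by simp
  qed
  show "q \<in> C2_class (2 * c) (norm p + c)"
    unfolding C2_class_def
  proof (intro CollectI conjI allI)
    show "C2_on UNIV q"
    proof (rule C2_onI)
      show "q differentiable (at x)" for x
        by (rule gderiv_imp_differentiable[OF gq])
      show "grad q differentiable (at x)" for x
        unfolding grad_q using Dg differentiableI by blast
      fix h k
      have "(\<lambda>y. frechet_derivative q (at y) h) = (\<lambda>y. h \<bullet> g y)"
        using gderiv_imp_differentiable[OF gq] grad_q by (simp add: frechet_derivative_eq_grad)
      moreover have "((\<lambda>y. h \<bullet> g y) has_derivative (\<lambda>k. h \<bullet> D x k)) (at x)" for x
        by (rule has_derivative_inner_right[OF Dg])
      then have "frechet_derivative (\<lambda>y. h \<bullet> g y) (at x) = (\<lambda>k. h \<bullet> D x k)" for x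
        by (simp flip: frechet_derivative_at)
      moreover have "continuous_on UNIV \<rho>"
        unfolding \<rho>_def[abs_def] by (intro continuous_intros)
      then have "continuous_on UNIV (\<lambda>x. h \<bullet> D x k)"
        unfolding D_def using \<rho> by (intro continuous_intros) (auto simp: less_imp_neq[symmetric])
      ultimately show "continuous_on UNIV (\<lambda>x. frechet_derivative (\<lambda>y. frechet_derivative q (at y) h) (at x) k)"
        by simp
    qed simp
    show "(norm p + c)-lipschitz_on UNIV q"
    proof (rule lipschitz_of_gradient_bound[OF convex_UNIV gq])
      fix x
      have "norm (g x) \<le> norm p + c / \<rho> x * norm (x - x0)"
        unfolding g_def using c \<rho>[of x] by (intro order.trans[OF norm_triangle_ineq]) simp
      also have "c / \<rho> x * norm (x - x0) \<le> c / \<rho> x * \<rho> x"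
        using c \<rho>[of x] n\<rho>[of x] by (intro mult_left_mono) simp_all
      also have "\<dots> = c" using \<rho>[of x] by simp
      finally show "norm (g x) \<le> norm p + c" by simp
    qed (use c in simp)
    show "d2_norm q x \<le> 2 * c" for x
      unfolding d2_norm_def grad_q frechet_derivative_at[OF Dg, symmetric]
      using c bD by (intro onorm_bound) auto
  qed
qed

text \<open>A single lower bound of order \<open>r\<^sup>2\<close> near 0 and of order
  \<open>r\<close> at infinity: it absorbs the quadratic error of a test function near the contact
  point and the Lipschitz growth of \<open>W\<close> far away.\<close>

lemma sqrt_one_plus_square_ge:
  fixes r :: real
  assumes "0 \<le> r"
  shows "r\<^sup>2 / (r + 2) \<le> sqrt (1 + r\<^sup>2) - 1"
proof -
  have "sqrt (1 + r\<^sup>2) \<le> 1 + r"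
    using assms by (intro real_le_lsqrt) (auto simp: power2_eq_square algebra_simps)
  then have "(sqrt (1 + r\<^sup>2) - 1) * (sqrt (1 + r\<^sup>2) + 1) \<le> (sqrt (1 + r\<^sup>2) - 1) * (r + 2)"
    by (intro mult_left_mono) simp_all
  moreover have "(sqrt (1 + r\<^sup>2) - 1) * (sqrt (1 + r\<^sup>2) + 1) = r\<^sup>2"
    by (simp add: algebra_simps flip: power2_eq_square)
  ultimately have "r\<^sup>2 \<le> (sqrt (1 + r\<^sup>2) - 1) * (r + 2)" by simp
  then show ?thesis using assms by (simp add: field_simps)
qed

context semiconcave_cauchy
begin

text \<open>\<open>T'\<close> is the time horizon and \<open>T\<close> the time where
  \<open>V\<close> takes over from \<open>W\<close>. The first term bounds the displacement by an
  evolution; the second one comes from the quadratic error of \<open>W_backward\<close>, with one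
  factor \<open>t - s\<close> estimated by \<open>T\<close>.\<close>

definition time_lip :: "real \<Rightarrow> real \<Rightarrow> real" where
  "time_lip T T' = A * (lip T' + 1)\<^sup>2 + (shadow_const T + const T) * T"

lemma shadow_const_nonneg: "0 \<le> T \<Longrightarrow> 0 \<le> shadow_const T"
  using A_nonneg lip_nonneg const_nonneg by (simp add: shadow_const_def)

lemma time_lip_nonneg: "0 \<le> T \<Longrightarrow> 0 \<le> time_lip T T'"
  using A_nonneg const_nonneg shadow_const_nonneg by (simp add: time_lip_def)

lemma V_close:
  assumes u: "(lip s)-lipschitz_on UNIV u" and st: "s \<le> t" "t \<le> T"
  shows "\<bar>V s t u x - u x\<bar> \<le> A * (lip T + 1)\<^sup>2 * (t - s)"
proof -
  have "\<bar>V s t u x - u x\<bar> \<le> A * (t - s) * ((lip s + 1) * exp (A * (t - s)))\<^sup>2"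
    by (rule evolution_close[OF evolution_GV(2) u st(1)])
  also have "(lip s + 1) * exp (A * (t - s)) = lip t + 1"
    using lip_semigroup[of s t] by linarith
  also have "A * (t - s) * (lip t + 1)\<^sup>2 \<le> A * (t - s) * (lip T + 1)\<^sup>2"
    using A_nonneg st lip_mono[OF st(2)] L_nonneg
    by (intro mult_left_mono power_mono) (simp_all add: lip_def)
  finally show ?thesis by (simp add: mult_ac)
qed

text \<open>For the upper bound, evolve an almost minimal function from \<open>s\<close> to
  \<open>t\<close>. The lower bound needs \<open>W_backward\<close>, since a function reached at
  time \<open>t\<close> need not come from time \<open>s\<close> in one stage.\<close>

lemma W_time:
  assumes s: "0 \<le> s" "s \<le> t" and t: "t \<le> T" "ereal T < life"
  shows "\<bar>W t x - W s x\<bar> \<le> time_lip T T * (t - s)"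
proof -
  define c where "c = A * (lip T + 1)\<^sup>2"
  define C where "C = shadow_const T + const T"
  have T: "0 \<le> T" using s t by simp
  have C: "0 \<le> C" using shadow_const_nonneg[OF T] const_nonneg[OF T] by (simp add: C_def)
  have lt: "ereal s < life" "ereal t < life" using s t life_less by auto
  have close: "\<bar>V s t \<phi> x - \<phi> x\<bar> \<le> c * (t - s)" if "reach s \<phi>" for \<phi>
    unfolding c_def
    using V_close[OF C2_class_lipschitz[OF reach_C2_class[OF that]] s(2) t(1)] .
  have "W t x \<le> W s x + c * (t - s)"
  proof (rule field_le_epsilon)
    fix e :: real assume "0 < e"
    then obtain \<phi> where \<phi>: "reach s \<phi>" "\<phi> x \<le> W s x + e" using W_near[OF s(1) lt(1)] by blast
    have "W t x \<le> V s t \<phi> x" by (rule W_le[OF evolve[OF \<phi>(1) s(2) lt(2)]])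
    then show "W t x \<le> W s x + c * (t - s) + e" using close[OF \<phi>(1)] \<phi>(2) by linarith
  qed
  moreover have "W s x \<le> W t x + C * (t - s)\<^sup>2 + c * (t - s)"
  proof (rule field_le_epsilon)
    fix e :: real assume "0 < e"
    then obtain \<phi> where \<phi>: "reach s \<phi>" "V s t \<phi> x \<le> W t x + C * (t - s)\<^sup>2 + e"
      using W_backward[OF s t] unfolding C_def by blast
    show "W s x \<le> W t x + C * (t - s)\<^sup>2 + c * (t - s) + e"
      using W_le[OF \<phi>(1), of x] close[OF \<phi>(1)] \<phi>(2) by linarith
  qed
  moreover have "C * (t - s)\<^sup>2 \<le> C * (T * (t - s))"
    using C s t unfolding power2_eq_square by (intro mult_left_mono mult_right_mono) auto
  moreover have "0 \<le> C * (T * (t - s))" using C T s by simp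
  moreover have "time_lip T T * (t - s) = c * (t - s) + C * (T * (t - s))"
    by (simp add: time_lip_def c_def C_def algebra_simps)
  ultimately show ?thesis by linarith
qed

text \<open>Uniqueness of the viscosity solution concerns all positive times, hence the continuation by \<open>V\<close>.\<close>

definition extended :: "real \<Rightarrow> real \<times> 'a \<Rightarrow> real" where
  "extended T z = (if fst z \<le> T then W (fst z) (snd z) else V T (fst z) (W T) (snd z))"

section \<open>Regularity of the continued infimum\<close>

lemma extended_before: "t \<le> T \<Longrightarrow> extended T (t, x) = W t x"
  by (simp add: extended_def)

lemma extended_after:
  assumes "0 \<le> T" "ereal T < life" "T \<le> t"
  shows "extended T (t, x) = V T t (W T) x"
  using evolution_refl[OF evolution_GV(2) W_lipschitz[OF assms(1,2)]] assms(3)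
  by (auto simp: extended_def)

lemma extended_lipschitz_space:
  assumes T: "0 \<le> T" "ereal T < life" and t: "0 \<le> t"
  shows "(lip t)-lipschitz_on UNIV (\<lambda>x. extended T (t, x))"
proof (cases "t \<le> T")
  case True
  then show ?thesis
    using W_lipschitz[OF t life_less[OF T(2) True]] by (simp add: extended_before)
next
  case False
  then show ?thesis
    using evolution_lipschitz[OF evolution_GV(2) W_lipschitz[OF T], where s = T and t = t]
    by (simp add: extended_after[OF T] lip_semigroup)
qed

lemma extended_time:
  assumes T: "0 \<le> T" "ereal T < life" and st: "0 \<le> s" "s \<le> t" "t \<le> T'" "T \<le> T'"
  shows "\<bar>extended T (t, x) - extended T (s, x)\<bar> \<le> time_lip T T' * (t - s)"
proof -
  have le: "time_lip T T \<le> time_lip T T'" "A * (lip T' + 1)\<^sup>2 \<le> time_lip T T'"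
    using A_nonneg lip_mono[OF st(4)] L_nonneg shadow_const_nonneg[OF T(1)] const_nonneg[OF T(1)] T(1)
    by (auto simp: time_lip_def lip_def intro!: mult_left_mono power_mono)
  have before: "\<bar>extended T (t, x) - extended T (s, x)\<bar> \<le> time_lip T T' * (t - s)"
    if "0 \<le> s" "s \<le> t" "t \<le> T" for s t
    using W_time[OF that(1,2,3) T(2), of x] that mult_right_mono[OF le(1), of "t - s"]
    by (simp add: extended_before)
  have after: "\<bar>extended T (t, x) - extended T (s, x)\<bar> \<le> time_lip T T' * (t - s)"
    if "T \<le> s" "s \<le> t" "t \<le> T'" for s t
  proof -
    have "V T t (W T) = V s t (V T s (W T))"
      using V_markov[OF W_lipschitz[OF T] that(1,2)] by simp
    moreover have "(lip s)-lipschitz_on UNIV (V T s (W T))"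
      using evolution_lipschitz[OF evolution_GV(2) W_lipschitz[OF T] that(1)] by (simp add: lip_semigroup)
    from V_close[OF this that(2,3), of x]
    have "\<bar>V s t (V T s (W T)) x - V T s (W T) x\<bar> \<le> A * (lip T' + 1)\<^sup>2 * (t - s)" .
    ultimately show ?thesis
      using that mult_right_mono[OF le(2), of "t - s"] by (simp add: extended_after[OF T])
  qed
  consider "t \<le> T" | "T \<le> s" | "s < T" "T < t" by linarith
  then show ?thesis
  proof cases
    case 3
    have "time_lip T T' * (T - s) + time_lip T T' * (t - T) = time_lip T T' * (t - s)"
      by (simp add: algebra_simps)
    then show ?thesis using before[of s T] after[of T t] 3 st by linarith
  qed (use before after st in auto)
qed

lemma extended_lipschitz:
  assumes T: "0 \<le> T" "ereal T < life" and T': "T \<le> T'"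
  shows "(time_lip T T' + lip T')-lipschitz_on ({0..T'} \<times> UNIV) (extended T)"
proof (rule lipschitz_onI)
  have T'0: "0 \<le> T'" using T T' by simp
  show "0 \<le> time_lip T T' + lip T'"
    using time_lip_nonneg[OF T(1)] lip_nonneg[OF T'0] by simp
  have *: "dist (extended T (s, x)) (extended T (t, y)) \<le> (time_lip T T' + lip T') * dist (s, x) (t, y)"
    if st: "0 \<le> s" "s \<le> t" "t \<le> T'" for s t x y
  proof -
    have "\<bar>extended T (t, x) - extended T (s, x)\<bar> \<le> time_lip T T' * (t - s)"
      by (rule extended_time[OF T st T'])
    also have "\<dots> \<le> time_lip T T' * dist (s, x) (t, y)"
      using st dist_fst_le[of "(s, x)" "(t, y)"] time_lip_nonneg[OF T(1)]
      by (intro mult_left_mono) (simp_all add: dist_real_def)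
    finally have 1: "\<bar>extended T (t, x) - extended T (s, x)\<bar> \<le> time_lip T T' * dist (s, x) (t, y)" .
    have "\<bar>extended T (t, x) - extended T (t, y)\<bar> \<le> lip t * dist x y"
      using lipschitz_onD[OF extended_lipschitz_space[OF T, of t], of x y] st by (simp add: dist_real_def)
    also have "\<dots> \<le> lip T' * dist (s, x) (t, y)"
      using dist_snd_le[of "(s, x)" "(t, y)"] lip_mono[OF st(3)] lip_nonneg[OF T'0]
      by (intro mult_mono) simp_all
    finally have "\<bar>extended T (t, x) - extended T (t, y)\<bar> \<le> lip T' * dist (s, x) (t, y)" .
    with 1 show ?thesis by (simp add: dist_real_def algebra_simps)
  qed
  fix z z' :: "real \<times> 'a" assume z: "z \<in> {0..T'} \<times> UNIV" "z' \<in> {0..T'} \<times> UNIV"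
  show "dist (extended T z) (extended T z') \<le> (time_lip T T' + lip T') * dist z z'"
    using *[of "fst z" "fst z'" "snd z" "snd z'"] *[of "fst z'" "fst z" "snd z'" "snd z"] z
    by (cases "fst z \<le> fst z'") (auto simp: dist_commute)
qed

lemma extended_continuous:
  assumes T: "0 \<le> T" "ereal T < life"
  shows "continuous_on ({0..} \<times> UNIV) (extended T)"
  unfolding continuous_on_iff
proof (intro ballI allI impI)
  fix z :: "real \<times> 'a" and e :: real assume z: "z \<in> {0..} \<times> UNIV" and e: "0 < e"
  define T' where "T' = max T (fst z + 1)"
  define M where "M = time_lip T T' + lip T'"
  have lip: "M-lipschitz_on ({0..T'} \<times> UNIV) (extended T)"
    unfolding M_def by (rule extended_lipschitz[OF T]) (simp add: T'_def)
  have M: "0 \<le> M" using lip by (rule lipschitz_on_nonneg)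
  show "\<exists>d>0. \<forall>z'\<in>{0..} \<times> UNIV. dist z' z < d \<longrightarrow> dist (extended T z') (extended T z) < e"
  proof (intro exI[of _ "min 1 (e / (M + 1))"] conjI ballI impI)
    show "0 < min 1 (e / (M + 1))" using e M by simp
    fix z' :: "real \<times> 'a" assume z': "z' \<in> {0..} \<times> UNIV" "dist z' z < min 1 (e / (M + 1))"
    have "dist (fst z') (fst z) < 1" using z'(2) dist_fst_le[of z' z] by simp
    then have in': "z' \<in> {0..T'} \<times> UNIV" "z \<in> {0..T'} \<times> UNIV"
      using z z'(1) by (auto simp: T'_def dist_real_def mem_Times_iff)
    have "dist (extended T z') (extended T z) \<le> M * dist z' z"
      by (rule lipschitz_onD[OF lip in'])
    also have "\<dots> \<le> M * (e / (M + 1))"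
      using z'(2) M by (intro mult_left_mono) simp_all
    also have "\<dots> < e" using e M by (simp add: field_simps)
    finally show "dist (extended T z') (extended T z) < e" .
  qed
qed

text \<open>At time \<open>\<tau> = t0 - s\<close> the bound from above is turned into a global
  majorant \<open>q\<close> of \<open>W \<tau>\<close> with gradient \<open>p\<close> at
  \<open>x0\<close>. Then \<open>W t0 x0\<close> is at most \<open>G \<tau> t0 q x0\<close>, which
  is the value of a classical solution and is expanded in \<open>s\<close>; divide by
  \<open>s\<close> and let \<open>s\<close> tend to 0. Only times up to \<open>t0\<close>
  enter.\<close>

lemma W_subsolution:
  assumes t0: "0 < t0" "ereal t0 < life" and d: "0 < d" and K: "0 \<le> K"
    and above: "\<And>s x. \<lbrakk>t0 - d < s; s \<le> t0; norm (x - x0) < d\<rbrakk> \<Longrightarrow>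
      W s x \<le> W t0 x0 + a * (s - t0) + p \<bullet> (x - x0) + K * ((s - t0)\<^sup>2 + (norm (x - x0))\<^sup>2)"
  shows "a + H (t0, x0, p) \<le> 0"
proof -
  define C where "C = time_lip t0 t0"
  define R where "R = C + \<bar>a\<bar> + lip t0 + norm p"
  define \<delta> where "\<delta> = min d 1"
  \<comment> \<open>By \<open>sqrt_one_plus_square_ge\<close>, the summand \<open>3 * K\<close>
    dominates \<open>K * r\<^sup>2\<close> at distances \<open>r < \<delta>\<close>, and
    \<open>3 * R / \<delta>\<close> dominates \<open>R * r\<close> at distances
    \<open>r \<ge> \<delta>\<close>. There \<open>R\<close> collects all Lipschitz terms, those in
    time included because \<open>s < \<delta> \<le> r\<close>.\<close>
  define c where "c = 3 * K + 3 * R / \<delta>"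
  have C: "0 \<le> C" unfolding C_def using time_lip_nonneg t0 by simp
  have \<delta>: "0 < \<delta>" "\<delta> \<le> 1" "\<delta> \<le> d" using d by (auto simp: \<delta>_def)
  have R: "0 \<le> R" using C lip_nonneg[of t0] t0 by (simp add: R_def)
  have c: "0 \<le> c" using K R \<delta> by (simp add: c_def)
  \<comment> \<open>The existence time \<open>\<sigma>\<close> depends on \<open>c\<close> but not
    on \<open>s\<close>, so \<open>\<rho>'\<close>, \<open>\<Lambda>'\<close> and \<open>K'\<close>
    stay fixed while \<open>s\<close> tends to 0.\<close>
  have "ereal 0 < lifespan Q (ennreal (2 * c))"
    using lifespan_pos by (simp add: zero_ereal_def)
  then obtain \<sigma> where \<sigma>: "0 < \<sigma>" "ereal \<sigma> < lifespan Q (ennreal (2 * c))"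
    using ereal_dense2[of "ereal 0"] by auto
  define \<rho>' where "\<rho>' = enn2real (Q \<sigma> (ennreal (2 * c)))"
  define \<Lambda>' where "\<Lambda>' = (norm p + c + 1) * exp (A * \<sigma>) - 1"
  define K' where "K' = hess_bound \<Lambda>' \<rho>'"
  have "1 * 1 \<le> (norm p + c + 1) * exp (A * \<sigma>)"
    using c A_nonneg \<sigma> by (intro mult_mono) simp_all
  then have \<Lambda>': "0 \<le> \<Lambda>'" by (simp add: \<Lambda>'_def)
  have \<rho>': "0 \<le> \<rho>'" "Q \<sigma> (ennreal (2 * c)) = ennreal \<rho>'"
    using Q_finite[OF _ \<sigma>(2)] \<sigma>(1) by (simp_all add: \<rho>'_def)
  have K': "0 \<le> K'" unfolding K'_def by (intro hess_bound_nonneg \<Lambda>' \<rho>')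
  have main: "a + H (t0, x0, p) \<le> (K + K' + A * (1 + norm p)) * s"
    if s: "0 < s" "s < min (min \<delta> \<sigma>) t0" for s
  proof -
    define \<tau> where "\<tau> = t0 - s"
    \<comment> \<open>The \<open>- c\<close> cancels the square root term at \<open>x0\<close>,
      where \<open>q\<close> takes the value of the upper bound at time
      \<open>\<tau>\<close>.\<close>
    define q where "q = (\<lambda>x. (W t0 x0 - a * s + K * s\<^sup>2 - c) + p \<bullet> (x - x0)
       + c * sqrt (1 + (x - x0) \<bullet> (x - x0)))"
    have q: "q \<in> C2_class (2 * c) (norm p + c)" "grad q x0 = p"
      unfolding q_def by (rule bump_C2_class[OF c])+
    have \<tau>: "0 \<le> \<tau>" "\<tau> \<le> t0" "t0 - \<tau> = s" using s by (auto simp: \<tau>_def)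
    have \<tau>l: "ereal \<tau> < life" by (rule life_less[OF t0(2) \<tau>(2)])
    have ge: "W \<tau> x \<le> q x" for x
    proof -
      define r where "r = norm (x - x0)"
      have r: "0 \<le> r" by (simp add: r_def)
      have qx: "q x = W t0 x0 - a * s + K * s\<^sup>2 + p \<bullet> (x - x0) + c * (sqrt (1 + r\<^sup>2) - 1)"
        by (simp add: q_def r_def dot_square_norm algebra_simps)
      have b: "c * (r\<^sup>2 / (r + 2)) \<le> c * (sqrt (1 + r\<^sup>2) - 1)"
        by (intro mult_left_mono sqrt_one_plus_square_ge r c)
      show ?thesis
      proof (cases "r < \<delta>")
        case True
        have "W \<tau> x \<le> W t0 x0 + a * (\<tau> - t0) + p \<bullet> (x - x0) + K * ((\<tau> - t0)\<^sup>2 + r\<^sup>2)"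
          unfolding r_def using above[of \<tau> x] True s \<delta> by (auto simp: \<tau>_def r_def)
        moreover have "K * r\<^sup>2 \<le> c * (r\<^sup>2 / (r + 2))"
        proof -
          have "K \<le> c / (r + 2)"
          proof -
            have "K * (r + 2) \<le> K * 3" using True \<delta> K by (intro mult_left_mono) simp_all
            also have "\<dots> \<le> c" using R \<delta> by (simp add: c_def)
            finally show ?thesis using r by (simp add: field_simps)
          qed
          from mult_right_mono[OF this, of "r\<^sup>2"] show ?thesis by simp
        qed
        moreover have "a * (\<tau> - t0) = - a * s" "(\<tau> - t0)\<^sup>2 = s\<^sup>2" by (simp_all add: \<tau>_def)
        ultimately show ?thesis using b unfolding qx by (simp add: distrib_left)
      next
        case False
        have "\<bar>W t0 x - W \<tau> x\<bar> \<le> C * s"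
          using W_time[OF \<tau>(1,2) order.refl t0(2), of x] \<tau>(3) by (simp add: C_def)
        moreover have "\<bar>W t0 x - W t0 x0\<bar> \<le> lip t0 * r"
          using lipschitz_onD[OF W_lipschitz[of t0], of x x0] t0 by (simp add: dist_norm r_def)
        ultimately have "W \<tau> x \<le> W t0 x0 + C * s + lip t0 * r" by linarith
        moreover have "- (p \<bullet> (x - x0)) \<le> norm p * r"
          using Cauchy_Schwarz_ineq2[of p "x - x0"] by (simp add: r_def)
        moreover have "a * s \<le> \<bar>a\<bar> * s" using s by (intro mult_right_mono) simp_all
        moreover have "0 \<le> K * s\<^sup>2" using K by simp
        moreover have "(C + \<bar>a\<bar>) * s \<le> (C + \<bar>a\<bar>) * r"
          using False s C by (intro mult_left_mono) simp_all
        moreover have "R * r \<le> c * (r\<^sup>2 / (r + 2))"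
        proof -
          have "R * (r + 2) \<le> R * (3 * r / \<delta>)"
          proof (intro mult_left_mono R)
            have "r * \<delta> + 2 * \<delta> \<le> r * 1 + 2 * r"
              using False \<delta> r by (intro add_mono mult_left_mono) simp_all
            then show "r + 2 \<le> 3 * r / \<delta>" using \<delta> by (simp add: field_simps)
          qed
          also have "\<dots> = (3 * R / \<delta>) * r" by simp
          also have "\<dots> \<le> c * r" using K r by (intro mult_right_mono) (simp_all add: c_def)
          finally have "R * (r + 2) * r \<le> c * r * r" using r by (rule mult_right_mono)
          then show ?thesis using r by (simp add: field_simps power2_eq_square)
        qed
        ultimately show ?thesis using b unfolding qx R_def by (simp add: algebra_simps)
      qed
    qed
    have fin: "ereal (t0 - \<tau>) < lifespan Q (ennreal (2 * c))"
      unfolding \<tau>(3) using s by (intro order.strict_trans1[OF _ \<sigma>(2)]) simp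
    have "Q (t0 - \<tau>) (ennreal (2 * c)) \<le> ennreal \<rho>'"
      unfolding \<rho>'(2)[symmetric] \<tau>(3) using s by (intro Q_mono_time) simp_all
    moreover have "(norm p + c + 1) * exp (A * (t0 - \<tau>)) - 1 \<le> \<Lambda>'"
      unfolding \<Lambda>'_def \<tau>(3) using s A_nonneg c by (simp add: mult_left_mono)
    ultimately obtain f where f: "regular_flow \<tau> t0 \<Lambda>' K' q f"
      using regular_flow_exists[OF q(1) \<tau>(2) fin _ \<rho>'(1)] unfolding K'_def by blast
    have t0I: "t0 \<in> {\<tau>..t0}" using \<tau> by simp
    have "W t0 x0 \<le> G \<tau> t0 (W \<tau>) x0" by (rule W_le_G_W[OF \<tau>(1,2) t0(2)])
    also have "\<dots> \<le> G \<tau> t0 q x0"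
      by (rule evolution_mono[OF evolution_GV(1) W_lipschitz[OF \<tau>(1) \<tau>l] C2_class_lipschitz[OF q(1)] ge \<tau>(2)])
    also have "\<dots> = f (t0, x0)" by (rule regular_flow_evolution[OF f evolution_GV(1) t0I])
    also have "\<dots> \<le> q x0 - s * H (\<tau>, x0, p) + K' * s\<^sup>2"
      using regular_flow_expansion[OF f K' t0I, of x0] unfolding q(2) \<tau>(3) by (simp add: abs_le_iff)
    also have "q x0 = W t0 x0 - a * s + K * s\<^sup>2" by (simp add: q_def)
    finally have "s * (a + H (\<tau>, x0, p)) \<le> s * ((K + K') * s)"
      by (simp add: algebra_simps power2_eq_square)
    then have 1: "a + H (\<tau>, x0, p) \<le> (K + K') * s" using s(1) by simp
    have "\<bar>H (t0, x0, p) - H (\<tau>, x0, p)\<bar> \<le> A * (1 + norm p) * s"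
      using H_lipschitz[of p "norm p" p t0 x0 \<tau> x0] s by (simp add: \<tau>_def)
    with 1 show ?thesis by (simp add: algebra_simps)
  qed
  show ?thesis
  proof (rule nonpos_if_le_linear)
    show "0 < min (min \<delta> \<sigma>) t0" using \<delta> \<sigma> t0 by simp
  qed (rule main)
qed

text \<open>\<open>W_backward\<close> gives a \<open>\<phi>\<close> at time
  \<open>\<tau> = t0 - s\<close> whose evolution almost touches \<open>W\<close> at
  \<open>(t0, x0)\<close>, but its gradient \<open>P\<close> at \<open>x0\<close> may differ from
  \<open>p\<close>. Since \<open>\<phi>\<close> lies above the bound from below, comparing the two
  at a displaced point penalises the difference by \<open>\<kappa> * (norm (P - p))\<^sup>2\<close>.
  This absorbs the change of \<open>H\<close> between \<open>P\<close> and \<open>p\<close> up to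
  \<open>c\<^sup>2 / \<kappa>\<close>. First \<open>s\<close> tends to 0 with
  \<open>\<kappa>\<close> fixed, then \<open>\<kappa>\<close> tends to infinity.\<close>

lemma W_supersolution:
  assumes t0: "0 < t0" "ereal t0 < life" and d: "0 < d" and K: "0 \<le> K"
    and below: "\<And>s x. \<lbrakk>t0 - d < s; s \<le> t0; norm (x - x0) < d\<rbrakk> \<Longrightarrow>
      W t0 x0 + a * (s - t0) + p \<bullet> (x - x0) - K * ((s - t0)\<^sup>2 + (norm (x - x0))\<^sup>2) \<le> W s x"
  shows "0 \<le> a + H (t0, x0, p)"
proof -
  define \<Lambda> where "\<Lambda> = lip t0"
  define R where "R = \<Lambda> + norm p"
  define c where "c = A * (1 + R)"
  \<comment> \<open>\<open>W_backward\<close> contributes \<open>shadow_const t0 + const t0\<close>,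
    the expansion of the flow another \<open>const t0\<close>, and the tolerance
    \<open>s\<^sup>2\<close> the 1.\<close>
  define M where "M = shadow_const t0 + 2 * const t0 + 1"
  have \<Lambda>: "0 \<le> \<Lambda>" using lip_nonneg t0 by (simp add: \<Lambda>_def)
  have R: "0 \<le> R" using \<Lambda> by (simp add: R_def)
  have c: "0 \<le> c" using R A_nonneg by (simp add: c_def)
  have M: "0 \<le> M" using shadow_const_nonneg[of t0] const_nonneg[of t0] t0 by (simp add: M_def)
  have main: "- (a + H (t0, x0, p)) \<le> c\<^sup>2 / \<kappa>" if \<kappa>: "0 < \<kappa>" for \<kappa>
  proof -
    define N where "N = K + (K + hess t0) * (\<kappa> * R)\<^sup>2 + M + c"
    have lin: "- (a + H (t0, x0, p)) - c\<^sup>2 / \<kappa> \<le> N * s"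
      if s: "0 < s" "s < min (min d t0) (d / (\<kappa> * R + 1))" for s
    proof -
      define \<tau> where "\<tau> = t0 - s"
      have \<tau>: "0 \<le> \<tau>" "\<tau> \<le> t0" "t0 - \<tau> = s" using s by (auto simp: \<tau>_def)
      have \<tau>l: "ereal \<tau> < life" by (rule life_less[OF t0(2) \<tau>(2)])
      have s2: "0 < s\<^sup>2" using s by simp
      obtain \<phi> where \<phi>: "reach \<tau> \<phi>"
        and val: "V \<tau> t0 \<phi> x0 \<le> W t0 x0 + (shadow_const t0 + const t0) * s\<^sup>2 + s\<^sup>2"
        using W_backward[OF \<tau>(1,2) order.refl t0(2) s2, of x0] unfolding \<tau>(3) by blast
      obtain f where f: "regular_flow \<tau> t0 (lip t0) (const t0) \<phi> f"
        and eq: "\<And>r x. r \<in> {\<tau>..t0} \<Longrightarrow> f (r, x) = V \<tau> r \<phi> x"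
        using reach_flow[OF \<phi> \<tau>(2) t0(2)] by blast
      define P where "P = grad \<phi> x0"
      have t0I: "t0 \<in> {\<tau>..t0}" using \<tau> by simp
      have "\<phi> x0 - s * H (\<tau>, x0, P) - const t0 * s\<^sup>2 \<le> V \<tau> t0 \<phi> x0"
        using regular_flow_expansion[OF f const_nonneg t0I, of x0] eq[OF t0I, of x0] t0 \<tau>(3)
        by (simp add: abs_le_iff P_def)
      with val have up: "\<phi> x0 \<le> W t0 x0 + s * H (\<tau>, x0, P) + M * s\<^sup>2"
        by (simp add: M_def algebra_simps)
      have \<phi>C: "\<phi> \<in> C2_class (hess \<tau>) (lip \<tau>)" by (rule reach_C2_class[OF \<phi>])
      have P: "norm P \<le> \<Lambda>"
        using C2_class_norm_grad[OF \<phi>C, of x0] lip_mono[OF \<tau>(2)] by (simp add: P_def \<Lambda>_def)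
      have PR: "norm (P - p) \<le> R"
        using norm_triangle_ineq4[of P p] P by (simp add: R_def)
      \<comment> \<open>The direction in which \<open>\<phi>\<close> decreases fastest relative to
        the bound from below. With a length of order \<open>s\<close>, the gain is of first order in
        \<open>s\<close> and the quadratic errors are of second order.\<close>
      define y where "y = - (\<kappa> * s) *\<^sub>R (P - p)"
      have ny: "norm y = \<kappa> * s * norm (P - p)" using \<kappa> s by (simp add: y_def)
      have "norm y \<le> s * (\<kappa> * R)"
        unfolding ny using PR \<kappa> s by (simp add: mult.commute mult.left_commute)
      also have "\<dots> \<le> s * (\<kappa> * R + 1)" using s by simp
      also have "\<dots> < d" using s \<kappa> R by (simp add: pos_less_divide_eq add_nonneg_pos)
      finally have yd: "norm y < d" .
      have "norm y \<le> \<kappa> * R * s"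
        unfolding ny using PR \<kappa> s by (simp add: mult.commute mult.left_commute)
      then have y2: "(norm y)\<^sup>2 \<le> (\<kappa> * R)\<^sup>2 * s\<^sup>2"
        using power_mono[of "norm y" "\<kappa> * R * s" 2] by (simp add: power_mult_distrib)
      have 1: "W t0 x0 + a * (\<tau> - t0) + p \<bullet> y - K * ((\<tau> - t0)\<^sup>2 + (norm y)\<^sup>2) \<le> W \<tau> (x0 + y)"
        using below[of \<tau> "x0 + y"] yd s by (simp add: \<tau>_def)
      have 2: "W \<tau> (x0 + y) \<le> \<phi> (x0 + y)" by (rule W_le[OF \<phi>])
      have 3: "\<phi> (x0 + y) \<le> \<phi> x0 + P \<bullet> y + hess t0 * (norm y)\<^sup>2"
      proof -
        have "hess \<tau> \<le> hess t0"
          unfolding hess_def using Q_finite[OF _ t0(2)] t0(1) \<tau>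
          by (intro enn2real_mono Q_mono_time) simp_all
        then have "hess \<tau> * (norm y)\<^sup>2 \<le> hess t0 * (norm y)\<^sup>2" by (rule mult_right_mono) simp
        then show ?thesis
          using C2_class_taylor[OF \<phi>C, of "x0 + y" x0] by (simp add: P_def abs_le_iff)
      qed
      have 4: "P \<bullet> y - p \<bullet> y = - (\<kappa> * s * (norm (P - p))\<^sup>2)"
      proof -
        have "P \<bullet> y - p \<bullet> y = (P - p) \<bullet> y" by (simp add: inner_diff_left)
        then show ?thesis by (simp add: y_def dot_square_norm)
      qed
      have 5: "a * (\<tau> - t0) = - a * s" "(\<tau> - t0)\<^sup>2 = s\<^sup>2" by (simp_all add: \<tau>_def)
      have 6: "(K + hess t0) * (norm y)\<^sup>2 \<le> (K + hess t0) * ((\<kappa> * R)\<^sup>2 * s\<^sup>2)"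
        using K hess_nonneg by (intro mult_left_mono y2) simp
      have "- a * s - K * s\<^sup>2 \<le> s * H (\<tau>, x0, P) + M * s\<^sup>2 - \<kappa> * s * (norm (P - p))\<^sup>2
          + (K + hess t0) * ((\<kappa> * R)\<^sup>2 * s\<^sup>2)"
        using 1 2 3 4 6 up unfolding 5 by (simp add: algebra_simps)
      then have "s * (- a) \<le> s * (H (\<tau>, x0, P) - \<kappa> * (norm (P - p))\<^sup>2 + (N - c) * s)"
        by (simp add: N_def algebra_simps power2_eq_square)
      then have 7: "- a \<le> H (\<tau>, x0, P) - \<kappa> * (norm (P - p))\<^sup>2 + (N - c) * s"
        by (simp only: mult_le_cancel_left_pos[OF s(1)])
      have 8: "\<bar>H (t0, x0, p) - H (\<tau>, x0, P)\<bar> \<le> c * (s + norm (P - p))"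
      proof -
        have "norm p \<le> R" "norm P \<le> R"
          using P \<Lambda> norm_ge_zero[of p] unfolding R_def by linarith+
        from H_lipschitz[OF this, of t0 x0 \<tau> x0] s show ?thesis
          by (simp add: \<tau>_def c_def norm_minus_commute)
      qed
      have 9: "c * norm (P - p) \<le> \<kappa> * (norm (P - p))\<^sup>2 + c\<^sup>2 / \<kappa>"
      proof -
        have "0 \<le> (\<kappa> * norm (P - p) - c)\<^sup>2 + \<kappa> * norm (P - p) * c"
          using \<kappa> c by simp
        then have "\<kappa> * (c * norm (P - p)) \<le> \<kappa> * (\<kappa> * (norm (P - p))\<^sup>2) + c\<^sup>2"
          by (simp add: power2_eq_square algebra_simps)
        also have "\<dots> = \<kappa> * (\<kappa> * (norm (P - p))\<^sup>2 + c\<^sup>2 / \<kappa>)"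
          using \<kappa> by (simp add: distrib_left)
        finally show ?thesis using \<kappa> by simp
      qed
      from 7 8 9 show ?thesis by (simp add: algebra_simps abs_le_iff)
    qed
    have "- (a + H (t0, x0, p)) - c\<^sup>2 / \<kappa> \<le> 0"
    proof (rule nonpos_if_le_linear)
      show "0 < min (min d t0) (d / (\<kappa> * R + 1))" using d t0 \<kappa> R by (simp add: add_nonneg_pos)
    qed (rule lin)
    then show ?thesis by simp
  qed
  \<comment> \<open>The limit of large \<open>\<kappa>\<close>, with
    \<open>\<kappa> = 1 / r\<close>.\<close>
  have "- (a + H (t0, x0, p)) \<le> c\<^sup>2 * r" if "0 < r" "r < 1" for r
    using main[of "1 / r"] that by simp
  from nonpos_if_le_linear[OF zero_less_one this] show ?thesis by simp
qed

text \<open>\<open>Y\<close> stands for the order relation of a contact, from above or from below,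
  so that both cases share one neighbourhood. Only \<open>s \<le> t0\<close> is kept, as the
  estimates on \<open>W\<close> look backward in time.\<close>

lemma test_function_expansion:
  fixes \<phi> :: "real \<times> 'a \<Rightarrow> real"
  assumes \<phi>: "smooth_on ({0<..} \<times> UNIV) \<phi>" and z: "0 < t0"
    and ev: "\<forall>\<^sub>F y in nhds (t0, x0). Y y"
  obtains K d where "0 \<le> K" "0 < d"
    and "\<And>s x. \<lbrakk>t0 - d < s; s \<le> t0; norm (x - x0) < d\<rbrakk> \<Longrightarrow> Y (s, x) \<and>
      \<bar>\<phi> (s, x) - (\<phi> (t0, x0) + fst (grad \<phi> (t0, x0)) * (s - t0) + snd (grad \<phi> (t0, x0)) \<bullet> (x - x0))\<bar>
        \<le> K * ((s - t0)\<^sup>2 + (norm (x - x0))\<^sup>2)"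
proof -
  have C2: "C2_on ({0<..} \<times> UNIV) \<phi>" using \<phi> by (simp add: smooth_on_def)
  have op: "open ({0<..} \<times> UNIV :: (real \<times> 'a) set)" by (intro open_Times) simp_all
  obtain K d1 where K: "0 \<le> K" "0 < d1" "\<And>y. dist (t0, x0) y < d1 \<Longrightarrow>
      \<bar>\<phi> y - \<phi> (t0, x0) - grad \<phi> (t0, x0) \<bullet> (y - (t0, x0))\<bar> \<le> K * (norm (y - (t0, x0)))\<^sup>2"
    using C2_on_local_taylor[OF C2 op, of "(t0, x0)"] z by auto
  obtain d2 where d2: "0 < d2" "\<And>y. dist y (t0, x0) < d2 \<Longrightarrow> Y y"
    using ev unfolding eventually_nhds_metric by blast
  define d where "d = min d1 d2 / 2"
  show ?thesis
  proof (rule that[of K d])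
    show "0 < d" using K d2 by (simp add: d_def)
    fix s x assume s: "t0 - d < s" "s \<le> t0" "norm (x - x0) < d"
    have "dist (s, x) (t0, x0) \<le> \<bar>s - t0\<bar> + norm (x - x0)"
      using norm_Pair_le[of "s - t0" "x - x0"] by (simp add: dist_norm)
    also have "\<dots> < min d1 d2"
    proof -
      have "2 * d = min d1 d2" by (simp add: d_def)
      then show ?thesis using s by linarith
    qed
    finally have dist: "dist (s, x) (t0, x0) < min d1 d2" .
    have n: "(norm ((s, x) - (t0, x0)))\<^sup>2 = (s - t0)\<^sup>2 + (norm (x - x0))\<^sup>2"
      by (simp add: norm_Pair)
    have "grad \<phi> (t0, x0) \<bullet> ((s, x) - (t0, x0))
        = fst (grad \<phi> (t0, x0)) * (s - t0) + snd (grad \<phi> (t0, x0)) \<bullet> (x - x0)"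
      by (simp add: inner_prod_def)
    with K(3)[of "(s, x)"] dist n d2(2)[of "(s, x)"] s
    show "Y (s, x) \<and>
      \<bar>\<phi> (s, x) - (\<phi> (t0, x0) + fst (grad \<phi> (t0, x0)) * (s - t0) + snd (grad \<phi> (t0, x0)) \<bullet> (x - x0))\<bar>
        \<le> K * ((s - t0)\<^sup>2 + (norm (x - x0))\<^sup>2)"
      by (simp add: dist_commute diff_diff_eq add.assoc)
  qed (rule K)
qed

text \<open>Beyond \<open>T\<close> the property is local and inherited from \<open>V\<close>. Up to
  and including \<open>T\<close> the two estimates on \<open>W\<close> use the contact at earlier
  times only, so nothing has to be matched at the junction \<open>t0 = T\<close>.\<close>

lemma extended_viscosity_solution:
  assumes T: "0 < T" "ereal T < life"
  shows "viscosity_solution_on H ({0<..} \<times> UNIV) (extended T)"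
proof -
  have T0: "0 \<le> T" using T by simp
  have "viscosity_cauchy_solution H T (W T) (\<lambda>(t, x). V T t (W T) x)"
    using V is_lipschitzI[OF W_lipschitz[OF T0 T(2)]] by (simp add: viscosity_resolution_def)
  then have V_sol: "viscosity_solution_on H ({T<..} \<times> UNIV) (\<lambda>(t, x). V T t (W T) x)"
    by (simp add: viscosity_cauchy_solution_def)
  have smooth: "smooth_on ({T<..} \<times> UNIV) \<phi>" if "smooth_on ({0<..} \<times> UNIV) \<phi>" for \<phi> :: "real \<times> 'a \<Rightarrow> real"
    using that T by (auto simp: smooth_on_def intro: higher_differentiable_on_subset)
  have agree: "\<forall>\<^sub>F y in nhds z. extended T y = (case y of (t, x) \<Rightarrow> V T t (W T) x)"
    if "z \<in> {T<..} \<times> UNIV" for z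
  proof (rule eventually_nhds_in_open[THEN eventually_mono])
    show "open ({T<..} \<times> UNIV :: (real \<times> 'a) set)" by (intro open_Times) simp_all
    show "z \<in> {T<..} \<times> UNIV" by fact
    show "extended T y = (case y of (t, x) \<Rightarrow> V T t (W T) x)" if "y \<in> {T<..} \<times> UNIV" for y
      using that by (auto simp: extended_def)
  qed
  show ?thesis
    unfolding viscosity_solution_on_def
  proof (intro conjI allI impI; (elim conjE)?)
    show "continuous_on ({0<..} \<times> UNIV) (extended T)"
      using extended_continuous[OF T0 T(2)] by (rule continuous_on_subset) auto
  next
    fix \<phi> z assume \<phi>: "smooth_on ({0<..} \<times> UNIV) \<phi>" and z: "z \<in> {0<..} \<times> (UNIV :: 'a set)"
      and c: "contact_above \<phi> (extended T) z"
    obtain t0 x0 where z_eq: "z = (t0, x0)" by (cases z)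
    have t0: "0 < t0" using z z_eq by simp
    show "HJ H \<phi> z \<le> 0"
    proof (cases "t0 \<le> T")
      case True
      define a where "a = fst (grad \<phi> (t0, x0))"
      define p where "p = snd (grad \<phi> (t0, x0))"
      have eq: "\<phi> (t0, x0) = W t0 x0" and ev: "\<forall>\<^sub>F y in nhds (t0, x0). extended T y \<le> \<phi> y"
        using c True by (simp_all add: contact_above_def z_eq extended_before)
      obtain K d where K: "0 \<le> K" "0 < d"
        and exp: "\<And>s x. \<lbrakk>t0 - d < s; s \<le> t0; norm (x - x0) < d\<rbrakk> \<Longrightarrow> extended T (s, x) \<le> \<phi> (s, x) \<and>
          \<bar>\<phi> (s, x) - (W t0 x0 + a * (s - t0) + p \<bullet> (x - x0))\<bar> \<le> K * ((s - t0)\<^sup>2 + (norm (x - x0))\<^sup>2)"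
        using test_function_expansion[OF \<phi> t0 ev] unfolding eq a_def p_def by blast
      have "a + H (t0, x0, p) \<le> 0"
      proof (rule W_subsolution[OF t0 life_less[OF T(2) True] K(2,1)])
        fix s x assume s: "t0 - d < s" "s \<le> t0" "norm (x - x0) < d"
        then have "extended T (s, x) = W s x" using True by (simp add: extended_before)
        then show "W s x \<le> W t0 x0 + a * (s - t0) + p \<bullet> (x - x0) + K * ((s - t0)\<^sup>2 + (norm (x - x0))\<^sup>2)"
          using exp[OF s] by linarith
      qed
      then show ?thesis by (simp add: HJ_def z_eq a_def p_def)
    next
      case False
      then have zT: "z \<in> {T<..} \<times> UNIV" using z_eq by simp
      have "contact_above \<phi> (\<lambda>(t, x). V T t (W T) x) z"
        using c contact_cong[OF agree[OF zT]] by simp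
      then show ?thesis
        using V_sol smooth[OF \<phi>] zT by (auto simp: viscosity_solution_on_def)
    qed
  next
    fix \<phi> z assume \<phi>: "smooth_on ({0<..} \<times> UNIV) \<phi>" and z: "z \<in> {0<..} \<times> (UNIV :: 'a set)"
      and c: "contact_below \<phi> (extended T) z"
    obtain t0 x0 where z_eq: "z = (t0, x0)" by (cases z)
    have t0: "0 < t0" using z z_eq by simp
    show "0 \<le> HJ H \<phi> z"
    proof (cases "t0 \<le> T")
      case True
      define a where "a = fst (grad \<phi> (t0, x0))"
      define p where "p = snd (grad \<phi> (t0, x0))"
      have eq: "\<phi> (t0, x0) = W t0 x0" and ev: "\<forall>\<^sub>F y in nhds (t0, x0). \<phi> y \<le> extended T y"
        using c True by (simp_all add: contact_below_def z_eq extended_before)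
      obtain K d where K: "0 \<le> K" "0 < d"
        and exp: "\<And>s x. \<lbrakk>t0 - d < s; s \<le> t0; norm (x - x0) < d\<rbrakk> \<Longrightarrow> \<phi> (s, x) \<le> extended T (s, x) \<and>
          \<bar>\<phi> (s, x) - (W t0 x0 + a * (s - t0) + p \<bullet> (x - x0))\<bar> \<le> K * ((s - t0)\<^sup>2 + (norm (x - x0))\<^sup>2)"
        using test_function_expansion[OF \<phi> t0 ev] unfolding eq a_def p_def by blast
      have "0 \<le> a + H (t0, x0, p)"
      proof (rule W_supersolution[OF t0 life_less[OF T(2) True] K(2,1)])
        fix s x assume s: "t0 - d < s" "s \<le> t0" "norm (x - x0) < d"
        then have "extended T (s, x) = W s x" using True by (simp add: extended_before)
        then show "W t0 x0 + a * (s - t0) + p \<bullet> (x - x0) - K * ((s - t0)\<^sup>2 + (norm (x - x0))\<^sup>2) \<le> W s x"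
          using exp[OF s] by linarith
      qed
      then show ?thesis by (simp add: HJ_def z_eq a_def p_def)
    next
      case False
      then have zT: "z \<in> {T<..} \<times> UNIV" using z_eq by simp
      have "contact_below \<phi> (\<lambda>(t, x). V T t (W T) x) z"
        using c contact_cong[OF agree[OF zT]] by simp
      then show ?thesis
        using V_sol smooth[OF \<phi>] zT by (auto simp: viscosity_solution_on_def)
    qed
  qed
qed

lemma extended_cauchy:
  assumes T: "0 < T" "ereal T < life"
  shows "viscosity_cauchy_solution H 0 u0 (extended T)"
  unfolding viscosity_cauchy_solution_def
proof (intro conjI allI impI)
  have T0: "0 \<le> T" using T by simp
  show "continuous_on ({0..} \<times> UNIV) (extended T)"
    by (rule extended_continuous[OF T0 T(2)])
  show "viscosity_solution_on H ({0<..} \<times> UNIV) (extended T)"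
    by (rule extended_viscosity_solution[OF T])
  show init: "extended T (0, x) = u0 x" for x
    using extended_before[OF T0] W_zero by simp
  fix T1 :: real assume T1: "0 < T1"
  define T' where "T' = max T T1"
  show "bounded ((\<lambda>(t, x). extended T (t, x) - u0 x) ` ({0<..<T1} \<times> UNIV))"
  proof (rule boundedI)
    fix y assume "y \<in> (\<lambda>(t, x). extended T (t, x) - u0 x) ` ({0<..<T1} \<times> UNIV)"
    then obtain t x where t: "0 < t" "t < T1" and y: "y = extended T (t, x) - u0 x" by auto
    have "\<bar>extended T (t, x) - extended T (0, x)\<bar> \<le> time_lip T T' * (t - 0)"
      using t by (intro extended_time[OF T0 T(2)]) (auto simp: T'_def)
    also have "\<dots> \<le> time_lip T T' * T'"
      using t time_lip_nonneg[OF T0] by (intro mult_left_mono) (auto simp: T'_def)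
    finally show "norm y \<le> time_lip T T' * T'" unfolding y init by simp
  qed
  have "(time_lip T T' + lip T')-lipschitz_on ({0<..<T1} \<times> UNIV) (extended T)"
    by (rule lipschitz_on_subset[OF extended_lipschitz[OF T0 T(2), of T']]) (auto simp: T'_def)
  moreover have "L-lipschitz_on ({0<..<T1} \<times> UNIV) (\<lambda>z. u0 (snd z))"
  proof (rule lipschitz_onI[OF _ L_nonneg])
    fix z z' :: "real \<times> 'a"
    have "dist (u0 (snd z)) (u0 (snd z')) \<le> L * dist (snd z) (snd z')"
      by (rule lipschitz_onD[OF u0_lipschitz]) simp_all
    also have "\<dots> \<le> L * dist z z'" by (intro mult_left_mono dist_snd_le L_nonneg)
    finally show "dist (u0 (snd z)) (u0 (snd z')) \<le> L * dist z z'" .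
  qed
  ultimately have "(time_lip T T' + lip T' + L)-lipschitz_on ({0<..<T1} \<times> UNIV) (\<lambda>z. extended T z - u0 (snd z))"
    by (rule lipschitz_on_diff)
  then show "\<exists>M. M-lipschitz_on ({0<..<T1} \<times> UNIV) (\<lambda>(t, x). extended T (t, x) - u0 x)"
    by (auto simp: case_prod_unfold)
qed

lemma W_eq_V:
  assumes T: "0 < T" "ereal T < life" and t: "0 \<le> t" "t \<le> T"
  shows "V 0 t u0 x = W t x"
  using V extended_cauchy[OF T] is_lipschitzI[OF u0_lipschitz] t extended_before[OF t(2), of x]
  unfolding viscosity_resolution_def by metis

section \<open>Semi-concavity and comparison of the two solutions\<close>

lemma convex_strip: "convex ({0..<T} \<times> UNIV :: (real \<times> 'a) set)"
  by (intro convex_Times) simp_all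

text \<open>The classical solution must start at the earlier time so that both end points lie in its
  domain, and \<open>W_backward\<close> then costs \<open>C * (fst m - fst z1)\<^sup>2\<close>. For
  weights \<open>a\<close> and \<open>b\<close> this would be \<open>C * b\<^sup>2\<close> times the
  squared time difference, which is not controlled by \<open>a * b\<close> as \<open>a\<close> tends
  to 0. Hence the detour through midpoints and continuity.\<close>

lemma viscosity_semi_concave:
  assumes T: "0 < T" "ereal T < life"
  shows "semi_concave_on ({0..<T} \<times> UNIV) (\<lambda>(t, x). V 0 t u0 x)"
proof -
  define K where "K = const T"
  define C where "C = shadow_const T + const T"
  \<comment> \<open>Taylor expansion costs \<open>K / 4\<close> and \<open>W_backward\<close> at
    most \<open>C / 4\<close> times the squared distance. The term
    \<open>M * (norm z)\<^sup>2 / 2\<close> compensates \<open>M / 8\<close> times the squared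
    distance at a midpoint.\<close>
  define M where "M = 2 * (K + C)"
  have T0: "0 \<le> T" using T by simp
  have K: "0 \<le> K" unfolding K_def by (rule const_nonneg[OF T0])
  have C: "0 \<le> C" using shadow_const_nonneg[OF T0] const_nonneg[OF T0] by (simp add: C_def)
  define F where "F z = W (fst z) (snd z) - M * (norm z)\<^sup>2 / 2" for z :: "real \<times> 'a"
  have *: "(F z1 + F z2) / 2 \<le> F ((1 / 2) *\<^sub>R (z1 + z2))"
    if z: "z1 \<in> {0..<T} \<times> UNIV" "z2 \<in> {0..<T} \<times> UNIV" and le: "fst z1 \<le> fst z2" for z1 z2
  proof -
    define m where "m = (1 / 2) *\<^sub>R (z1 + z2)"
    have fm: "fst m = (fst z1 + fst z2) / 2" by (simp add: m_def)
    have t: "0 \<le> fst z1" "fst z1 \<le> fst m" "fst m \<le> T" "fst z2 \<le> T"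
      using z le by (auto simp: fm mem_Times_iff)
    have "(W (fst z1) (snd z1) + W (fst z2) (snd z2)) / 2 \<le> W (fst m) (snd m) + M * (norm (z1 - z2))\<^sup>2 / 8"
    proof (rule field_le_epsilon)
      fix e :: real assume "0 < e"
      then obtain \<phi> where \<phi>: "reach (fst z1) \<phi>"
        and near: "V (fst z1) (fst m) \<phi> (snd m) \<le> W (fst m) (snd m) + C * (fst m - fst z1)\<^sup>2 + e"
        using W_backward[OF t(1,2,3) T(2)] unfolding C_def by blast
      obtain f where f: "regular_flow (fst z1) T (lip T) K \<phi> f"
        and eq: "\<And>r x. r \<in> {fst z1..T} \<Longrightarrow> f (r, x) = V (fst z1) r \<phi> x"
        using reach_flow[OF \<phi> _ T(2)] t unfolding K_def by (metis order.trans)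
      have W_f: "W (fst z) (snd z) \<le> f z" if "fst z1 \<le> fst z" "fst z \<le> T" for z
        using W_le[OF evolve[OF \<phi> that(1) life_less[OF T(2) that(2)]], of "snd z"]
          eq[of "fst z" "snd z"] that by simp
      have "(1 / 2) * f z1 + (1 / 2) * f z2 \<le> f ((1 / 2) *\<^sub>R z1 + (1 / 2) *\<^sub>R z2) + K * (1 / 2 * (1 / 2)) * (norm (z1 - z2))\<^sup>2"
        using t le by (intro regular_flow_semiconcave[OF f K]) (auto simp: mem_Times_iff)
      moreover have "(1 / 2) *\<^sub>R z1 + (1 / 2) *\<^sub>R z2 = m" by (simp add: m_def scaleR_add_right)
      moreover have "f m = V (fst z1) (fst m) \<phi> (snd m)"
        using eq[of "fst m" "snd m"] t by simp
      moreover have "C * (fst m - fst z1)\<^sup>2 \<le> C * ((norm (z1 - z2))\<^sup>2 / 4)"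
      proof (intro mult_left_mono C)
        have "\<bar>fst (z1 - z2)\<bar> \<le> norm (z1 - z2)"
          by (metis norm_fst_le prod.collapse real_norm_def)
        then have "\<bar>fst z1 - fst z2\<bar>\<^sup>2 \<le> (norm (z1 - z2))\<^sup>2" by (intro power_mono) simp_all
        then show "(fst m - fst z1)\<^sup>2 \<le> (norm (z1 - z2))\<^sup>2 / 4"
          by (simp add: fm power2_eq_square field_simps)
      qed
      ultimately show "(W (fst z1) (snd z1) + W (fst z2) (snd z2)) / 2
          \<le> W (fst m) (snd m) + M * (norm (z1 - z2))\<^sup>2 / 8 + e"
        using near W_f[of z1] W_f[of z2] t le by (simp add: M_def field_simps)
    qed
    moreover have "((norm z1)\<^sup>2 + (norm z2)\<^sup>2) / 2 - (norm m)\<^sup>2 = (norm (z1 - z2))\<^sup>2 / 4"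
      by (simp add: m_def power2_norm_eq_inner inner_add_left inner_add_right inner_diff_left
          inner_diff_right inner_commute field_simps)
    then have "M / 2 * (((norm z1)\<^sup>2 + (norm z2)\<^sup>2) / 2 - (norm m)\<^sup>2) = M / 2 * ((norm (z1 - z2))\<^sup>2 / 4)"
      by (simp only:)
    ultimately show ?thesis unfolding F_def m_def[symmetric] by (simp add: field_simps)
  qed
  have "concave_on ({0..<T} \<times> UNIV) F"
  proof (rule midpoint_concave_imp_concave[OF convex_strip])
    have "continuous_on ({0..<T} \<times> UNIV) (extended T)"
      using extended_continuous[OF T0 T(2)] by (rule continuous_on_subset) auto
    then have "continuous_on ({0..<T} \<times> UNIV) (\<lambda>z. W (fst z) (snd z))"
      by (rule continuous_on_eq) (auto simp: extended_def)
    then show "continuous_on ({0..<T} \<times> UNIV) F"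
      unfolding F_def by (intro continuous_intros) simp_all
    show "(F z1 + F z2) / 2 \<le> F ((1 / 2) *\<^sub>R (z1 + z2))"
      if "z1 \<in> {0..<T} \<times> UNIV" "z2 \<in> {0..<T} \<times> UNIV" for z1 z2
      using *[OF that] *[OF that(2,1)] by (cases "fst z1 \<le> fst z2") (simp_all add: add.commute)
  qed
  then have "concave_on ({0..<T} \<times> UNIV) (\<lambda>z. (case z of (t, x) \<Rightarrow> V 0 t u0 x) - M * (norm z)\<^sup>2 / 2)"
    by (rule concave_on_eq) (auto simp: F_def W_eq_V[OF T])
  then show ?thesis unfolding semi_concave_on_def by blast
qed

lemma variational_near:
  assumes "0 \<le> t" "ereal t < life" "0 < e"
  shows "\<exists>\<phi>. reach 0 \<phi> \<and> V 0 t \<phi> x \<le> G 0 t u0 x + e"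
  using G_W_near[OF order.refl assms] by (simp add: W_zero)

lemma viscosity_le_variational:
  assumes t: "0 \<le> t" "ereal t < life"
  shows "V 0 t u0 x \<le> G 0 t u0 x"
proof (rule field_le_epsilon)
  fix e :: real assume "0 < e"
  then obtain \<phi> where \<phi>: "reach 0 \<phi>" "V 0 t \<phi> x \<le> G 0 t u0 x + e"
    using variational_near[OF t] by blast
  have "V 0 t u0 x \<le> V 0 t \<phi> x"
    by (rule V_u0_le_reach[OF evolve[OF \<phi>(1) t]])
  with \<phi>(2) show "V 0 t u0 x \<le> G 0 t u0 x + e" by simp
qed

lemma variational_le_classical:
  assumes f: "classical_solution_on H (strip 0 life) f" "f0 \<in> F0" "\<And>x. f (0, x) = f0 x"
    and t: "0 \<le> t" "ereal t < life"
  shows "G 0 t u0 x \<le> f (t, x)"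
proof -
  have l: "L-lipschitz_on UNIV f0" using f(2) F0 C2_class_lipschitz by blast
  have "G 0 t u0 x \<le> G 0 t f0 x"
    using is_pointwise_inf_le[OF u0 f(2)] t
    by (intro evolution_mono[OF evolution_GV(1) u0_lipschitz l])
  also have "\<dots> = f (t, x)"
    using t by (intro classical_evolution[OF evolution_GV(1) f(1,3) l]) simp_all
  finally show ?thesis .
qed

text \<open>For each \<open>(t, x)\<close> the almost minimal classical solution starts at time 0,
  so the whole strip lies in its domain and no backward error occurs. Arbitrary weights are
  therefore treated directly, with constant \<open>2 * K\<close>.\<close>

lemma variational_semi_concave:
  assumes T: "0 < T" "ereal T < life"
  shows "semi_concave_on ({0..<T} \<times> UNIV) (\<lambda>(t, x). G 0 t u0 x)"
proof -
  define K where "K = const T"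
  have K: "0 \<le> K" unfolding K_def using T by (intro const_nonneg) simp
  have "concave_on ({0..<T} \<times> UNIV) (\<lambda>z. (case z of (t, x) \<Rightarrow> G 0 t u0 x) - (2 * K) * (norm z)\<^sup>2 / 2)"
    unfolding concave_on_iff
  proof (intro conjI ballI allI impI convex_strip)
    fix z1 z2 :: "real \<times> 'a" and a b :: real
    assume z: "z1 \<in> {0..<T} \<times> UNIV" "z2 \<in> {0..<T} \<times> UNIV" and ab: "0 \<le> a" "0 \<le> b" "a + b = 1"
    define g where "g z = G 0 (fst z) u0 (snd z)" for z
    define m where "m = a *\<^sub>R z1 + b *\<^sub>R z2"
    have m: "m \<in> {0..<T} \<times> UNIV"
      unfolding m_def using convex_strip z ab by (rule convexD)
    have "a * g z1 + b * g z2 \<le> g m + K * (a * b) * (norm (z1 - z2))\<^sup>2"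
    proof (rule field_le_epsilon)
      fix e :: real assume "0 < e"
      moreover have "0 \<le> fst m" "ereal (fst m) < life"
        using m life_less[OF T(2), of "fst m"] by (auto simp: mem_Times_iff)
      ultimately obtain \<phi> where \<phi>: "reach 0 \<phi>" and near: "V 0 (fst m) \<phi> (snd m) \<le> g m + e"
        using variational_near unfolding g_def by blast
      obtain f where f: "regular_flow 0 T (lip T) K \<phi> f"
        and eq: "\<And>r x. r \<in> {0..T} \<Longrightarrow> f (r, x) = V 0 r \<phi> x"
        using reach_flow[OF \<phi> _ T(2)] T unfolding K_def by (metis less_imp_le)
      have g_f: "g z \<le> f z" if "z \<in> {0..<T} \<times> UNIV" for z
        using that G_W_le[OF \<phi>, of "fst z" "snd z"] life_less[OF T(2), of "fst z"]
          eq[of "fst z" "snd z"]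
        by (auto simp: g_def W_zero mem_Times_iff)
      have "a * g z1 + b * g z2 \<le> a * f z1 + b * f z2"
        using ab z by (intro add_mono mult_left_mono g_f)
      also have "\<dots> \<le> f m + K * (a * b) * (norm (z1 - z2))\<^sup>2"
        unfolding m_def using z by (intro regular_flow_semiconcave[OF f K _ _ ab]) (auto simp: mem_Times_iff)
      also have "f m \<le> g m + e"
        using near eq[of "fst m" "snd m"] m by (auto simp: mem_Times_iff)
      finally show "a * g z1 + b * g z2 \<le> g m + K * (a * b) * (norm (z1 - z2))\<^sup>2 + e" by simp
    qed
    moreover have "a * (norm z1)\<^sup>2 + b * (norm z2)\<^sup>2 - (norm m)\<^sup>2 = a * b * (norm (z1 - z2))\<^sup>2"
    proof -
      have a: "a = 1 - b" using ab by simp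
      show ?thesis
        unfolding m_def a
        by (simp add: power2_norm_eq_inner inner_add_left inner_add_right inner_diff_left
            inner_diff_right inner_commute algebra_simps)
    qed
    then have "K * (a * (norm z1)\<^sup>2 + b * (norm z2)\<^sup>2 - (norm m)\<^sup>2) = K * (a * b * (norm (z1 - z2))\<^sup>2)"
      by (simp only:)
    ultimately have "a * (g z1 - K * (norm z1)\<^sup>2) + b * (g z2 - K * (norm z2)\<^sup>2) \<le> g m - K * (norm m)\<^sup>2"
      by (simp add: algebra_simps)
    then show "a * ((case z1 of (t, x) \<Rightarrow> G 0 t u0 x) - (2 * K) * (norm z1)\<^sup>2 / 2) +
        b * ((case z2 of (t, x) \<Rightarrow> G 0 t u0 x) - (2 * K) * (norm z2)\<^sup>2 / 2)
        \<le> (case a *\<^sub>R z1 + b *\<^sub>R z2 of (t, x) \<Rightarrow> G 0 t u0 x) - (2 * K) * (norm (a *\<^sub>R z1 + b *\<^sub>R z2))\<^sup>2 / 2"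
      by (simp add: g_def m_def case_prod_unfold)
  qed
  then show ?thesis unfolding semi_concave_on_def by blast
qed

end

theorem theorem1:
  fixes H :: "('a::euclidean_space) hamiltonian"
    and A B :: real
    and Q :: "real \<Rightarrow> ennreal \<Rightarrow> ennreal"
    and G V :: "'a evolution"
    and F0 :: "('a \<Rightarrow> real) set"
    and F :: "(real \<times> 'a \<Rightarrow> real) set"
    and u0 :: "'a \<Rightarrow> real"
    and v g :: "real \<times> 'a \<Rightarrow> real"
  assumes H: "admissible_hamiltonian H A"
    and Q: "hessian_growth H A Q"
    and G: "variational_resolution H A G"
    and V: "viscosity_resolution H A V"
    and F0_C2: "\<And>f0. f0 \<in> F0 \<Longrightarrow> C2_on UNIV f0"
    and F0_equi_lipschitz: "\<exists>L. \<forall>f0\<in>F0. L-lipschitz_on UNIV f0"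
    and F0_hessian: "\<And>f0 x. f0 \<in> F0 \<Longrightarrow> d2_norm f0 x \<le> B"
    and u0: "\<And>x. ereal (u0 x) = (INF f0\<in>F0. ereal (f0 x))"
    and F: "F = {f. classical_solution_on H (strip 0 (lifespan Q (ennreal B))) f \<and>
                    (\<exists>f0\<in>F0. \<forall>x. f (0, x) = f0 x)}"
    and v: "v = (\<lambda>(t, x). V 0 t u0 x)"
    and g: "g = (\<lambda>(t, x). G 0 t u0 x)"
  shows "(\<forall>T. 0 < T \<and> ereal T < lifespan Q (ennreal B) \<longrightarrow>
            semi_concave_on ({0..<T} \<times> UNIV) v \<and> semi_concave_on ({0..<T} \<times> UNIV) g) \<and>
         (\<forall>t x. 0 \<le> t \<and> ereal t < lifespan Q (ennreal B) \<longrightarrow>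
            v (t, x) \<le> g (t, x) \<and> ereal (g (t, x)) \<le> (INF f\<in>F. ereal (f (t, x))))"
proof -
  obtain L where L: "\<forall>f0\<in>F0. L-lipschitz_on UNIV f0"
    using F0_equi_lipschitz by blast
  have "F0 \<noteq> {}"
  proof
    \<comment> \<open>The infimum over the empty family is infinite, against the finite values of
      \<open>u0\<close>.\<close>
    assume "F0 = {}"
    then show False using u0[of 0] by (simp add: top_ereal_def)
  qed
  then obtain f0 where f0: "f0 \<in> F0" by blast
  have B: "0 \<le> B"
    using d2_norm_nonneg[OF F0_C2[OF f0], of 0] F0_hessian[OF f0, of 0] by simp
  have F0_class: "F0 \<subseteq> C2_class B L"
    using F0_C2 F0_hessian L by (auto simp: C2_class_def)
  have inf: "is_pointwise_inf F0 u0"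
    unfolding is_pointwise_inf_def
  proof (intro conjI ballI allI impI)
    show "u0 x \<le> f x" if "f \<in> F0" for f x
    proof -
      have "ereal (u0 x) \<le> ereal (f x)" unfolding u0 using that by (rule INF_lower)
      then show ?thesis by simp
    qed
    show "\<exists>f\<in>F0. f x \<le> u0 x + e" if "0 < e" for x and e :: real
    proof -
      have "(INF f0\<in>F0. ereal (f0 x)) < ereal (u0 x + e)" using that by (simp flip: u0)
      then obtain f where "f \<in> F0" "ereal (f x) < ereal (u0 x + e)" unfolding INF_less_iff by blast
      then show ?thesis by (intro bexI[of _ f]) simp_all
    qed
  qed
  interpret semiconcave_cauchy H A Q G V F0 u0 B L
    by unfold_locales (fact H Q G V F0_class B inf)+
  show ?thesis
  proof (intro conjI allI impI; elim conjE)
    show "semi_concave_on ({0..<T} \<times> UNIV) v" if "0 < T" "ereal T < life" for T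
      unfolding v by (rule viscosity_semi_concave[OF that])
    show "semi_concave_on ({0..<T} \<times> UNIV) g" if "0 < T" "ereal T < life" for T
      unfolding g by (rule variational_semi_concave[OF that])
    show "v (t, x) \<le> g (t, x)" if "0 \<le> t" "ereal t < life" for t x
      unfolding v g using viscosity_le_variational[OF that] by simp
    show "ereal (g (t, x)) \<le> (INF f\<in>F. ereal (f (t, x)))" if "0 \<le> t" "ereal t < life" for t x
    proof (rule INF_greatest)
      fix f assume "f \<in> F"
      then obtain f0 where "classical_solution_on H (strip 0 life) f" "f0 \<in> F0" "\<forall>x. f (0, x) = f0 x"
        unfolding F by blast
      then show "ereal (g (t, x)) \<le> ereal (f (t, x))"
        unfolding g using variational_le_classical[of f f0 t x] that by simp
    qed
  qed
qed

end
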